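(* Let $n \ge 1$ and let $\lambda$ and $\mu$ be partitions of $n$. If $\chi^\lambda(g) = \chi^\mu(g)$ for all $2'$-elements $g$ of $S_n$ (that is, all elements of odd order), then either $\lambda = \mu$ or $\lambda = \mu'$, where $\mu'$ is the conjugate partition of $\mu$.
   Context: For a partition $\lambda$ of $n$, $\chi^\lambda$ denotes the ordinary irreducible character of the symmetric group $S_n$ afforded by the Specht module $S^\lambda$ over a field of characteristic zero. The conjugate $\mu'$ is the partition whose Young diagram is the transpose of that of $\mu$. *)

theory Defs
  imports
    "HOL-Algebra.Sym_Groups"
    "HOL-Algebra.Multiplicative_Group"
    "HOL-Library.Function_Algebras"
begin

section \<open>Partitions\<close>

definition partition_of :: "nat list \<Rightarrow> nat \<Rightarrow> bool" where
  "partition_of lam n \<longleftrightarrow> sorted_wrt (\<ge>) lam \<and> (\<forall>k \<in> set lam. 0 < k) \<and> sum_list lam = n"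

text \<open>Cells are (row, column), both counted from 0.\<close>

definition young_diagram :: "nat list \<Rightarrow> (nat \<times> nat) set" where
  "young_diagram lam = {(i, j). i < length lam \<and> j < lam ! i}"

text \<open>The parts of the conjugate partition are the column lengths.\<close>

definition conjugate :: "nat list \<Rightarrow> nat list" where
  "conjugate mu =
     map (\<lambda>j. card {i. (i, j) \<in> young_diagram mu}) [0..<(if mu = [] then 0 else hd mu)]"

lemma finite_young_diagram: "finite (young_diagram lam)"
proof (rule finite_subset)
  show "young_diagram lam \<subseteq> (\<Union>i<length lam. {i} \<times> {..<lam ! i})"
    by (auto simp: young_diagram_def)
qed auto

lemma card_young_diagram: "card (young_diagram lam) = sum_list lam"
proof -
  have "young_diagram lam = (SIGMA i:{..<length lam}. {..<lam ! i})"
    by (auto simp: young_diagram_def)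
  then have "card (young_diagram lam) = (\<Sum>i<length lam. lam ! i)"
    by simp
  then show ?thesis
    by (simp add: sum_list_sum_nth atLeast0LessThan)
qed

lemma young_diagram_down_closed:
  assumes "sorted_wrt (\<ge>) lam" "(i, j) \<in> young_diagram lam" "i' \<le> i" "j' \<le> j"
  shows "(i', j') \<in> young_diagram lam"
proof -
  have "lam ! i \<le> lam ! i'"
    using assms(1-3) by (cases "i' = i") (auto simp: sorted_wrt_iff_nth_less young_diagram_def)
  then show ?thesis using assms(2-4) by (auto simp: young_diagram_def)
qed

lemma column_eq_lessThan:
  assumes "sorted_wrt (\<ge>) lam"
  shows "{i. (i, j) \<in> young_diagram lam} = {..<card {i. (i, j) \<in> young_diagram lam}}"
    (is "?C = _")
proof -
  have fin: "finite ?C"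
    by (rule finite_subset[of _ "{..<length lam}"]) (auto simp: young_diagram_def)
  have dc: "i' \<in> ?C" if "i \<in> ?C" "i' \<le> i" for i i'
    using young_diagram_down_closed[OF assms, of i j i' j] that by auto
  have "\<exists>m. ?C = {..<m}"
  proof (cases "?C = {}")
    case True
    then show ?thesis by (intro exI[of _ 0]) simp
  next
    case False
    have "?C = {..<Suc (Max ?C)}"
    proof
      show "?C \<subseteq> {..<Suc (Max ?C)}" using fin by (auto simp: less_Suc_eq_le)
      show "{..<Suc (Max ?C)} \<subseteq> ?C"
      proof
        fix i assume "i \<in> {..<Suc (Max ?C)}"
        then show "i \<in> ?C" by (intro dc[OF Max_in[OF fin False]]) simp
      qed
    qed
    then show ?thesis by blast
  qed
  then show ?thesis by (metis card_lessThan)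
qed

lemma young_diagram_conjugate:
  assumes "sorted_wrt (\<ge>) mu"
  shows "young_diagram (conjugate mu) = {(j, i). (i, j) \<in> young_diagram mu}"
proof -
  have "(j, i) \<in> young_diagram (conjugate mu) \<longleftrightarrow> (i, j) \<in> young_diagram mu" for i j
  proof -
    have *: "(i, j) \<in> young_diagram mu \<longleftrightarrow> i < card {i. (i, j) \<in> young_diagram mu}"
      using column_eq_lessThan[OF assms, of j] by blast
    have "j < (if mu = [] then 0 else hd mu)" if "(i, j) \<in> young_diagram mu"
      using young_diagram_down_closed[OF assms that, of 0 j]
      by (auto simp: young_diagram_def hd_conv_nth)
    then show ?thesis
      using * by (subst young_diagram_def) (auto simp: conjugate_def)
  qed
  then show ?thesis by auto
qed

lemma partition_of_conjugate:
  assumes "partition_of mu n"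
  shows "partition_of (conjugate mu) n"
proof -
  have s: "sorted_wrt (\<ge>) mu" using assms unfolding partition_of_def by blast
  let ?col = "\<lambda>j. {i. (i, j) \<in> young_diagram mu}"
  have fin: "finite (?col j)" for j
    by (rule finite_subset[of _ "{..<length mu}"]) (auto simp: young_diagram_def)
  have "sorted_wrt (\<ge>) (conjugate mu)"
    unfolding sorted_wrt_iff_nth_less
  proof (intro allI impI)
    fix j k assume "j < k" "k < length (conjugate mu)"
    moreover have "?col k \<subseteq> ?col j"
    proof
      fix i assume "i \<in> ?col k"
      then show "i \<in> ?col j"
        using young_diagram_down_closed[OF s, of i k i j] \<open>j < k\<close> by simp
    qed
    then have "card (?col k) \<le> card (?col j)" by (rule card_mono[OF fin])
    ultimately show "conjugate mu ! k \<le> conjugate mu ! j" by (simp add: conjugate_def)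
  qed
  moreover have "0 < k" if k: "k \<in> set (conjugate mu)" for k
  proof -
    from k obtain j where j: "j < (if mu = [] then 0 else hd mu)" "k = card (?col j)"
      by (auto simp: conjugate_def)
    then have "0 \<in> ?col j" by (auto simp: young_diagram_def hd_conv_nth split: if_splits)
    with fin[of j] show ?thesis using j(2) card_gt_0_iff by blast
  qed
  moreover have "sum_list (conjugate mu) = n"
  proof -
    have "young_diagram (conjugate mu) = prod.swap ` young_diagram mu"
      using young_diagram_conjugate[OF s] by (force simp: image_iff)
    then have "card (young_diagram (conjugate mu)) = card (young_diagram mu)"
      by (simp add: card_image)
    then show ?thesis using assms by (simp add: card_young_diagram partition_of_def)
  qed
  ultimately show ?thesis by (auto simp: partition_of_def)
qed


section \<open>The trace of an endomorphism of a subspace\<close>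

context vector_space
begin

lemma diagonal_sum_basis_independent:
  assumes B: "independent B" "finite B" "span B = V"
    and C: "independent C" "finite C" "span C = V"
    and f: "Vector_Spaces.linear scale scale f" "f ` V \<subseteq> V"
  shows "(\<Sum>b\<in>B. representation B (f b) b) = (\<Sum>c\<in>C. representation C (f c) c)"
proof -
  interpret f: Vector_Spaces.linear scale scale f by (fact f(1))
  have inV: "b \<in> V" "f b \<in> V" if "b \<in> B \<union> C" for b
    using that f(2) span_superset[of B] span_superset[of C] B(3) C(3) by auto
  have exp: "(\<Sum>e\<in>E. scale (representation E v e) e) = v"
    if "independent E" "finite E" "span E = V" "v \<in> V" for E v
    by (rule sum_representation_eq) (use that in auto)
  have "(\<Sum>b\<in>B. representation B (f b) b)
      = (\<Sum>b\<in>B. \<Sum>c\<in>C. representation C b c * representation B (f c) b)"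
  proof (rule sum.cong[OF refl])
    fix b assume b: "b \<in> B"
    have "f b = f (\<Sum>c\<in>C. scale (representation C b c) c)"
      using exp[OF C inV(1)] b by simp
    also have "\<dots> = (\<Sum>c\<in>C. scale (representation C b c) (f c))"
      by (simp add: f.sum f.scale)
    finally have "representation B (f b)
        = representation B (\<Sum>c\<in>C. scale (representation C b c) (f c))"
      by simp
    also have "\<dots> = (\<lambda>x. \<Sum>c\<in>C. representation B (scale (representation C b c) (f c)) x)"
      using B C inV by (intro representation_sum) (auto intro!: span_scale)
    also have "\<dots> = (\<lambda>x. \<Sum>c\<in>C. representation C b c * representation B (f c) x)"
      using B inV by (intro ext sum.cong refl) (simp add: representation_scale)
    finally show "representation B (f b) b
        = (\<Sum>c\<in>C. representation C b c * representation B (f c) b)" by simp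
  qed
  also have "\<dots> = (\<Sum>c\<in>C. \<Sum>b\<in>B. representation B (f c) b * representation C b c)"
    by (subst sum.swap) (simp add: mult.commute)
  also have "\<dots> = (\<Sum>c\<in>C. representation C (f c) c)"
  proof (rule sum.cong[OF refl])
    fix c assume c: "c \<in> C"
    have "representation C (f c)
        = representation C (\<Sum>b\<in>B. scale (representation B (f c) b) b)"
      using exp[OF B inV(2)] c by simp
    also have "\<dots> = (\<lambda>x. \<Sum>b\<in>B. representation C (scale (representation B (f c) b) b) x)"
      using B C inV by (intro representation_sum) (auto intro!: span_scale)
    also have "\<dots> = (\<lambda>x. \<Sum>b\<in>B. representation B (f c) b * representation C b x)"
      using C inV by (intro ext sum.cong refl) (simp add: representation_scale)
    finally show "(\<Sum>b\<in>B. representation B (f c) b * representation C b c)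
        = representation C (f c) c" by simp
  qed
  finally show ?thesis .
qed

end

definition fscale :: "'k::field \<Rightarrow> ('a \<Rightarrow> 'k) \<Rightarrow> 'a \<Rightarrow> 'k" where
  "fscale c v = (\<lambda>x. c * v x)"

global_interpretation fun_space: vector_space fscale
  by standard (auto simp: fscale_def algebra_simps)

text \<open>
  The basis is chosen arbitrarily; by \<open>trace_on_eq\<close> below, every basis gives the same
  value when \<open>f\<close> restricts to a linear endomorphism of a finite-dimensional space \<open>V\<close>.
\<close>

definition trace_on :: "('a \<Rightarrow> 'k::field) set \<Rightarrow> (('a \<Rightarrow> 'k) \<Rightarrow> 'a \<Rightarrow> 'k) \<Rightarrow> 'k" where
  "trace_on V f =
     (let B = (SOME B. fun_space.independent B \<and> fun_space.span B = V)
      in \<Sum>b\<in>B. fun_space.representation B (f b) b)"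

lemma trace_on_eq:
  assumes B: "fun_space.independent B" "finite B" "fun_space.span B = V"
    and f: "Vector_Spaces.linear fscale fscale f" "f ` V \<subseteq> V"
  shows "trace_on V f = (\<Sum>b\<in>B. fun_space.representation B (f b) b)"
proof -
  define C where "C = (SOME C. fun_space.independent C \<and> fun_space.span C = V)"
  have C: "fun_space.independent C" "fun_space.span C = V"
    using someI[of "\<lambda>C. fun_space.independent C \<and> fun_space.span C = V" B] B
    by (auto simp: C_def)
  moreover have "finite C"
    using fun_space.independent_span_bound[OF B(2) C(1)] fun_space.span_superset[of C] B(3) C(2)
    by auto
  ultimately show ?thesis
    using fun_space.diagonal_sum_basis_independent[OF C(1) _ C(2) B f]
    by (simp add: trace_on_def C_def)
qed


section \<open>Specht modules\<close>

definition tableau :: "nat list \<Rightarrow> (nat \<times> nat \<Rightarrow> nat) \<Rightarrow> bool" where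
  "tableau lam t \<longleftrightarrow> bij_betw t (young_diagram lam) {1..sum_list lam}"

text \<open>
  A tabloid, that is, a row-equivalence class of tableaux, is encoded by its sequence of
  (unordered) rows: two tableaux are row equivalent iff corresponding rows have the same entries.
\<close>

definition tabloid :: "nat list \<Rightarrow> (nat \<times> nat \<Rightarrow> nat) \<Rightarrow> nat \<Rightarrow> nat set" where
  "tabloid lam t = (\<lambda>i. {t (i, j) |j. (i, j) \<in> young_diagram lam})"

definition column :: "nat list \<Rightarrow> (nat \<times> nat \<Rightarrow> nat) \<Rightarrow> nat \<Rightarrow> nat set" where
  "column lam t j = {t (i, j) |i. (i, j) \<in> young_diagram lam}"

definition column_stabilizer :: "nat list \<Rightarrow> (nat \<times> nat \<Rightarrow> nat) \<Rightarrow> (nat \<Rightarrow> nat) set" where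
  "column_stabilizer lam t =
     {\<sigma> \<in> carrier (sym_group (sum_list lam)). \<forall>j. \<sigma> ` column lam t j = column lam t j}"

text \<open>
  The permutation module on tabloids sits inside the space of all \<open>'k\<close>-valued functions on
  sequences of rows, as the functions supported on tabloids; \<open>basis_vector T\<close> is the basis
  element corresponding to the tabloid \<open>T\<close>.
\<close>

definition basis_vector :: "'a \<Rightarrow> 'a \<Rightarrow> 'k::field" where
  "basis_vector T = (\<lambda>T'. of_bool (T' = T))"

definition polytabloid ::
    "nat list \<Rightarrow> (nat \<times> nat \<Rightarrow> nat) \<Rightarrow> (nat \<Rightarrow> nat set) \<Rightarrow> 'k::field" where
  "polytabloid lam t =
     (\<Sum>\<sigma> \<in> column_stabilizer lam t.
        fscale (of_int (sign \<sigma>)) (basis_vector (tabloid lam (\<sigma> \<circ> t))))"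

definition specht_module :: "nat list \<Rightarrow> ((nat \<Rightarrow> nat set) \<Rightarrow> 'k::field) set" where
  "specht_module lam = fun_space.span {polytabloid lam t |t. tableau lam t}"

text \<open>
  The linear action of \<open>g\<close> sends the basis vector of \<open>T\<close> to that of
  \<open>\<lambda>i. g ` T i\<close>; hence the inverse in the definition.
\<close>

definition perm_action ::
    "(nat \<Rightarrow> nat) \<Rightarrow> ((nat \<Rightarrow> nat set) \<Rightarrow> 'k::field) \<Rightarrow> (nat \<Rightarrow> nat set) \<Rightarrow> 'k" where
  "perm_action g v = (\<lambda>T. v (\<lambda>i. Hilbert_Choice.inv g ` T i))"

definition specht_character :: "nat list \<Rightarrow> (nat \<Rightarrow> nat) \<Rightarrow> 'k::field_char_0" where
  "specht_character lam g = trace_on (specht_module lam) (perm_action g)"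

lemma perm_action_linear: "Vector_Spaces.linear fscale fscale (perm_action g)"
  by unfold_locales (auto simp: perm_action_def fscale_def algebra_simps)

lemma perm_action_basis_vector:
  assumes "bij g"
  shows "perm_action g (basis_vector T) = basis_vector (\<lambda>i. g ` T i)"
proof -
  have "(\<lambda>i. Hilbert_Choice.inv g ` S i) = T \<longleftrightarrow> S = (\<lambda>i. g ` T i)" for S
  proof
    assume "(\<lambda>i. Hilbert_Choice.inv g ` S i) = T"
    then have "T i = Hilbert_Choice.inv g ` S i" for i by auto
    then show "S = (\<lambda>i. g ` T i)"
      using assms by (simp add: image_image bij_is_surj surj_f_inv_f)
  next
    assume "S = (\<lambda>i. g ` T i)"
    then show "(\<lambda>i. Hilbert_Choice.inv g ` S i) = T"
      using assms by (simp add: image_image bij_is_inj)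
  qed
  then show ?thesis by (simp add: perm_action_def basis_vector_def)
qed

lemma image_tabloid: "(\<lambda>i. g ` tabloid lam t i) = tabloid lam (g \<circ> t)"
  by (auto simp: tabloid_def)

lemma image_column: "g ` column lam t j = column lam (g \<circ> t) j"
  by (auto simp: column_def)

lemma conj_column_stabilizer:
  assumes "g permutes {1..sum_list lam}" "s \<in> column_stabilizer lam t"
  shows "g \<circ> s \<circ> Hilbert_Choice.inv g \<in> column_stabilizer lam (g \<circ> t)"
proof -
  have "(g \<circ> s \<circ> Hilbert_Choice.inv g) permutes {1..sum_list lam}"
    using assms by (auto simp: column_stabilizer_def sym_group_carrier
        intro!: permutes_compose permutes_inv)
  moreover have "(g \<circ> s \<circ> Hilbert_Choice.inv g) ` g ` column lam t j = g ` column lam t j" for j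
  proof -
    have "(g \<circ> s \<circ> Hilbert_Choice.inv g) ` g ` column lam t j = g ` s ` column lam t j"
      using permutes_inj[OF assms(1)] by (simp add: image_image)
    then show ?thesis using assms(2) by (simp add: column_stabilizer_def)
  qed
  ultimately show ?thesis
    unfolding column_stabilizer_def sym_group_carrier image_column[symmetric] by blast
qed

lemma perm_action_polytabloid:
  assumes g: "g permutes {1..sum_list lam}"
  shows "perm_action g (polytabloid lam t) = polytabloid lam (g \<circ> t)"
proof -
  interpret l: Vector_Spaces.linear fscale fscale "perm_action g" by (rule perm_action_linear)
  let ?i = "Hilbert_Choice.inv g"
  have ig: "?i permutes {1..sum_list lam}" by (rule permutes_inv[OF g])
  have gi: "g \<circ> ?i = id" "?i \<circ> g = id" using permutes_inv_o[OF g] by auto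
  have ii: "Hilbert_Choice.inv ?i = g" by (rule permutes_inv_inv[OF g])
  have pg: "permutation g" "permutation ?i"
    using g ig by (auto simp: permutation_permutes)
  have "perm_action g (polytabloid lam t)
      = (\<Sum>s \<in> column_stabilizer lam t.
           fscale (of_int (sign s)) (basis_vector (tabloid lam (g \<circ> s \<circ> t))))"
    by (simp add: polytabloid_def l.sum l.scale perm_action_basis_vector[OF permutes_bij[OF g]]
        image_tabloid comp_assoc)
  also have "\<dots> = polytabloid lam (g \<circ> t)"
    unfolding polytabloid_def
  proof (rule sum.reindex_bij_witness[where j = "\<lambda>s. g \<circ> s \<circ> ?i" and i = "\<lambda>s. ?i \<circ> s \<circ> g"])
    fix s assume s: "s \<in> column_stabilizer lam t"
    show "?i \<circ> (g \<circ> s \<circ> ?i) \<circ> g = s" using gi by (metis comp_assoc comp_id id_comp)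
    show "g \<circ> s \<circ> ?i \<in> column_stabilizer lam (g \<circ> t)"
      by (rule conj_column_stabilizer[OF g s])
    have "permutation s"
      using s by (auto simp: column_stabilizer_def intro: sym_group_carrier')
    then have "sign (g \<circ> s \<circ> ?i) = sign s"
      using pg by (simp add: sign_compose permutation_compose sign_inverse)
    moreover have "g \<circ> s \<circ> ?i \<circ> (g \<circ> t) = g \<circ> s \<circ> t"
      using gi by (metis comp_assoc comp_id)
    ultimately show "fscale (of_int (sign (g \<circ> s \<circ> ?i)))
          (basis_vector (tabloid lam (g \<circ> s \<circ> ?i \<circ> (g \<circ> t)))) =
        fscale (of_int (sign s)) (basis_vector (tabloid lam (g \<circ> s \<circ> t)))"
      by simp
  next
    fix s assume s: "s \<in> column_stabilizer lam (g \<circ> t)"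
    show "g \<circ> (?i \<circ> s \<circ> g) \<circ> ?i = s" using gi by (metis comp_assoc comp_id id_comp)
    have "?i \<circ> (g \<circ> t) = t" using gi by (metis comp_assoc id_comp)
    then show "?i \<circ> s \<circ> g \<in> column_stabilizer lam t"
      using conj_column_stabilizer[OF ig s] by (simp add: ii)
  qed
  finally show ?thesis .
qed

lemma perm_action_specht_module:
  assumes g: "g \<in> carrier (sym_group (sum_list lam))"
  shows "perm_action g ` specht_module lam \<subseteq> specht_module lam"
proof -
  interpret l: Vector_Spaces.linear fscale fscale "perm_action g" by (rule perm_action_linear)
  have g': "g permutes {1..sum_list lam}" using g by (simp add: sym_group_carrier)
  have "tableau lam (g \<circ> t)" if "tableau lam t" for t
    using that permutes_imp_bij[OF g'] by (auto simp: tableau_def intro: bij_betw_trans)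
  then have "perm_action g ` {polytabloid lam t |t. tableau lam t}
      \<subseteq> {polytabloid lam t |t. tableau lam t}"
    using perm_action_polytabloid[OF g'] by auto
  then show ?thesis
    unfolding specht_module_def l.span_image[symmetric] by (rule fun_space.span_mono)
qed

end

theory Submission
  imports Defs
begin

text \<open>
  By Frobenius, the character of the Specht module of \<open>lam\<close> at a permutation is the coefficient of
  \<open>x^(lam + delta)\<close> in the Vandermonde alternant times a product of power sums \<open>p_k\<close>, one for every
  cycle length \<open>k\<close>. An element has odd order iff all its cycles are odd, so the values on such
  elements are exactly what the Schur function of \<open>lam\<close> sees of the ring generated by the odd power
  sums. That ring contains the functions \<open>q_r = (\<Sum>i\<le>r. h_i * e_(r-i))\<close>, whose generating function
  \<open>\<Prod>(1 + x_i t) / (1 - x_i t)\<close> is the exponential of a series in odd power sums. Hence the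
  hypothesis makes \<open>lam\<close> and \<open>mu\<close> pair equally with every product of \<open>q_r\<close>s (the pairing is
  \<open>odd_pairing\<close> below), and it remains to recover a diagram up to conjugation from these pairings.

  Pairing with \<open>q_r\<close> removes from a diagram all skew shapes of \<open>r\<close> cells without a \<open>2 * 2\<close> square,
  with weight 2 to the number of connected components (\<open>odd_pairing_Cons\<close>). The largest such shape
  is the whole rim, so by induction the diagram without its rim is known up to conjugation, and one
  may take it to be the same diagram \<open>\<omega>\<close> for \<open>lam\<close> and \<open>mu\<close>. The two diagrams are then frames around
  \<open>\<omega>\<close> with equally many cells, and they differ in how far the first row and the first column stick out.
  Let \<open>k\<close> be the smallest of these four overhangs, say that of the row of \<open>lam\<close>. Among the shapes that
  leave \<open>k\<close> cells of the rim behind, the weights differ only where the remaining diagram is \<open>\<omega>\<close> with its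
  first row lengthened by \<open>k\<close>, or, if the column of \<open>mu\<close> overhangs by \<open>k\<close> too, \<open>\<omega>\<close> with its first column
  lengthened by \<open>k\<close>. As no pairing vanishes identically, the second case must occur and the two
  lengthened diagrams have equal pairings. By induction they are equal or conjugate; either way \<open>\<omega>\<close> is
  self-conjugate and \<open>mu\<close> is the conjugate of \<open>lam\<close> (\<open>same_core_conjugate\<close>).

  Frobenius' formula is obtained by comparing norms. Write \<open>\<chi>\<close> for the Specht character and \<open>\<psi>\<close> for the
  determinantal combination \<open>\<Sum>w. sign w * \<pi>_(lam_i - i + w i)\<close> of Young permutation characters. Row
  symmetrizers and column antisymmetrizers show that \<open>\<chi>\<close> pairs to 0 with all terms of \<open>\<psi>\<close> but the
  leading one, and to 1 with that one; Schur's lemma gives norm 1 for \<open>\<chi>\<close>, and the Pieri rules give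
  norm 1 for \<open>\<psi>\<close>. So \<open>\<chi> - \<psi>\<close> has norm \<open>1 - 2 + 1 = 0\<close>, and as its values are rational it vanishes.
\<close>

section \<open>Pieri rules for coefficients of alternants\<close>

text \<open>
  The exponents of the monomials in \<open>N\<close> variables that make up the complete (\<open>s = False\<close>) or
  elementary (\<open>s = True\<close>) symmetric polynomial of degree \<open>r\<close>.
\<close>

definition row_fillings :: "nat \<Rightarrow> bool \<Rightarrow> nat \<Rightarrow> (nat \<Rightarrow> nat) set" where
  "row_fillings N s r =
     {b \<in> {..<N} \<rightarrow>\<^sub>E {..r}. sum b {..<N} = r \<and> (s \<longrightarrow> (\<forall>i<N. b i \<le> 1))}"

text \<open>
  The coefficient of \<open>x^(l + (N-1, ..., N-1))\<close> in the alternant \<open>\<Sum>w. sign w * \<Prod>i. x_i^(N-1-w i)\<close>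
  times the complete and elementary symmetric polynomials listed in \<open>T\<close>. The shift by \<open>N - 1\<close> makes
  the vector \<open>l\<close> that belongs to a partition independent of the number of variables.
\<close>

fun alt_count :: "nat \<Rightarrow> (nat \<Rightarrow> int) \<Rightarrow> (bool \<times> nat) list \<Rightarrow> int" where
  "alt_count N l [] =
     (\<Sum>w | w permutes {..<N}. sign w * of_bool (\<forall>i<N. l i = - int (w i)))"
| "alt_count N l ((s, r) # T) = (\<Sum>b \<in> row_fillings N s r. alt_count N (\<lambda>i. l i - int (b i)) T)"

lemma finite_row_fillings: "finite (row_fillings N s r)"
  unfolding row_fillings_def
  by (rule finite_subset[of _ "{..<N} \<rightarrow>\<^sub>E {..r}"]) (auto intro: finite_PiE)

lemma alt_count_cong:
  assumes "\<And>i. i < N \<Longrightarrow> l i = l' i"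
  shows "alt_count N l T = alt_count N l' T"
  using assms
proof (induction T arbitrary: l l')
  case Nil
  then show ?case by (auto intro!: sum.cong)
next
  case (Cons a T)
  obtain s r where a: "a = (s, r)" by force
  show ?case unfolding a alt_count.simps
    by (intro sum.cong refl Cons.IH) (use Cons.prems in auto)
qed

text \<open>
  The alternant is antisymmetric and the other factors are symmetric, so the coefficients are
  antisymmetric in the exponents.
\<close>

lemma alt_count_transpose:
  assumes "i < N" "j < N" "i \<noteq> j"
  shows "alt_count N (l \<circ> transpose i j) T = - alt_count N l T"
proof (induction T arbitrary: l)
  case Nil
  let ?t = "transpose i j"
  have t: "?t permutes {..<N}" using assms by (simp add: permutes_swap_id)
  have "alt_count N (l \<circ> ?t) [] =
      (\<Sum>w | w permutes {..<N}. - (sign w * of_bool (\<forall>k<N. l k = - int (w k))))"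
    unfolding alt_count.simps
  proof (rule sum.reindex_bij_witness[where i = "\<lambda>w. w \<circ> ?t" and j = "\<lambda>w. w \<circ> ?t"])
    fix w assume w: "w \<in> {w. w permutes {..<N}}"
    show "w \<circ> ?t \<circ> ?t = w" by (simp add: comp_assoc)
    show "w \<circ> ?t \<in> {w. w permutes {..<N}}" using w t by (auto intro: permutes_compose)
    have tk: "?t k < N \<longleftrightarrow> k < N" for k using permutes_in_image[OF t, of k] by simp
    have eq: "(\<forall>k<N. l k = - int ((w \<circ> ?t) k)) \<longleftrightarrow> (\<forall>k<N. (l \<circ> ?t) k = - int (w k))" (is "?A = ?B")
    proof
      assume ?A
      show ?B
      proof (intro allI impI)
        fix k assume "k < N"
        then have "l (?t k) = - int ((w \<circ> ?t) (?t k))" using \<open>?A\<close> tk[of k] by blast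
        then show "(l \<circ> ?t) k = - int (w k)" by simp
      qed
    next
      assume ?B
      show ?A
      proof (intro allI impI)
        fix k assume "k < N"
        then have "(l \<circ> ?t) (?t k) = - int (w (?t k))" using \<open>?B\<close> tk[of k] by blast
        then show "l k = - int ((w \<circ> ?t) k)" by simp
      qed
    qed
    have "permutation w" using w by (auto simp: permutation_permutes)
    then have "sign (w \<circ> ?t) = - sign w"
      using assms by (simp add: sign_compose permutation_swap_id sign_swap_id)
    with eq show "- (sign (w \<circ> ?t) * of_bool (\<forall>k<N. l k = - int ((w \<circ> ?t) k))) =
        sign w * of_bool (\<forall>k<N. (l \<circ> ?t) k = - int (w k))"
      by simp
  next
    fix w assume w: "w \<in> {w. w permutes {..<N}}"
    show "w \<circ> ?t \<circ> ?t = w" by (simp add: comp_assoc)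
    show "w \<circ> ?t \<in> {w. w permutes {..<N}}" using w t by (auto intro: permutes_compose)
  qed
  then show ?case by (simp add: sum_negf)
next
  case (Cons a T)
  obtain s r where a: "a = (s, r)" by force
  let ?t = "transpose i j"
  have t: "?t permutes {..<N}" using assms by (simp add: permutes_swap_id)
  have tk: "?t k < N \<longleftrightarrow> k < N" for k using permutes_in_image[OF t, of k] by simp
  have mem: "b \<circ> ?t \<in> row_fillings N s r" if "b \<in> row_fillings N s r" for b
  proof -
    have "sum (b \<circ> ?t) {..<N} = sum b {..<N}"
      using sum.permute[OF t, of b] by simp
    moreover have "(b \<circ> ?t) k = undefined" if "\<not> k < N" for k
    proof -
      have "?t k = k" using that assms by (auto simp: transpose_def)
      then show ?thesis using \<open>b \<in> _\<close> that by (auto simp: row_fillings_def PiE_def extensional_def)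
    qed
    moreover have "(b \<circ> ?t) k \<le> r" if "k < N" for k
      using \<open>b \<in> _\<close> that tk[of k] by (auto simp: row_fillings_def PiE_def Pi_def)
    moreover have "s \<longrightarrow> (\<forall>k<N. (b \<circ> ?t) k \<le> 1)"
      using \<open>b \<in> _\<close> tk by (auto simp: row_fillings_def)
    ultimately show ?thesis using that
      by (auto simp: row_fillings_def PiE_def extensional_def Pi_def)
  qed
  have "alt_count N (l \<circ> ?t) (a # T) =
      (\<Sum>b \<in> row_fillings N s r. alt_count N ((\<lambda>k. l k - int (b k)) \<circ> ?t) T)"
    unfolding a alt_count.simps
  proof (rule sum.reindex_bij_witness[where i = "\<lambda>b. b \<circ> ?t" and j = "\<lambda>b. b \<circ> ?t"])
    fix b assume b: "b \<in> row_fillings N s r"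
    show "b \<circ> ?t \<circ> ?t = b" by (simp add: comp_assoc)
    show "b \<circ> ?t \<in> row_fillings N s r" by (rule mem[OF b])
    show "alt_count N ((\<lambda>k. l k - int ((b \<circ> ?t) k)) \<circ> ?t) T =
        alt_count N (\<lambda>i. (l \<circ> ?t) i - int (b i)) T"
      by (rule alt_count_cong) simp
  next
    fix b assume b: "b \<in> row_fillings N s r"
    show "b \<circ> ?t \<circ> ?t = b" by (simp add: comp_assoc)
    show "b \<circ> ?t \<in> row_fillings N s r" by (rule mem[OF b])
  qed
  then show ?case unfolding a alt_count.simps Cons.IH by (simp add: sum_negf)
qed

lemma alt_count_eq_entries:
  assumes "i < N" "j < N" "i \<noteq> j" "l i = l j"
  shows "alt_count N l T = 0"
proof -
  have "l \<circ> transpose i j = l" using assms(4) by (auto simp: transpose_def fun_eq_iff)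
  then show ?thesis using alt_count_transpose[OF assms(1-3), of l T] by simp
qed

text \<open>
  An exponent that is negative before the shift never occurs, and multiplying by further factors only
  calls for smaller ones.
\<close>

lemma alt_count_small_entry:
  assumes "i < N" "l i + int N \<le> 0"
  shows "alt_count N l T = 0"
  using assms(2)
proof (induction T arbitrary: l)
  case Nil
  have "\<not> (\<forall>k<N. l k = - int (w k))" if "w permutes {..<N}" for w
    using permutes_in_image[OF that, of i] assms(1) Nil by force
  then show ?case by (auto intro!: sum.neutral)
next
  case (Cons a T)
  obtain s r where a: "a = (s, r)" by force
  show ?case unfolding a alt_count.simps
    by (intro sum.neutral ballI Cons.IH) (use Cons.prems in auto)
qed

lemma alt_count_swap_tokens:
  "alt_count N l ((s, r) # (s', r') # T) = alt_count N l ((s', r') # (s, r) # T)"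
proof -
  have "alt_count N l ((s, r) # (s', r') # T) =
    (\<Sum>b\<in>row_fillings N s r. \<Sum>b'\<in>row_fillings N s' r'. alt_count N (\<lambda>i. l i - int (b i) - int (b' i)) T)"
    by simp
  also have "\<dots> = (\<Sum>b'\<in>row_fillings N s' r'. \<Sum>b\<in>row_fillings N s r. alt_count N (\<lambda>i. l i - int (b' i) - int (b i)) T)"
    by (subst sum.swap) (intro sum.cong refl alt_count_cong, simp)
  finally show ?thesis by simp
qed

definition is_partition :: "nat \<Rightarrow> (nat \<Rightarrow> nat) \<Rightarrow> bool" where
  "is_partition N p \<longleftrightarrow> antimono p \<and> (\<forall>i\<ge>N. p i = 0)"

text \<open>
  The exponents of the leading monomial of the alternant of \<open>p\<close>, after the shift by \<open>N - 1\<close>. They are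
  also the contents of the cells just beyond the rows of \<open>p\<close>.
\<close>

definition content_vec :: "(nat \<Rightarrow> nat) \<Rightarrow> nat \<Rightarrow> int" where
  "content_vec p i = int (p i) - int i"

text \<open>
  The partitions that remain when a horizontal strip of \<open>r\<close> cells is removed from \<open>p\<close>; interlacing
  with \<open>p\<close> makes them decreasing.
\<close>

definition hstrips :: "nat \<Rightarrow> (nat \<Rightarrow> nat) \<Rightarrow> nat \<Rightarrow> (nat \<Rightarrow> nat) set" where
  "hstrips N p r = {q. (\<forall>i. p (Suc i) \<le> q i \<and> q i \<le> p i) \<and> (\<Sum>i<N. p i - q i) = r}"

definition vstrips :: "nat \<Rightarrow> (nat \<Rightarrow> nat) \<Rightarrow> nat \<Rightarrow> (nat \<Rightarrow> nat) set" where
  "vstrips N p r = {q. antimono q \<and> (\<forall>i. q i \<le> p i \<and> p i \<le> q i + 1) \<and> (\<Sum>i<N. p i - q i) = r}"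

lemma hstrips_is_partition:
  assumes "is_partition N p" "q \<in> hstrips N p r"
  shows "is_partition N q"
  unfolding is_partition_def
proof
  have "q (Suc i) \<le> q i" for i
    using assms(2) unfolding hstrips_def by (blast intro: le_trans)
  then show "antimono q" by (simp add: decseq_Suc_iff)
  have "q i \<le> p i" for i using assms(2) by (auto simp: hstrips_def)
  then show "\<forall>i\<ge>N. q i = 0" using assms(1) by (metis is_partition_def le_zero_eq)
qed

lemma vstrips_is_partition:
  assumes "is_partition N p" "q \<in> vstrips N p r"
  shows "is_partition N q"
proof -
  have "q i \<le> p i" for i using assms(2) by (auto simp: vstrips_def)
  then have "\<forall>i\<ge>N. q i = 0" using assms(1) by (metis is_partition_def le_zero_eq)
  then show ?thesis using assms(2) by (auto simp: vstrips_def is_partition_def)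
qed

text \<open>
  Pieri's rule. A filling that is not a horizontal strip takes so much from some row \<open>i\<close> that
  exchanging the entries \<open>i\<close> and \<open>i + 1\<close> of the resulting vector gives another filling of this kind.
  Doing this at the first such row is an involution, and it cancels these fillings in pairs.
\<close>

lemma alt_count_hstrips:
  assumes p: "is_partition N p"
  shows "alt_count N (content_vec p) ((False, r) # T) =
    (\<Sum>q \<in> hstrips N p r. alt_count N (content_vec q) T)"
proof -
  let ?F = "\<lambda>b. alt_count N (\<lambda>i. content_vec p i - int (b i)) T"
  have pS: "p (Suc i) \<le> p i" for i using p by (simp add: is_partition_def antimonoD)
  define viol where "viol = (\<lambda>b i. p (Suc i) + b i > p i)"
  define good where "good = {b \<in> row_fillings N False r. \<forall>i<N. \<not> viol b i}"
  define bad where "bad = {b \<in> row_fillings N False r. \<exists>i. Suc i < N \<and> viol b i}"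
  define low where "low = {b \<in> row_fillings N False r. (\<forall>i. Suc i < N \<longrightarrow> \<not> viol b i) \<and> (\<exists>i<N. viol b i)}"
  have split: "row_fillings N False r = good \<union> (bad \<union> low)"
    unfolding good_def bad_def low_def by auto
  have fin: "finite good" "finite bad" "finite low"
    unfolding good_def bad_def low_def using finite_row_fillings by auto
  have disj: "good \<inter> (bad \<union> low) = {}" "bad \<inter> low = {}"
    unfolding good_def bad_def low_def by auto
  \<comment> \<open>Only the last row takes too much: its entry becomes too small.\<close>
  have low0: "sum ?F low = 0"
  proof (rule sum.neutral, rule)
    fix b assume "b \<in> low"
    then obtain i where i: "i < N" "viol b i" "\<not> Suc i < N" unfolding low_def by auto
    then have "N = Suc i" by simp
    moreover have "p (Suc i) = 0" using p \<open>N = Suc i\<close> by (simp add: is_partition_def)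
    ultimately show "?F b = 0"
      using i by (intro alt_count_small_entry[of i]) (auto simp: viol_def content_vec_def)
  qed
  define first where "first = (\<lambda>b. LEAST i. Suc i < N \<and> viol b i)"
  \<comment> \<open>Subtracting \<open>flip b\<close> from \<open>content_vec p\<close> gives the same vector as subtracting \<open>b\<close>, with two adjacent entries exchanged.\<close>
  define flip where "flip = (\<lambda>b. let i = first b in
     b(i := nat (int (p i) - int (p (Suc i)) + 1 + int (b (Suc i))), Suc i := b i + p (Suc i) - p i - 1))"
  have flip: "flip b \<in> bad \<and> first (flip b) = first b \<and> flip (flip b) = b \<and> ?F (flip b) = - ?F b"
    if b: "b \<in> bad" for b
  proof -
    let ?i = "first b"
    have ex: "\<exists>i. Suc i < N \<and> viol b i" using b by (simp add: bad_def)
    then have i: "Suc ?i < N" "viol b ?i"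
      unfolding first_def by (metis (mono_tags, lifting) LeastI_ex)+
    have min: "\<not> viol b k" if "k < ?i" for k
      using not_less_Least[of k "\<lambda>i. Suc i < N \<and> viol b i"] that i(1) unfolding first_def by auto
    have fi: "flip b ?i = p ?i - p (Suc ?i) + 1 + b (Suc ?i)"
      "flip b (Suc ?i) = b ?i + p (Suc ?i) - p ?i - 1"
      "\<And>k. k \<noteq> ?i \<Longrightarrow> k \<noteq> Suc ?i \<Longrightarrow> flip b k = b k"
      using pS[of ?i] by (auto simp: flip_def Let_def)
    have sm: "sum f {..<N} = f ?i + f (Suc ?i) + sum f ({..<N} - {?i, Suc ?i})" for f :: "nat \<Rightarrow> nat"
      using i(1) by (subst sum.subset_diff[of "{?i, Suc ?i}"]) auto
    have "sum (flip b) ({..<N} - {?i, Suc ?i}) = sum b ({..<N} - {?i, Suc ?i})"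
      by (rule sum.cong) (auto simp: fi)
    then have s: "sum (flip b) {..<N} = sum b {..<N}"
      unfolding sm fi using i(2) pS[of ?i] by (simp add: viol_def)
    then have s': "sum (flip b) {..<N} = r" using b by (simp add: bad_def row_fillings_def)
    have le: "flip b k \<le> r" if "k < N" for k
      unfolding s'[symmetric] using that by (intro member_le_sum) auto
    have ext: "flip b k = undefined" if "\<not> k < N" for k
      using that fi(3)[of k] i b by (auto simp: bad_def row_fillings_def PiE_def extensional_def)
    have mem: "flip b \<in> row_fillings N False r"
      using s' le ext by (auto simp: row_fillings_def PiE_def extensional_def Pi_def)
    have vi: "viol (flip b) ?i" using pS[of ?i] by (simp add: viol_def fi)
    have min': "\<not> viol (flip b) k" if "k < ?i" for k
      using min[OF that] that by (simp add: viol_def fi)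
    have mb: "flip b \<in> bad" using mem vi i(1) by (auto simp: bad_def)
    have ff: "first (flip b) = ?i"
      unfolding first_def
    proof (rule Least_equality)
      show "Suc (LEAST i. Suc i < N \<and> viol b i) < N \<and> viol (flip b) (LEAST i. Suc i < N \<and> viol b i)"
        using i(1) vi by (simp add: first_def)
      show "(LEAST i. Suc i < N \<and> viol b i) \<le> y" if "Suc y < N \<and> viol (flip b) y" for y
        using that min'[of y] by (metis first_def not_less)
    qed
    have ffb: "flip (flip b) = b"
    proof
      fix k
      have *: "flip c k = (if k = first c then nat (int (p k) - int (p (Suc k)) + 1 + int (c (Suc k)))
         else if k = Suc (first c) then c (first c) + p k - p (first c) - 1 else c k)" for c
        by (auto simp: flip_def Let_def)
      show "flip (flip b) k = b k"
        unfolding *[of "flip b"] ff using pS[of ?i] i(2) by (auto simp: fi viol_def)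
    qed
    have "?F (flip b) = alt_count N ((\<lambda>k. content_vec p k - int (b k)) \<circ> transpose ?i (Suc ?i)) T"
    proof (rule alt_count_cong)
      fix k assume "k < N"
      show "content_vec p k - int (flip b k) =
        ((\<lambda>k. content_vec p k - int (b k)) \<circ> transpose ?i (Suc ?i)) k"
        using i(2) pS[of ?i]
        by (cases "k = ?i"; cases "k = Suc ?i") (auto simp: fi content_vec_def transpose_def viol_def)
    qed
    also have "\<dots> = - ?F b" using i(1) by (intro alt_count_transpose) auto
    finally show ?thesis using mb ff ffb by simp
  qed
  have "sum ?F bad = (\<Sum>b\<in>bad. - ?F b)"
    by (rule sum.reindex_bij_witness[where i = flip and j = flip]) (use flip in auto)
  then have bad0: "sum ?F bad = 0" by (simp add: sum_negf)
  have "alt_count N (content_vec p) ((False, r) # T) = sum ?F good"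
    using split disj fin by (simp add: sum.union_disjoint low0 bad0)
  also have "\<dots> = (\<Sum>q \<in> hstrips N p r. alt_count N (content_vec q) T)"
  proof (rule sum.reindex_bij_witness[where j = "\<lambda>b i. if i < N then p i - b i else 0"
        and i = "\<lambda>q. \<lambda>i\<in>{..<N}. p i - q i"])
    fix b assume b: "b \<in> good"
    have ok: "b i \<le> p i - p (Suc i)" if "i < N" for i using b that by (auto simp: good_def viol_def)
    have bp: "b i \<le> p i" if "i < N" for i using ok[OF that] by simp
    have rf: "b \<in> {..<N} \<rightarrow>\<^sub>E {..r}" "sum b {..<N} = r"
      using b by (auto simp: good_def row_fillings_def)
    show "(\<lambda>i\<in>{..<N}. p i - (if i < N then p i - b i else 0)) = b"
      using bp rf(1) by (auto simp: fun_eq_iff PiE_def extensional_def)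
    have "(\<Sum>i<N. p i - (if i < N then p i - b i else 0)) = sum b {..<N}"
      using bp by (intro sum.cong) auto
    moreover have "p (Suc i) \<le> (if i < N then p i - b i else 0)" for i
      using ok[of i] pS[of i] p by (auto simp: is_partition_def)
    ultimately show "(\<lambda>i. if i < N then p i - b i else 0) \<in> hstrips N p r"
      using rf(2) by (auto simp: hstrips_def)
    show "alt_count N (content_vec (\<lambda>i. if i < N then p i - b i else 0)) T = ?F b"
      by (rule alt_count_cong) (use bp in \<open>auto simp: content_vec_def of_nat_diff\<close>)
  next
    fix q assume q: "q \<in> hstrips N p r"
    then have q': "q i \<le> p i" "p (Suc i) \<le> q i" for i by (auto simp: hstrips_def)
    have q0: "q i = 0" if "\<not> i < N" for i using q'(1)[of i] p that by (auto simp: is_partition_def)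
    show "(\<lambda>i. if i < N then p i - (\<lambda>i\<in>{..<N}. p i - q i) i else 0) = q"
      using q' q0 by (auto simp: fun_eq_iff)
    have s: "(\<Sum>i<N. p i - q i) = r" using q by (simp add: hstrips_def)
    have "p i - q i \<le> r" if "i < N" for i
      unfolding s[symmetric] using that by (intro member_le_sum) auto
    moreover have "p (Suc i) + (p i - q i) \<le> p i" for i using q'[of i] by simp
    ultimately show "(\<lambda>i\<in>{..<N}. p i - q i) \<in> good"
      using s by (simp add: good_def row_fillings_def viol_def not_less)
  qed
  finally show ?thesis .
qed

text \<open>
  Dual Pieri rule. Rows lose at most one cell, so a filling that does not leave a partition makes two
  adjacent entries of the vector equal, or takes a cell from the empty last row.
\<close>

lemma alt_count_vstrips:
  assumes p: "is_partition N p"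
  shows "alt_count N (content_vec p) ((True, r) # T) =
    (\<Sum>q \<in> vstrips N p r. alt_count N (content_vec q) T)"
proof -
  let ?F = "\<lambda>b. alt_count N (\<lambda>i. content_vec p i - int (b i)) T"
  have pS: "p (Suc i) \<le> p i" for i using p by (simp add: is_partition_def antimonoD)
  have pN: "p N = 0" using p by (simp add: is_partition_def)
  define ok where "ok = (\<lambda>b i. p i = p (Suc i) \<and> b i = (1::nat) \<longrightarrow> Suc i < N \<and> b (Suc i) = 1)"
  define good where "good = {b \<in> row_fillings N True r. \<forall>i<N. ok b i}"
  have "alt_count N (content_vec p) ((True, r) # T) = sum ?F good"
    unfolding alt_count.simps
  proof (rule sum.mono_neutral_right)
    show "\<forall>b\<in>row_fillings N True r - good. ?F b = 0"
    proof
      fix b assume "b \<in> row_fillings N True r - good"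
      then obtain i where i: "i < N" "p i = p (Suc i)" "b i = 1" "Suc i < N \<Longrightarrow> b (Suc i) \<noteq> 1"
        and b: "\<forall>i<N. b i \<le> 1" by (auto simp: good_def ok_def row_fillings_def)
      show "?F b = 0"
      proof (cases "Suc i < N")
        case True
        then have "b (Suc i) = 0" using i(4) b by (metis One_nat_def le_SucE le_zero_eq)
        then show ?thesis using i True
          by (intro alt_count_eq_entries[of i _ "Suc i"]) (auto simp: content_vec_def)
      next
        case False
        then have "N = Suc i" using i(1) by simp
        then show ?thesis using i pN by (intro alt_count_small_entry[of i]) (auto simp: content_vec_def)
      qed
    qed
  qed (auto simp: good_def finite_row_fillings)
  also have "\<dots> = (\<Sum>q \<in> vstrips N p r. alt_count N (content_vec q) T)"
  proof (rule sum.reindex_bij_witness[where j = "\<lambda>b i. if i < N then p i - b i else 0"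
        and i = "\<lambda>q. \<lambda>i\<in>{..<N}. p i - q i"])
    fix b assume b: "b \<in> good"
    have okb: "ok b i" if "i < N" for i using b that by (auto simp: good_def)
    have rf: "b \<in> {..<N} \<rightarrow>\<^sub>E {..r}" "sum b {..<N} = r" "\<And>i. i < N \<Longrightarrow> b i \<le> 1"
      using b by (auto simp: good_def row_fillings_def)
    have bp: "b i \<le> p i" if "i < N" for i
    proof (rule ccontr)
      assume c: "\<not> b i \<le> p i"
      have "p i = 0" using c rf(3)[OF \<open>i < N\<close>] by simp
      then have pk: "p k = 0" if "i \<le> k" for k
        using antimonoD[of p i k] p that by (simp add: is_partition_def)
      have "b (i + d) = 1 \<and> i + d < N" for d
      proof (induction d)
        case 0
        show ?case using c rf(3)[OF \<open>i < N\<close>] \<open>i < N\<close> by simp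
      next
        case (Suc d)
        then show ?case using okb[of "i + d"] pk by (auto simp: ok_def)
      qed
      from this[of N] show False by simp
    qed
    show "(\<lambda>i\<in>{..<N}. p i - (if i < N then p i - b i else 0)) = b"
      using bp rf(1) by (auto simp: fun_eq_iff PiE_def extensional_def)
    have "(\<Sum>i<N. p i - (if i < N then p i - b i else 0)) = sum b {..<N}"
      using bp by (intro sum.cong) auto
    moreover have "antimono (\<lambda>i. if i < N then p i - b i else 0)"
      unfolding decseq_Suc_iff
    proof
      fix i
      show "(if Suc i < N then p (Suc i) - b (Suc i) else 0) \<le> (if i < N then p i - b i else 0)"
        using okb[of i] pS[of i] rf(3)[of i] unfolding ok_def
        by (cases "Suc i < N"; cases "p i = p (Suc i)"; cases "b i = 1") auto
    qed
    moreover have "p i \<le> (if i < N then p i - b i else 0) + 1" for i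
      using rf(3)[of i] p by (auto simp: is_partition_def)
    ultimately show "(\<lambda>i. if i < N then p i - b i else 0) \<in> vstrips N p r"
      using rf(2) by (auto simp: vstrips_def)
    show "alt_count N (content_vec (\<lambda>i. if i < N then p i - b i else 0)) T = ?F b"
      by (rule alt_count_cong) (use bp in \<open>auto simp: content_vec_def of_nat_diff\<close>)
  next
    fix q assume q: "q \<in> vstrips N p r"
    then have q': "q i \<le> p i" "p i \<le> q i + 1" for i by (auto simp: vstrips_def)
    have qS: "q (Suc i) \<le> q i" for i using q by (auto simp: vstrips_def antimonoD)
    have q0: "q i = 0" if "\<not> i < N" for i using q'(1)[of i] p that by (auto simp: is_partition_def)
    show "(\<lambda>i. if i < N then p i - (\<lambda>i\<in>{..<N}. p i - q i) i else 0) = q"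
      using q' q0 by (auto simp: fun_eq_iff)
    have s: "(\<Sum>i<N. p i - q i) = r" using q by (simp add: vstrips_def)
    have "p i - q i \<le> r" if "i < N" for i
      unfolding s[symmetric] using that by (intro member_le_sum) auto
    moreover have "ok (\<lambda>i\<in>{..<N}. p i - q i) i" if "i < N" for i
    proof -
      have "Suc i < N" if "p i = p (Suc i)" "p i - q i = 1"
        using that pN \<open>i < N\<close> by (cases "Suc i = N") auto
      then show ?thesis unfolding ok_def using that qS[of i] q'[of "Suc i"] by auto
    qed
    moreover have "p i - q i \<le> 1" for i using q'(2)[of i] by simp
    ultimately show "(\<lambda>i\<in>{..<N}. p i - q i) \<in> good"
      using s by (auto simp: good_def row_fillings_def)
  qed
  finally show ?thesis .
qed

text \<open>
  The contents of a partition satisfy \<open>- i \<le> content_vec p i\<close>, so \<open>w i \<le> i\<close> for a contributing \<open>w\<close>,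
  which forces \<open>w = id\<close> and then \<open>p i = 0\<close>.
\<close>

lemma alt_count_partition_Nil:
  assumes p: "is_partition N p"
  shows "alt_count N (content_vec p) [] = of_bool (p = (\<lambda>_. 0))"
proof -
  have key: "w = id \<and> p = (\<lambda>_. 0)"
    if w: "w permutes {..<N}" and eq: "\<forall>i<N. content_vec p i = - int (w i)" for w
  proof -
    have le: "w i \<le> i" for i
    proof (cases "i < N")
      case True
      then show ?thesis using eq by (force simp: content_vec_def)
    next
      case False
      then show ?thesis using w by (simp add: permutes_not_in)
    qed
    have "w i = i" for i
    proof (induction i rule: less_induct)
      case (less i)
      show ?case
      proof (rule ccontr)
        assume "w i \<noteq> i"
        then have "w i < i" using le[of i] by simp
        then have "w (w i) = w i" using less by blast
        then show False using \<open>w i \<noteq> i\<close> permutes_inj[OF w] by (metis injD)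
      qed
    qed
    then have "w = id" by auto
    moreover from this have "p i = 0" for i
      using eq p by (cases "i < N") (auto simp: content_vec_def is_partition_def)
    ultimately show ?thesis by auto
  qed
  show ?thesis
  proof (cases "p = (\<lambda>_. 0)")
    case True
    have "alt_count N (content_vec p) [] = (\<Sum>w | w permutes {..<N}. of_bool (w = id))"
      unfolding alt_count.simps
      by (intro sum.cong refl) (use key True in \<open>auto simp: content_vec_def\<close>)
    also have "\<dots> = (\<Sum>w\<in>{id :: nat \<Rightarrow> nat}. 1)"
      by (rule sum.mono_neutral_cong_right) (auto simp: finite_permutations permutes_id)
    also have "\<dots> = 1" by simp
    finally show ?thesis using True by simp
  next
    case False
    then show ?thesis using key by (force intro!: sum.neutral)
  qed
qed

section \<open>Colourings fixed by permutations\<close>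

definition fibre_card :: "'a set \<Rightarrow> ('a \<Rightarrow> 'b) \<Rightarrow> 'b \<Rightarrow> nat" where
  "fibre_card X f k = card {x \<in> X. f x = k}"

definition colour_stab :: "'a set \<Rightarrow> ('a \<Rightarrow> 'b) \<Rightarrow> ('a \<Rightarrow> 'a) set" where
  "colour_stab X f = {g. g permutes X \<and> (\<forall>x\<in>X. f (g x) = f x)}"

definition perm_on :: "('a \<Rightarrow> 'a) \<Rightarrow> 'a set \<Rightarrow> 'a \<Rightarrow> 'a" where
  "perm_on g A = (\<lambda>x. if x \<in> A then g x else x)"

lemma finite_colour_stab: "finite X \<Longrightarrow> finite (colour_stab X f)"
  unfolding colour_stab_def by (rule finite_subset[OF _ finite_permutations[of X]]) auto

lemma colour_stab_compose:
  assumes "g \<in> colour_stab X f" "h \<in> colour_stab X f"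
  shows "g \<circ> h \<in> colour_stab X f"
  using assms permutes_in_image[of h X] by (auto simp: colour_stab_def permutes_compose)

lemma colour_stab_inv:
  assumes "g \<in> colour_stab X f"
  shows "Hilbert_Choice.inv g \<in> colour_stab X f"
proof -
  have g: "g permutes X" "\<And>x. x \<in> X \<Longrightarrow> f (g x) = f x" using assms by (auto simp: colour_stab_def)
  have "f (Hilbert_Choice.inv g x) = f x" if "x \<in> X" for x
    using g(2)[of "Hilbert_Choice.inv g x"] permutes_in_image[OF permutes_inv[OF g(1)], of x] that
    by (simp add: permutes_inverses[OF g(1)])
  then show ?thesis using permutes_inv[OF g(1)] by (simp add: colour_stab_def)
qed

lemma equal_fibres_imp_permuted:
  assumes X: "finite X" and eq: "\<And>x. x \<in> X \<Longrightarrow> fibre_card X f (f x) = fibre_card X h (f x)"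
    "\<And>x. x \<in> X \<Longrightarrow> fibre_card X f (h x) = fibre_card X h (h x)"
  shows "\<exists>p. p permutes X \<and> (\<forall>x\<in>X. h x = f (p x))"
proof -
  have "image_mset h (mset_set X) = image_mset f (mset_set X)"
  proof (rule multiset_eqI)
    fix k
    have "count (image_mset u (mset_set X)) k = fibre_card X u k" for u :: "'a \<Rightarrow> 'b"
      unfolding fibre_card_def count_image_mset'
      using X by (subst sum.cong[OF refl, of _ _ "\<lambda>_. 1"])
        (auto simp: vimage_def Int_def conj_commute intro!: arg_cong[of _ _ card])
    moreover have "fibre_card X h k = fibre_card X f k"
    proof (cases "k \<in> f ` X \<union> h ` X")
      case True
      then show ?thesis using eq by auto
    next
      case False
      then have "{x\<in>X. f x = k} = {}" "{x\<in>X. h x = k} = {}" by auto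
      then show ?thesis unfolding fibre_card_def by (simp only:)
    qed
    ultimately show "count (image_mset h (mset_set X)) k = count (image_mset f (mset_set X)) k"
      by simp
  qed
  from image_mset_eq_implies_permutes[OF X this] show ?thesis by metis
qed

lemma fibre_card_permute:
  assumes "p permutes X"
  shows "fibre_card X (\<lambda>x. f (p x)) k = fibre_card X f k"
  unfolding fibre_card_def
proof (rule bij_betw_same_card[of p])
  show "bij_betw p {x \<in> X. f (p x) = k} {x \<in> X. f x = k}"
    unfolding bij_betw_def
  proof
    show "inj_on p {x \<in> X. f (p x) = k}" using permutes_inj[OF assms] by (auto simp: inj_on_def)
    show "p ` {x \<in> X. f (p x) = k} = {x \<in> X. f x = k}"
    proof
      show "p ` {x \<in> X. f (p x) = k} \<subseteq> {x \<in> X. f x = k}"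
        using permutes_in_image[OF assms] by auto
      show "{x \<in> X. f x = k} \<subseteq> p ` {x \<in> X. f (p x) = k}"
      proof
        fix x assume x: "x \<in> {x \<in> X. f x = k}"
        have "x = p (Hilbert_Choice.inv p x)" by (simp add: permutes_inverses[OF assms])
        moreover have "Hilbert_Choice.inv p x \<in> X"
          using x permutes_in_image[OF permutes_inv[OF assms]] by auto
        ultimately show "x \<in> p ` {x \<in> X. f (p x) = k}" using x
          by (intro image_eqI[of _ _ "Hilbert_Choice.inv p x"]) (auto simp: permutes_inverses[OF assms])
      qed
    qed
  qed
qed

lemma fibre_card_restrict: "fibre_card X (restrict f X) = fibre_card X f"
  unfolding fibre_card_def by (intro ext arg_cong[of _ _ card]) auto

text \<open>
  The colourings with given fibre sizes form one orbit of the symmetric group, and the permutations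
  carrying a fixed colouring to \<open>f\<close> form a coset of the stabilizer of \<open>f\<close>.
\<close>

lemma sum_card_colour_stab:
  assumes X: "finite X" and f0: "f0 \<in> X \<rightarrow>\<^sub>E K"
  shows "(\<Sum>f | f \<in> X \<rightarrow>\<^sub>E K \<and> (\<forall>k\<in>K. fibre_card X f k = fibre_card X f0 k). card (colour_stab X f))
     = fact (card X)"
proof -
  define C where "C = {f \<in> X \<rightarrow>\<^sub>E K. \<forall>k\<in>K. fibre_card X f k = fibre_card X f0 k}"
  define \<phi> where "\<phi> = (\<lambda>p. restrict (f0 \<circ> p) X)"
  let ?P = "{p. p permutes X}"
  have img: "\<phi> ` ?P = C"
  proof
    show "\<phi> ` ?P \<subseteq> C"
    proof
      fix f assume "f \<in> \<phi> ` ?P"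
      then obtain p where p: "p permutes X" "f = restrict (f0 \<circ> p) X" by (auto simp: \<phi>_def)
      have "f \<in> X \<rightarrow>\<^sub>E K" using p f0 permutes_in_image[OF p(1)] by (auto simp: PiE_def)
      moreover have "fibre_card X f k = fibre_card X f0 k" for k
        unfolding p(2) fibre_card_restrict comp_def by (rule fibre_card_permute[OF p(1)])
      ultimately show "f \<in> C" by (simp add: C_def)
    qed
    show "C \<subseteq> \<phi> ` ?P"
    proof
      fix f assume f: "f \<in> C"
      then have fK: "f x \<in> K" "f0 x \<in> K" if "x \<in> X" for x using f0 that by (auto simp: C_def)
      have "\<exists>p. p permutes X \<and> (\<forall>x\<in>X. f x = f0 (p x))"
        using X f fK by (intro equal_fibres_imp_permuted) (auto simp: C_def)
      then obtain p where p: "p permutes X" "\<forall>x\<in>X. f x = f0 (p x)" by blast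
      have "f = \<phi> p" using p f by (auto simp: \<phi>_def C_def fun_eq_iff PiE_def extensional_def)
      then show "f \<in> \<phi> ` ?P" using p by blast
    qed
  qed
  have fib: "card {p \<in> ?P. \<phi> p = f} = card (colour_stab X f)" if "f \<in> C" for f
  proof -
    obtain p0 where p0: "p0 permutes X" "\<phi> p0 = f" using \<open>f \<in> C\<close> img by blast
    have f: "f x = f0 (p0 x)" if "x \<in> X" for x using p0(2) that by (auto simp: \<phi>_def)
    let ?i = "Hilbert_Choice.inv p0"
    have "bij_betw (\<lambda>g. p0 \<circ> g) (colour_stab X f) {p \<in> ?P. \<phi> p = f}"
    proof (rule bij_betw_byWitness[where f' = "\<lambda>p. ?i \<circ> p"])
      show "\<forall>g\<in>colour_stab X f. ?i \<circ> (p0 \<circ> g) = g"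
        by (simp add: fun_eq_iff permutes_inverses[OF p0(1)])
      show "\<forall>p\<in>{p \<in> ?P. \<phi> p = f}. p0 \<circ> (?i \<circ> p) = p"
        by (simp add: fun_eq_iff permutes_inverses[OF p0(1)])
      show "(\<lambda>g. p0 \<circ> g) ` colour_stab X f \<subseteq> {p \<in> ?P. \<phi> p = f}"
      proof
        fix p assume "p \<in> (\<lambda>g. p0 \<circ> g) ` colour_stab X f"
        then obtain g where g: "g permutes X" "\<And>x. x \<in> X \<Longrightarrow> f (g x) = f x" "p = p0 \<circ> g"
          by (auto simp: colour_stab_def)
        have "f0 (p0 (g x)) = f x" if "x \<in> X" for x
          using g(2)[OF that] f[of "g x"] permutes_in_image[OF g(1)] that by simp
        then have "\<phi> p = f" using \<open>f \<in> C\<close> g(3)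
          by (auto simp: \<phi>_def C_def fun_eq_iff PiE_def extensional_def)
        then show "p \<in> {p \<in> ?P. \<phi> p = f}" using g p0 by (auto intro: permutes_compose)
      qed
      show "(\<lambda>p. ?i \<circ> p) ` {p \<in> ?P. \<phi> p = f} \<subseteq> colour_stab X f"
      proof
        fix g assume "g \<in> (\<lambda>p. ?i \<circ> p) ` {p \<in> ?P. \<phi> p = f}"
        then obtain p where p: "p permutes X" "\<phi> p = f" "g = ?i \<circ> p" by auto
        have gX: "g permutes X" unfolding p(3) by (intro permutes_compose p(1) permutes_inv p0(1))
        have "f (g x) = f x" if x: "x \<in> X" for x
        proof -
          have "f (g x) = f0 (p0 (g x))" using f permutes_in_image[OF gX] x by simp
          also have "\<dots> = f0 (p x)" by (simp add: p(3) permutes_inverses[OF p0(1)])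
          also have "\<dots> = f x" using p(2) x by (auto simp: \<phi>_def)
          finally show ?thesis .
        qed
        then show "g \<in> colour_stab X f" using gX by (simp add: colour_stab_def)
      qed
    qed
    then show ?thesis by (rule bij_betw_same_card[symmetric])
  qed
  have "fact (card X) = card ?P" using card_permutations[OF refl X] by simp
  also have "\<dots> = (\<Sum>f\<in>C. card {p \<in> ?P. \<phi> p = f})"
    using sum.image_gen[of ?P "\<lambda>_. 1::nat" \<phi>] finite_permutations[OF X] by (simp add: img)
  also have "\<dots> = (\<Sum>f\<in>C. card (colour_stab X f))" by (rule sum.cong) (use fib in auto)
  finally show ?thesis by (simp add: C_def)
qed

lemma perm_on_permutes:
  assumes "g permutes X" "A \<subseteq> X" "finite X" "\<And>x. x \<in> A \<Longrightarrow> g x \<in> A"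
  shows "perm_on g A permutes X"
proof -
  have "inj_on g A" using permutes_inj[OF assms(1)] by (auto simp: inj_on_def)
  then have "bij_betw g A A"
    using assms endo_inj_surj[of A g] finite_subset[of A X] by (simp add: bij_betw_def image_subset_iff)
  then have "bij_betw (perm_on g A) A A"
    by (rule bij_betw_cong[THEN iffD1, rotated]) (simp add: perm_on_def)
  then have "perm_on g A permutes A" by (rule bij_imp_permutes) (simp add: perm_on_def)
  then show ?thesis using assms(2) by (rule permutes_subset)
qed

lemma perm_on_compose:
  assumes "\<And>x. x \<in> A \<Longrightarrow> h x \<in> A"
  shows "perm_on (g \<circ> h) A = perm_on g A \<circ> perm_on h A"
  using assms by (auto simp: perm_on_def fun_eq_iff)

text \<open>
  Two points with the same marked colour give a transposition in the stabilizer; composing with it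
  reverses the sign. Otherwise the stabilizer fixes every point with a marked colour.
\<close>

lemma sum_sign_colour_stab:
  fixes F :: "'a \<Rightarrow> 'b"
  assumes X: "finite X"
  shows "(\<Sum>g \<in> colour_stab X F. sign (perm_on g {x \<in> X. mn (F x)})) =
     (if \<forall>k. mn k \<longrightarrow> fibre_card X F k \<le> 1 then int (card (colour_stab X F)) else 0)"
proof (cases "\<forall>k. mn k \<longrightarrow> fibre_card X F k \<le> 1")
  case True
  have "perm_on g {x \<in> X. mn (F x)} = id" if g: "g \<in> colour_stab X F" for g
  proof
    fix x show "perm_on g {x \<in> X. mn (F x)} x = id x"
    proof (cases "x \<in> X \<and> mn (F x)")
      case x: True
      then have "g x \<in> X" "F (g x) = F x"
        using g permutes_in_image[of g X] by (auto simp: colour_stab_def)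
      moreover have "card {y \<in> X. F y = F x} \<le> 1" using True x unfolding fibre_card_def by blast
      ultimately have "g x = x" using x X card_le_Suc0_iff_eq[of "{y \<in> X. F y = F x}"] by auto
      then show ?thesis by (simp add: perm_on_def)
    qed (auto simp: perm_on_def)
  qed
  then show ?thesis using True by simp
next
  case False
  then obtain k where k: "mn k" "\<not> card {x \<in> X. F x = k} \<le> Suc 0" by (auto simp: fibre_card_def)
  then obtain x y where xy: "x \<in> X" "y \<in> X" "F x = k" "F y = k" "x \<noteq> y"
    using X card_le_Suc0_iff_eq[of "{x \<in> X. F x = k}"] by auto
  let ?A = "{x \<in> X. mn (F x)}"
  let ?t = "transpose x y"
  let ?S = "\<Sum>g \<in> colour_stab X F. sign (perm_on g ?A)"
  have t: "?t \<in> colour_stab X F"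
    using xy by (auto simp: colour_stab_def permutes_swap_id) (auto simp: transpose_def)
  \<comment> \<open>The transposition moves only points with a marked colour, so restricting to these keeps it.\<close>
  have tA: "perm_on ?t ?A = ?t" using xy k(1) by (auto simp: perm_on_def fun_eq_iff transpose_def)
  have stA: "g z \<in> ?A" if "g \<in> colour_stab X F" "z \<in> ?A" for g z
    using that permutes_in_image[of g X z] by (auto simp: colour_stab_def)
  have "?S = (\<Sum>g \<in> colour_stab X F. - sign (perm_on g ?A))"
  proof (rule sum.reindex_bij_witness[where i = "\<lambda>g. g \<circ> ?t" and j = "\<lambda>g. g \<circ> ?t"])
    fix g assume g: "g \<in> colour_stab X F"
    show "g \<circ> ?t \<circ> ?t = g" by (simp add: comp_assoc)
    show "g \<circ> ?t \<in> colour_stab X F" by (rule colour_stab_compose[OF g t])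
    have "perm_on g ?A permutes X"
      using g stA[OF g] X by (intro perm_on_permutes) (auto simp: colour_stab_def)
    then have "permutation (perm_on g ?A)" using X permutation_permutes by blast
    moreover have "perm_on (g \<circ> ?t) ?A = perm_on g ?A \<circ> ?t"
      using perm_on_compose[of ?A ?t g] stA[OF t] tA by auto
    ultimately show "- sign (perm_on (g \<circ> ?t) ?A) = sign (perm_on g ?A)"
      using xy(5) by (simp add: sign_compose permutation_swap_id sign_swap_id)
  next
    fix g assume g: "g \<in> colour_stab X F"
    show "g \<circ> ?t \<circ> ?t = g" by (simp add: comp_assoc)
    show "g \<circ> ?t \<in> colour_stab X F" by (rule colour_stab_compose[OF g t])
  qed
  then have "?S = 0" by (simp add: sum_negf)
  then show ?thesis unfolding if_not_P[OF False] .
qed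

lemma ex_colouring_with_fibres:
  assumes X: "finite X" and K: "finite K" and c: "sum c K = card X"
  obtains F where "F \<in> X \<rightarrow>\<^sub>E K" "\<And>k. k \<in> K \<Longrightarrow> fibre_card X F k = c k"
proof -
  let ?S = "SIGMA k:K. {..<c k}"
  have "card ?S = card X" using K c by simp
  then obtain h where h: "bij_betw h X ?S" using X K finite_same_card_bij[of X ?S] by force
  define F where "F = restrict (fst \<circ> h) X"
  have "F \<in> X \<rightarrow>\<^sub>E K" using bij_betwE[OF h] by (auto simp: F_def)
  moreover have "fibre_card X F k = c k" if "k \<in> K" for k
  proof -
    have "bij_betw h {x \<in> X. F x = k} {z \<in> ?S. fst z = k}"
      unfolding bij_betw_def
    proof
      show "inj_on h {x \<in> X. F x = k}"
        using h by (auto simp: bij_betw_def inj_on_def)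
      have "h ` X = ?S" using h by (simp add: bij_betw_def)
      moreover have "{x \<in> X. F x = k} = {x \<in> X. fst (h x) = k}" by (auto simp: F_def)
      moreover have "h ` {x \<in> X. fst (h x) = k} = {z \<in> h ` X. fst z = k}" by auto
      ultimately show "h ` {x \<in> X. F x = k} = {z \<in> ?S. fst z = k}" by simp
    qed
    moreover have "{z \<in> ?S. fst z = k} = {k} \<times> {..<c k}" using that by auto
    ultimately show ?thesis unfolding fibre_card_def
      by (simp add: bij_betw_same_card card_cartesian_product)
  qed
  ultimately show ?thesis by (rule that)
qed

lemma fibre_card_sum:
  assumes "finite X" "finite K" "f \<in> X \<rightarrow>\<^sub>E K"
  shows "(\<Sum>k\<in>K. fibre_card X f k) = card X"
  using sum.group[of X K f "\<lambda>_. 1::nat"] assms by (auto simp: fibre_card_def)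

lemma sum_card_colour_stab_fibres:
  assumes X: "finite X" and K: "finite K"
  shows "(\<Sum>F | F \<in> X \<rightarrow>\<^sub>E K \<and> Q (restrict (fibre_card X F) K). card (colour_stab X F)) =
    fact (card X) * card {c \<in> K \<rightarrow>\<^sub>E UNIV. sum c K = card X \<and> Q c}"
proof -
  let ?Fs = "{F \<in> X \<rightarrow>\<^sub>E K. Q (restrict (fibre_card X F) K)}"
  let ?cont = "\<lambda>F. restrict (fibre_card X F) K"
  have fin: "finite ?Fs"
    by (rule finite_subset[of _ "X \<rightarrow>\<^sub>E K"]) (use X K in \<open>auto intro: finite_PiE\<close>)
  have img: "?cont ` ?Fs = {c \<in> K \<rightarrow>\<^sub>E UNIV. sum c K = card X \<and> Q c}"
  proof
    show "?cont ` ?Fs \<subseteq> {c \<in> K \<rightarrow>\<^sub>E UNIV. sum c K = card X \<and> Q c}"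
      using fibre_card_sum[OF X K] by auto
    show "{c \<in> K \<rightarrow>\<^sub>E UNIV. sum c K = card X \<and> Q c} \<subseteq> ?cont ` ?Fs"
    proof
      fix c :: "'b \<Rightarrow> nat" assume c: "c \<in> {c \<in> K \<rightarrow>\<^sub>E UNIV. sum c K = card X \<and> Q c}"
      then obtain F where F: "F \<in> X \<rightarrow>\<^sub>E K" "\<And>k. k \<in> K \<Longrightarrow> fibre_card X F k = c k"
        using ex_colouring_with_fibres[OF X K, of c] by auto
      then have "?cont F = c" using c by (auto simp: fun_eq_iff PiE_def extensional_def)
      then show "c \<in> ?cont ` ?Fs" using F c by (intro image_eqI[of _ _ F]) auto
    qed
  qed
  have "(\<Sum>F\<in>?Fs. card (colour_stab X F)) =
     (\<Sum>c\<in>?cont ` ?Fs. \<Sum>F | F \<in> ?Fs \<and> ?cont F = c. card (colour_stab X F))"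
    using sum.image_gen[OF fin, of "\<lambda>F. card (colour_stab X F)" ?cont] by simp
  also have "\<dots> = (\<Sum>c\<in>?cont ` ?Fs. fact (card X))"
  proof (rule sum.cong[OF refl])
    fix c assume "c \<in> ?cont ` ?Fs"
    then obtain F0 where F0: "F0 \<in> X \<rightarrow>\<^sub>E K" "Q (?cont F0)" "c = ?cont F0" by auto
    have "{F. F \<in> ?Fs \<and> ?cont F = c} =
       {F. F \<in> X \<rightarrow>\<^sub>E K \<and> (\<forall>k\<in>K. fibre_card X F k = fibre_card X F0 k)}" (is "?L = ?R")
    proof
      show "?L \<subseteq> ?R" unfolding F0(3) by (auto simp: restrict_def fun_eq_iff split: if_splits)
      show "?R \<subseteq> ?L"
      proof
        fix F assume F: "F \<in> ?R"
        then have "?cont F = ?cont F0" by (auto simp: fun_eq_iff)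
        then show "F \<in> ?L" using F F0 by auto
      qed
    qed
    then show "(\<Sum>F | F \<in> ?Fs \<and> ?cont F = c. card (colour_stab X F)) = fact (card X)"
      using sum_card_colour_stab[OF X F0(1)] by simp
  qed
  finally show ?thesis unfolding img by simp
qed

text \<open>
  The prescribed fibre sizes are integers since the determinantal formula also asks for negative ones,
  which no colouring has.
\<close>

definition fixed_colourings :: "'a set \<Rightarrow> nat \<Rightarrow> (nat \<Rightarrow> int) \<Rightarrow> ('a \<Rightarrow> 'a) \<Rightarrow> ('a \<Rightarrow> nat) set" where
  "fixed_colourings X N \<alpha> g =
     {f \<in> X \<rightarrow>\<^sub>E {..<N}. (\<forall>x\<in>X. f (g x) = f x) \<and> (\<forall>i<N. int (fibre_card X f i) = \<alpha> i)}"

text \<open>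
  The permutation character induced from the trivial character of the Young subgroup of type \<open>\<alpha>\<close>.
\<close>

definition young_char :: "'a set \<Rightarrow> nat \<Rightarrow> (nat \<Rightarrow> int) \<Rightarrow> ('a \<Rightarrow> 'a) \<Rightarrow> int" where
  "young_char X N \<alpha> g = int (card (fixed_colourings X N \<alpha> g))"

text \<open>
  The character induced from a Young subgroup whose factors carry the trivial character (\<open>False\<close>) or
  the sign character (\<open>True\<close>).
\<close>

definition signed_young_char :: "'a set \<Rightarrow> (bool \<times> nat) list \<Rightarrow> ('a \<Rightarrow> 'a) \<Rightarrow> int" where
  "signed_young_char X T g =
     (\<Sum>f \<in> fixed_colourings X (length T) (\<lambda>j. int (snd (T ! j))) g.
        sign (perm_on g {x \<in> X. fst (T ! f x)}))"

fun matrix_count :: "nat \<Rightarrow> (nat \<Rightarrow> int) \<Rightarrow> (bool \<times> nat) list \<Rightarrow> int" where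
  "matrix_count N \<alpha> [] = of_bool (\<forall>i<N. \<alpha> i = 0)"
| "matrix_count N \<alpha> ((s, r) # T) =
     (\<Sum>b \<in> row_fillings N s r. matrix_count N (\<lambda>i. \<alpha> i - int (b i)) T)"

lemma alt_count_eq_sum_matrix_count:
  "alt_count N l T = (\<Sum>w | w permutes {..<N}. sign w * matrix_count N (\<lambda>i. l i + int (w i)) T)"
proof (induction T arbitrary: l)
  case Nil
  show ?case by (auto intro!: sum.cong simp: eq_neg_iff_add_eq_0)
next
  case (Cons a T)
  obtain s r where a: "a = (s, r)" by force
  show ?case unfolding a alt_count.simps matrix_count.simps Cons.IH sum_distrib_left
    by (subst sum.swap) (simp add: algebra_simps)
qed

text \<open>
  These matrices count the orbits on pairs of colourings: the entry \<open>(j, i)\<close> is the number of points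
  coloured \<open>j\<close> by the first and \<open>i\<close> by the second colouring.
\<close>

definition matrices :: "nat \<Rightarrow> (nat \<Rightarrow> int) \<Rightarrow> (bool \<times> nat) list \<Rightarrow> (nat \<times> nat \<Rightarrow> nat) set" where
  "matrices N \<alpha> T = {c \<in> {..<length T} \<times> {..<N} \<rightarrow>\<^sub>E UNIV.
     (\<forall>j<length T. (\<Sum>i<N. c (j, i)) = snd (T ! j)) \<and>
     (\<forall>i<N. int (\<Sum>j<length T. c (j, i)) = \<alpha> i) \<and>
     (\<forall>j<length T. \<forall>i<N. fst (T ! j) \<longrightarrow> c (j, i) \<le> 1)}"

lemma finite_matrices: "finite (matrices N \<alpha> T)"
proof (rule finite_subset)
  show "matrices N \<alpha> T \<subseteq> {..<length T} \<times> {..<N} \<rightarrow>\<^sub>E {..sum_list (map snd T)}"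
  proof
    fix c assume c: "c \<in> matrices N \<alpha> T"
    have "c (j, i) \<le> sum_list (map snd T)" if "j < length T" "i < N" for j i
    proof -
      have "c (j, i) \<le> (\<Sum>i<N. c (j, i))" using that by (intro member_le_sum) auto
      also have "\<dots> = snd (T ! j)" using c that by (simp add: matrices_def)
      also have "\<dots> \<le> sum_list (map snd T)" using that(1) by (intro member_le_sum_list) auto
      finally show ?thesis .
    qed
    then show "c \<in> {..<length T} \<times> {..<N} \<rightarrow>\<^sub>E {..sum_list (map snd T)}"
      using c by (auto simp: matrices_def PiE_def Pi_def)
  qed
qed (auto intro: finite_PiE)

lemma card_matrices: "int (card (matrices N \<alpha> T)) = matrix_count N \<alpha> T"
proof (induction T arbitrary: \<alpha>)
  case Nil
  show ?case by (auto simp: matrices_def)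
next
  case (Cons a T)
  obtain s r where a: "a = (s, r)" by force
  let ?S = "SIGMA b:row_fillings N s r. matrices N (\<lambda>i. \<alpha> i - int (b i)) T"
  let ?cons = "\<lambda>(b, c). \<lambda>(j, i)\<in>{..<Suc (length T)} \<times> {..<N}. (case j of 0 \<Rightarrow> b i | Suc j' \<Rightarrow> c (j', i))"
  let ?split = "\<lambda>c. (\<lambda>i\<in>{..<N}. c (0, i), \<lambda>(j, i)\<in>{..<length T} \<times> {..<N}. c (Suc j, i))"
  have "bij_betw ?split (matrices N \<alpha> (a # T)) ?S"
  proof (rule bij_betw_byWitness[where f' = ?cons])
    show "\<forall>c\<in>matrices N \<alpha> (a # T). ?cons (?split c) = c"
      by (auto simp: matrices_def fun_eq_iff PiE_def extensional_def split: nat.split)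
    show "\<forall>bc\<in>?S. ?split (?cons bc) = bc"
      by (auto simp: matrices_def row_fillings_def fun_eq_iff PiE_def extensional_def)
    show "?split ` matrices N \<alpha> (a # T) \<subseteq> ?S"
    proof
      fix bc assume "bc \<in> ?split ` matrices N \<alpha> (a # T)"
      then obtain c where c: "c \<in> matrices N \<alpha> (a # T)" and bc: "bc = ?split c" by blast
      have rows: "(\<Sum>i<N. c (j, i)) = snd ((a # T) ! j)" if "j < Suc (length T)" for j
        using c that by (simp add: matrices_def)
      have cols: "int (c (0, i)) + int (\<Sum>j<length T. c (Suc j, i)) = \<alpha> i" if "i < N" for i
        using c that unfolding matrices_def by (simp add: sum.lessThan_Suc_shift del: sum.lessThan_Suc)
      have sg: "c (j, i) \<le> 1" if "j < Suc (length T)" "i < N" "fst ((a # T) ! j)" for j i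
        using c that by (simp add: matrices_def)
      have r: "(\<Sum>i<N. c (0, i)) = r" using rows[of 0] a by simp
      have "c (0, i) \<le> r" if "i < N" for i
        unfolding r[symmetric] using that by (intro member_le_sum) auto
      then have "(\<lambda>i\<in>{..<N}. c (0, i)) \<in> row_fillings N s r"
        using r sg[of 0] a by (auto simp: row_fillings_def)
      moreover have "(\<lambda>(j, i)\<in>{..<length T} \<times> {..<N}. c (Suc j, i)) \<in>
          matrices N (\<lambda>i. \<alpha> i - int ((\<lambda>i\<in>{..<N}. c (0, i)) i)) T"
        using rows[of "Suc _"] cols sg[of "Suc _"] by (auto simp: matrices_def eq_diff_eq add.commute)
      ultimately show "bc \<in> ?S" unfolding bc by blast
    qed
    show "?cons ` ?S \<subseteq> matrices N \<alpha> (a # T)"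
    proof
      fix c assume "c \<in> ?cons ` ?S"
      then obtain b d where b: "b \<in> row_fillings N s r" and d: "d \<in> matrices N (\<lambda>i. \<alpha> i - int (b i)) T"
        and c: "c = ?cons (b, d)" by blast
      have "(\<Sum>i<N. c (j, i)) = snd ((a # T) ! j)" if "j < Suc (length T)" for j
        using b d that unfolding c a by (cases j) (auto simp: matrices_def row_fillings_def)
      moreover have "int (\<Sum>j<Suc (length T). c (j, i)) = \<alpha> i" if "i < N" for i
        using b d that unfolding c
        by (simp add: sum.lessThan_Suc_shift matrices_def row_fillings_def del: sum.lessThan_Suc)
      moreover have "c (j, i) \<le> 1" if "j < Suc (length T)" "i < N" "fst ((a # T) ! j)" for j i
        using b d that unfolding c a by (cases j) (auto simp: matrices_def row_fillings_def)
      ultimately show "c \<in> matrices N \<alpha> (a # T)"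
        unfolding matrices_def c by (auto simp: PiE_def)
    qed
  qed
  then have "card (matrices N \<alpha> (a # T)) = card ?S" by (rule bij_betw_same_card)
  also have "\<dots> = (\<Sum>b\<in>row_fillings N s r. card (matrices N (\<lambda>i. \<alpha> i - int (b i)) T))"
    by (simp add: finite_row_fillings finite_matrices)
  finally show ?case unfolding a by (simp add: Cons.IH)
qed

text \<open>
  Burnside's count for pairs of colourings, with signs. A pair is a colouring with colours \<open>(j, i)\<close>;
  each admissible matrix of fibre sizes contributes the order of the group, and the sign sum kills
  the matrices with an entry above 1 in a row of sign type.
\<close>

lemma young_char_pairing:
  assumes X: "finite X" and \<alpha>: "(\<Sum>i<N. \<alpha> i) = int (card X)"
  shows "(\<Sum>g | g permutes X. signed_young_char X T g * young_char X N \<alpha> g) =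
     fact (card X) * matrix_count N \<alpha> T"
proof -
  let ?m = "length T"
  let ?K = "{..<?m} \<times> {..<N}"
  let ?mn = "\<lambda>k. fst (T ! fst k)"
  define Q0 where "Q0 = (\<lambda>c :: nat \<times> nat \<Rightarrow> nat. (\<forall>j<?m. (\<Sum>i<N. c (j, i)) = snd (T ! j)) \<and>
     (\<forall>i<N. int (\<Sum>j<?m. c (j, i)) = \<alpha> i))"
  define Q1 where "Q1 = (\<lambda>c :: nat \<times> nat \<Rightarrow> nat. \<forall>j<?m. \<forall>i<N. fst (T ! j) \<longrightarrow> c (j, i) \<le> 1)"
  let ?cont = "\<lambda>F. restrict (fibre_card X F) ?K"
  let ?Fs = "{F \<in> X \<rightarrow>\<^sub>E ?K. Q0 (?cont F)}"
  have finP: "finite {g. g permutes X}" by (rule finite_permutations[OF X])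
  have finF: "finite ?Fs"
    by (rule finite_subset[of _ "X \<rightarrow>\<^sub>E ?K"]) (use X in \<open>auto intro: finite_PiE\<close>)
  have marg1: "(\<Sum>i<N. fibre_card X F (j, i)) = fibre_card X (\<lambda>x\<in>X. fst (F x)) j"
    and marg2: "(\<Sum>j<?m. fibre_card X F (j, i)) = fibre_card X (\<lambda>x\<in>X. snd (F x)) i"
    if F: "F \<in> X \<rightarrow>\<^sub>E ?K" and ji: "j < ?m" "i < N" for F j i
  proof -
    have Fx: "fst (F x) < ?m" "snd (F x) < N" if "x \<in> X" for x
      using PiE_mem[OF F that] by (simp_all add: mem_Times_iff)
    have e: "(F x = (j, i)) \<longleftrightarrow> fst (F x) = j \<and> snd (F x) = i" for x i j by (cases "F x") auto
    have "sum (\<lambda>i. card {x \<in> {x\<in>X. fst (F x) = j}. snd (F x) = i}) {..<N} = card {x\<in>X. fst (F x) = j}"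
      using sum.group[of "{x\<in>X. fst (F x) = j}" "{..<N}" "\<lambda>x. snd (F x)" "\<lambda>_. 1::nat"] X Fx by auto
    then show "(\<Sum>i<N. fibre_card X F (j, i)) = fibre_card X (\<lambda>x\<in>X. fst (F x)) j"
      unfolding fibre_card_restrict unfolding fibre_card_def e by simp
    have "sum (\<lambda>j. card {x \<in> {x\<in>X. snd (F x) = i}. fst (F x) = j}) {..<?m} = card {x\<in>X. snd (F x) = i}"
      using sum.group[of "{x\<in>X. snd (F x) = i}" "{..<?m}" "\<lambda>x. fst (F x)" "\<lambda>_. 1::nat"] X Fx by auto
    then show "(\<Sum>j<?m. fibre_card X F (j, i)) = fibre_card X (\<lambda>x\<in>X. snd (F x)) i"
      unfolding fibre_card_restrict unfolding fibre_card_def e by (simp add: conj_commute conj_left_commute)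
  qed
  \<comment> \<open>Without rows or columns there are no colours, so the set of points is empty.\<close>
  have marg1': "(\<Sum>i<N. fibre_card X F (j, i)) = fibre_card X (\<lambda>x\<in>X. fst (F x)) j"
    if F: "F \<in> X \<rightarrow>\<^sub>E ?K" and ji: "j < ?m" for F j
  proof (cases "N = 0")
    case True
    then have "X = {}" using F by auto
    then show ?thesis using True by (simp add: fibre_card_def)
  qed (use marg1[OF F ji, of 0] in auto)
  have marg2': "(\<Sum>j<?m. fibre_card X F (j, i)) = fibre_card X (\<lambda>x\<in>X. snd (F x)) i"
    if F: "F \<in> X \<rightarrow>\<^sub>E ?K" and ji: "i < N" for F i
  proof (cases "?m = 0")
    case True
    then have "X = {}" using F by auto
    then show ?thesis using True by (simp add: fibre_card_def)
  qed (use marg2[OF F _ ji, of 0] in auto)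
  have Q0iff: "Q0 (?cont F) \<longleftrightarrow>
      (\<forall>j<?m. fibre_card X (\<lambda>x\<in>X. fst (F x)) j = snd (T ! j)) \<and>
      (\<forall>i<N. int (fibre_card X (\<lambda>x\<in>X. snd (F x)) i) = \<alpha> i)" if F: "F \<in> X \<rightarrow>\<^sub>E ?K" for F
    unfolding Q0_def using marg1'[OF F] marg2'[OF F] by (auto simp flip: of_nat_sum)
  have prod: "signed_young_char X T g * young_char X N \<alpha> g =
      (\<Sum>F \<in> ?Fs. if g \<in> colour_stab X F then sign (perm_on g {x \<in> X. ?mn (F x)}) else 0)"
    if g: "g permutes X" for g
  proof -
    have gX: "g x \<in> X \<longleftrightarrow> x \<in> X" for x by (rule permutes_in_image[OF g])
    let ?A = "fixed_colourings X ?m (\<lambda>j. int (snd (T ! j))) g"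
    let ?B = "fixed_colourings X N \<alpha> g"
    have "signed_young_char X T g * young_char X N \<alpha> g =
       (\<Sum>(f, h) \<in> ?A \<times> ?B. sign (perm_on g {x \<in> X. fst (T ! f x)}))"
      unfolding signed_young_char_def young_char_def
      by (simp add: sum.cartesian_product[symmetric] sum_distrib_right sum_distrib_left mult.commute)
    also have "\<dots> = (\<Sum>F | F \<in> ?Fs \<and> g \<in> colour_stab X F. sign (perm_on g {x \<in> X. ?mn (F x)}))"
    proof (rule sum.reindex_bij_witness[where j = "\<lambda>(f, h). \<lambda>x\<in>X. (f x, h x)"
          and i = "\<lambda>F. (\<lambda>x\<in>X. fst (F x), \<lambda>x\<in>X. snd (F x))"])
      fix fh assume fh: "fh \<in> ?A \<times> ?B"
      obtain f h where e: "fh = (f, h)" by force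
      have f: "f \<in> X \<rightarrow>\<^sub>E {..<?m}" "h \<in> X \<rightarrow>\<^sub>E {..<N}" using fh e by (auto simp: fixed_colourings_def)
      have p: "(\<lambda>x\<in>X. fst ((\<lambda>x\<in>X. (f x, h x)) x)) = f" "(\<lambda>x\<in>X. snd ((\<lambda>x\<in>X. (f x, h x)) x)) = h"
        using f by (auto simp: fun_eq_iff PiE_def extensional_def)
      then show "(\<lambda>x\<in>X. fst ((case fh of (f, h) \<Rightarrow> \<lambda>x\<in>X. (f x, h x)) x),
          \<lambda>x\<in>X. snd ((case fh of (f, h) \<Rightarrow> \<lambda>x\<in>X. (f x, h x)) x)) = fh" unfolding e by simp
      have F: "(\<lambda>x\<in>X. (f x, h x)) \<in> X \<rightarrow>\<^sub>E ?K" using f by auto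
      have "Q0 (?cont (\<lambda>x\<in>X. (f x, h x)))"
        unfolding Q0iff[OF F] p using fh by (auto simp: e fixed_colourings_def)
      moreover have "g \<in> colour_stab X (\<lambda>x\<in>X. (f x, h x))"
        using fh g gX by (auto simp: e fixed_colourings_def colour_stab_def)
      ultimately show "(case fh of (f, h) \<Rightarrow> \<lambda>x\<in>X. (f x, h x)) \<in> {F. F \<in> ?Fs \<and> g \<in> colour_stab X F}"
        using F unfolding e by simp
      have "{x \<in> X. ?mn ((\<lambda>x\<in>X. (f x, h x)) x)} = {x \<in> X. fst (T ! f x)}" by auto
      then show "sign (perm_on g {x \<in> X. ?mn ((case fh of (f, h) \<Rightarrow> \<lambda>x\<in>X. (f x, h x)) x)}) =
         (case fh of (f, h) \<Rightarrow> sign (perm_on g {x \<in> X. fst (T ! f x)}))" unfolding e by simp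
    next
      fix F assume F: "F \<in> {F. F \<in> ?Fs \<and> g \<in> colour_stab X F}"
      then have FX: "F \<in> X \<rightarrow>\<^sub>E ?K" "Q0 (?cont F)" "\<And>x. x \<in> X \<Longrightarrow> F (g x) = F x"
        by (auto simp: colour_stab_def)
      show "(case (\<lambda>x\<in>X. fst (F x), \<lambda>x\<in>X. snd (F x)) of (f, h) \<Rightarrow> \<lambda>x\<in>X. (f x, h x)) = F"
        using FX(1) by (auto simp: fun_eq_iff PiE_def extensional_def)
      show "(\<lambda>x\<in>X. fst (F x), \<lambda>x\<in>X. snd (F x)) \<in> ?A \<times> ?B"
        using FX(2) unfolding Q0iff[OF FX(1)] using FX(1,3) gX
        by (auto simp: fixed_colourings_def PiE_def Pi_def)
    qed
    also have "\<dots> = (\<Sum>F \<in> ?Fs. if g \<in> colour_stab X F then sign (perm_on g {x \<in> X. ?mn (F x)}) else 0)"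
      using finF by (simp add: sum.inter_filter[symmetric])
    finally show ?thesis .
  qed
  have "(\<Sum>g | g permutes X. signed_young_char X T g * young_char X N \<alpha> g) =
     (\<Sum>F \<in> ?Fs. \<Sum>g | g permutes X. if g \<in> colour_stab X F then sign (perm_on g {x \<in> X. ?mn (F x)}) else 0)"
    by (subst sum.swap) (intro sum.cong refl prod, simp)
  also have "\<dots> = (\<Sum>F \<in> ?Fs. \<Sum>g \<in> colour_stab X F. sign (perm_on g {x \<in> X. ?mn (F x)}))"
  proof (rule sum.cong[OF refl])
    fix F :: "'a \<Rightarrow> nat \<times> nat"
    have "colour_stab X F = {g \<in> {g. g permutes X}. g \<in> colour_stab X F}" by (auto simp: colour_stab_def)
    then show "(\<Sum>g | g permutes X. if g \<in> colour_stab X F then sign (perm_on g {x \<in> X. ?mn (F x)}) else 0)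
      = (\<Sum>g \<in> colour_stab X F. sign (perm_on g {x \<in> X. ?mn (F x)}))"
      using sum.inter_filter[OF finP, of "\<lambda>g. sign (perm_on g {x \<in> X. ?mn (F x)})" "\<lambda>g. g \<in> colour_stab X F"]
      by simp
  qed
  also have "\<dots> = (\<Sum>F \<in> ?Fs. if Q1 (?cont F) then int (card (colour_stab X F)) else 0)"
  proof (rule sum.cong[OF refl])
    fix F assume F: "F \<in> ?Fs"
    have "(\<forall>k :: nat \<times> nat. ?mn k \<longrightarrow> fibre_card X F k \<le> 1) \<longleftrightarrow> Q1 (?cont F)"
    proof
      assume "\<forall>k. ?mn k \<longrightarrow> fibre_card X F k \<le> 1"
      then show "Q1 (?cont F)" by (simp add: Q1_def)
    next
      assume Q: "Q1 (?cont F)"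
      show "\<forall>k. ?mn k \<longrightarrow> fibre_card X F k \<le> 1"
      proof (intro allI impI)
        fix k :: "nat \<times> nat" assume k: "?mn k"
        show "fibre_card X F k \<le> 1"
        proof (cases "k \<in> ?K")
          case True
          then show ?thesis using Q k by (cases k) (simp add: Q1_def)
        next
          case False
          then have "{x \<in> X. F x = k} = {}" using F by auto
          then show ?thesis unfolding fibre_card_def by (simp only: card.empty)
        qed
      qed
    qed
    then show "(\<Sum>g \<in> colour_stab X F. sign (perm_on g {x \<in> X. ?mn (F x)})) =
        (if Q1 (?cont F) then int (card (colour_stab X F)) else 0)"
      using sum_sign_colour_stab[OF X, of ?mn F] by simp
  qed
  also have "\<dots> = (\<Sum>F | F \<in> X \<rightarrow>\<^sub>E ?K \<and> (Q0 (?cont F) \<and> Q1 (?cont F)). int (card (colour_stab X F)))"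
    using finF by (simp add: sum.inter_filter[symmetric] conj_assoc)
  also have "\<dots> = int (fact (card X) * card {c \<in> ?K \<rightarrow>\<^sub>E UNIV. sum c ?K = card X \<and> (Q0 c \<and> Q1 c)})"
    unfolding of_nat_sum[symmetric]
    by (rule arg_cong[OF sum_card_colour_stab_fibres]) (use X in auto)
  also have "{c \<in> ?K \<rightarrow>\<^sub>E UNIV. sum c ?K = card X \<and> (Q0 c \<and> Q1 c)} = matrices N \<alpha> T"
  proof -
    have "sum c ?K = card X" if "Q0 c" for c
    proof -
      have "sum c ?K = (\<Sum>j<?m. \<Sum>i<N. c (j, i))" by (rule sum.cartesian_product')
      also have "\<dots> = (\<Sum>i<N. \<Sum>j<?m. c (j, i))" by (rule sum.swap)
      finally have "int (sum c ?K) = (\<Sum>i<N. int (\<Sum>j<?m. c (j, i)))" by (simp only: of_nat_sum)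
      also have "\<dots> = (\<Sum>i<N. \<alpha> i)" using that by (intro sum.cong) (auto simp: Q0_def)
      finally show ?thesis unfolding \<alpha> by (simp only: of_nat_eq_iff)
    qed
    then show ?thesis by (auto simp: matrices_def Q0_def Q1_def)
  qed
  finally show ?thesis by (simp add: card_matrices)
qed

section \<open>Determinantal characters\<close>

text \<open>
  The determinant of the matrix of complete symmetric functions \<open>h_(l i + j)\<close>, as a class function:
  for \<open>l = content_vec p\<close> this is the Jacobi-Trudi expression for the Schur function of \<open>p\<close>.
\<close>

definition determinantal_char :: "'a set \<Rightarrow> nat \<Rightarrow> (nat \<Rightarrow> int) \<Rightarrow> ('a \<Rightarrow> 'a) \<Rightarrow> int" where
  "determinantal_char X N l g =
     (\<Sum>w | w permutes {..<N}. sign w * young_char X N (\<lambda>i. l i + int (w i)) g)"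

text \<open>
  This turns inner products of class functions into coefficients of alternants, to which the Pieri
  rules apply. All permuted exponent vectors have the same sum, which must be the number of points.
\<close>

lemma determinantal_char_pairing:
  assumes X: "finite X" and l: "(\<Sum>i<N. l i) + (\<Sum>i<N. int i) = int (card X)"
  shows "(\<Sum>g | g permutes X. signed_young_char X T g * determinantal_char X N l g) =
     fact (card X) * alt_count N l T"
proof -
  have "(\<Sum>g | g permutes X. signed_young_char X T g * determinantal_char X N l g) =
    (\<Sum>w | w permutes {..<N}. sign w * (\<Sum>g | g permutes X.
        signed_young_char X T g * young_char X N (\<lambda>i. l i + int (w i)) g))"
    unfolding determinantal_char_def sum_distrib_left
    by (subst sum.swap) (simp add: mult.left_commute)
  also have "\<dots> = (\<Sum>w | w permutes {..<N}. sign w *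
       (fact (card X) * matrix_count N (\<lambda>i. l i + int (w i)) T))"
  proof (intro sum.cong refl arg_cong[of _ _ "(*) _"] young_char_pairing X)
    fix w assume "w \<in> {w. w permutes {..<N}}"
    then have "(\<Sum>i<N. int (w i)) = (\<Sum>i<N. int i)"
      using sum.permute[of w "{..<N}" int] by (simp add: comp_def)
    then show "(\<Sum>i<N. l i + int (w i)) = int (card X)"
      using l by (simp add: sum.distrib)
  qed
  also have "\<dots> = fact (card X) * alt_count N l T"
    unfolding alt_count_eq_sum_matrix_count sum_distrib_left by (simp add: mult.left_commute)
  finally show ?thesis .
qed

lemma young_char_eq_signed:
  assumes "\<And>i. i < N \<Longrightarrow> 0 \<le> \<alpha> i"
  shows "young_char X N \<alpha> g = signed_young_char X (map (\<lambda>i. (False, nat (\<alpha> i))) [0..<N]) g"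
proof -
  let ?T = "map (\<lambda>i. (False, nat (\<alpha> i))) [0..<N]"
  have f: "fixed_colourings X N \<alpha> g = fixed_colourings X (length ?T) (\<lambda>j. int (snd (?T ! j))) g"
    unfolding fixed_colourings_def using assms by auto
  have "perm_on g {x \<in> X. fst (?T ! c x)} = id" if c: "c \<in> fixed_colourings X (length ?T) \<beta> g" for c \<beta>
  proof -
    have "c x < N" if "x \<in> X" for x using c that by (auto simp: fixed_colourings_def)
    then have e: "{x \<in> X. fst (?T ! c x)} = {}" by auto
    show ?thesis unfolding e by (auto simp: perm_on_def)
  qed
  then show ?thesis unfolding young_char_def signed_young_char_def f by simp
qed

lemma young_char_negative:
  assumes "i < N" "\<alpha> i < 0"
  shows "young_char X N \<alpha> g = 0"
proof -
  have "fixed_colourings X N \<alpha> g = {}"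
    using assms by (force simp: fixed_colourings_def)
  then show ?thesis by (simp add: young_char_def)
qed

lemma sum_partition_differences:
  fixes p :: "nat \<Rightarrow> nat"
  assumes "antimono p" "k \<le> N"
  shows "(\<Sum>i\<in>{k..<N}. p i - p (Suc i)) = p k - p N"
  using assms(2)
proof (induction N rule: dec_induct)
  case (step n)
  have "p n \<le> p k" "p (Suc n) \<le> p n" using step.hyps by (auto intro!: antimonoD[OF assms(1)])
  then show ?case using step by simp
qed simp

text \<open>
  A horizontal strip contains at most one cell of each column, so \<open>k\<close> strips have at most as many cells
  as the first \<open>k\<close> rows. The induction removes the strips one by one, comparing the tails of the
  row lengths by telescoping.
\<close>

lemma alt_count_nonzero_imp_dominated:
  assumes "is_partition N p" "alt_count N (content_vec p) (map (Pair False) as) \<noteq> 0" "k \<le> length as"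
  shows "(\<Sum>i<k. as ! i) \<le> (\<Sum>i<k. p i)"
  using assms
proof (induction as arbitrary: p k)
  case (Cons r as)
  have "(\<Sum>q \<in> hstrips N p r. alt_count N (content_vec q) (map (Pair False) as)) \<noteq> 0"
    using Cons.prems alt_count_hstrips[OF Cons.prems(1), of r "map (Pair False) as"] by simp
  then obtain q where q: "q \<in> hstrips N p r" "alt_count N (content_vec q) (map (Pair False) as) \<noteq> 0"
    by (rule sum.not_neutral_contains_not_neutral)
  show ?case
  proof (cases k)
    case (Suc k')
    have IH: "(\<Sum>i<k'. as ! i) \<le> (\<Sum>i<k'. q i)"
      using Cons.IH[OF hstrips_is_partition[OF Cons.prems(1) q(1)] q(2)] Cons.prems Suc by simp
    have r: "(\<Sum>i<N. p i - q i) = r" and q': "\<And>i. p (Suc i) \<le> q i" "\<And>i. q i \<le> p i"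
      using q(1) by (auto simp: hstrips_def)
    have anti: "antimono p" using Cons.prems(1) by (simp add: is_partition_def)
    have "r = (\<Sum>i<N. p i - q i)" using r by simp
    also have "\<dots> \<le> (\<Sum>i\<in>{..<k'} \<union> {k'..<N}. p i - q i)" by (rule sum_mono2) auto
    also have "\<dots> = (\<Sum>i<k'. p i - q i) + (\<Sum>i\<in>{k'..<N}. p i - q i)"
      by (rule sum.union_disjoint) auto
    also have "(\<Sum>i\<in>{k'..<N}. p i - q i) \<le> (\<Sum>i\<in>{k'..<N}. p i - p (Suc i))"
      by (rule sum_mono) (use q' in \<open>auto intro: diff_le_mono2\<close>)
    also have "\<dots> \<le> p k'"
      by (cases "k' \<le> N") (auto simp: sum_partition_differences[OF anti])
    finally have "r \<le> (\<Sum>i<k'. p i - q i) + p k'" by simp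
    moreover have "(\<Sum>i<k'. p i - q i) + (\<Sum>i<k'. q i) = (\<Sum>i<k'. p i)"
      unfolding sum.distrib[symmetric] by (rule sum.cong) (use q' in auto)
    ultimately show ?thesis using IH unfolding Suc
      by (simp add: sum.lessThan_Suc_shift[of "\<lambda>i. (r # as) ! i"] del: sum.lessThan_Suc) simp
  qed simp
qed simp

text \<open>
  Horizontal strips as long as the rows can be removed in one way only: each time the strip consists
  of the bottom cells of all columns, and the rows shift up by one.
\<close>

lemma alt_count_row_lengths:
  assumes "is_partition N p" "m \<le> N" "\<And>i. m \<le> i \<Longrightarrow> p i = 0"
  shows "alt_count N (content_vec p) (map (\<lambda>i. (False, p i)) [0..<m]) = 1"
  using assms
proof (induction m arbitrary: p)
  case 0
  then have "p = (\<lambda>_. 0)" by auto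
  then show ?case using alt_count_partition_Nil[OF 0(1)] by (simp del: alt_count.simps)
next
  case (Suc m)
  let ?p' = "\<lambda>i. p (Suc i)"
  have anti: "antimono p" and pN: "p N = 0" using Suc.prems(1) by (auto simp: is_partition_def)
  have tot: "(\<Sum>i<N. p i - p (Suc i)) = p 0"
    using sum_partition_differences[OF anti, of 0 N] pN by (simp add: atLeast0LessThan)
  have "hstrips N p (p 0) = {?p'}"
  proof
    show "hstrips N p (p 0) \<subseteq> {?p'}"
    proof
      fix q assume q: "q \<in> hstrips N p (p 0)"
      then have q': "\<And>i. p (Suc i) \<le> q i" "\<And>i. q i \<le> p i" "(\<Sum>i<N. p i - q i) = p 0"
        by (auto simp: hstrips_def)
      have "q i = p (Suc i)" for i
      proof (rule ccontr)
        assume ne: "q i \<noteq> p (Suc i)"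
        then have "p (Suc i) < q i" using q'(1)[of i] by simp
        moreover have "i < N"
        proof (rule ccontr)
          assume "\<not> i < N"
          then have "p i = 0" using Suc.prems(1) by (simp add: is_partition_def)
          then show False using q'(1,2)[of i] ne by simp
        qed
        ultimately have "(\<Sum>i<N. p i - q i) < (\<Sum>i<N. p i - p (Suc i))"
          using q' by (intro sum_strict_mono_ex1) (auto intro!: bexI[of _ i] diff_le_mono2 diff_less_mono2 intro: less_le_trans)
        then show False using tot q'(3) by simp
      qed
      then show "q \<in> {?p'}" by auto
    qed
    show "{?p'} \<subseteq> hstrips N p (p 0)"
      using tot anti by (auto simp: hstrips_def antimonoD)
  qed
  moreover have "map (\<lambda>i. (False, p i)) [0..<Suc m] = (False, p 0) # map (\<lambda>i. (False, ?p' i)) [0..<m]"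
    unfolding upt_conv_Cons[OF zero_less_Suc] list.map map_Suc_upt[symmetric] by (simp add: comp_def)
  moreover have "is_partition N ?p'"
    using Suc.prems(1) anti by (auto simp: is_partition_def antimono_def)
  then have "alt_count N (content_vec ?p') (map (\<lambda>i. (False, ?p' i)) [0..<m]) = 1"
    using Suc.prems(2,3) by (intro Suc.IH) auto
  ultimately show ?case by (simp add: alt_count_hstrips[OF Suc.prems(1)] del: alt_count.simps upt_Suc)
qed

text \<open>
  Take \<open>k\<close> just beyond the first point moved by \<open>w\<close>, which is necessarily moved up.
\<close>

lemma permutation_ahead:
  assumes w: "w permutes {..<N}" "w \<noteq> id"
  obtains k where "k \<le> N" "(\<Sum>i<k. int i) < (\<Sum>i<k. int (w i))"
proof -
  obtain i0 where "w i0 \<noteq> i0" using w(2) by (auto simp: fun_eq_iff)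
  define i where "i = (LEAST i. w i \<noteq> i)"
  have i: "w i \<noteq> i" unfolding i_def by (rule LeastI[of "\<lambda>i. w i \<noteq> i" i0]) fact
  have less: "w j = j" if "j < i" for j using not_less_Least that unfolding i_def by blast
  have iN: "i < N" using i w(1) by (metis lessThan_iff permutes_not_in)
  have "i < w i"
  proof (rule ccontr)
    assume "\<not> i < w i"
    then have "w i < i" using i by simp
    then have "w (w i) = w i" by (rule less)
    then show False using i permutes_inj[OF w(1)] by (metis injD)
  qed
  then have "(\<Sum>j<Suc i. int j) < (\<Sum>j<Suc i. int (w j))" using less by simp
  then show ?thesis using iN by (intro that[of "Suc i"]) auto
qed

lemma sum_content_vec:
  "(\<Sum>i<N. content_vec p i) + (\<Sum>i<N. int i) = int (\<Sum>i<N. p i)"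
  by (simp add: content_vec_def sum_subtractf)

text \<open>
  The terms of one factor are permutation characters of types \<open>\<lambda>_i - i + w i\<close>. For \<open>w \<noteq> id\<close> these types
  are not dominated by the partition, so they pair to 0 with the other factor.
\<close>

lemma determinantal_char_norm:
  assumes X: "finite X" and p: "is_partition N p" and sz: "(\<Sum>i<N. p i) = card X"
  shows "(\<Sum>g | g permutes X. determinantal_char X N (content_vec p) g ^ 2) = fact (card X)"
proof -
  let ?l = "content_vec p"
  let ?\<psi> = "determinantal_char X N ?l"
  let ?Y = "\<lambda>w. young_char X N (\<lambda>i. ?l i + int (w i))"
  have l: "(\<Sum>i<N. ?l i) + (\<Sum>i<N. int i) = int (card X)" using sz by (simp add: sum_content_vec)
  have pairing: "(\<Sum>g | g permutes X. ?Y w g * ?\<psi> g) = fact (card X) * of_bool (w = id)"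
    if w: "w permutes {..<N}" for w
  proof (cases "\<exists>i<N. ?l i + int (w i) < 0")
    case True
    then obtain i where i: "i < N" "?l i + int (w i) < 0" by blast
    then have "w \<noteq> id" by (auto simp: content_vec_def)
    moreover have "?Y w g = 0" for g by (rule young_char_negative) (use i in auto)
    ultimately show ?thesis by simp
  next
    case False
    then have nn: "0 \<le> ?l i + int (w i)" if "i < N" for i using that by force
    let ?as = "map (\<lambda>i. nat (?l i + int (w i))) [0..<N]"
    have "(\<Sum>g | g permutes X. ?Y w g * ?\<psi> g) =
       (\<Sum>g | g permutes X. signed_young_char X (map (Pair False) ?as) g * ?\<psi> g)"
      by (simp add: young_char_eq_signed nn comp_def)
    also have "\<dots> = fact (card X) * alt_count N ?l (map (Pair False) ?as)"
      by (rule determinantal_char_pairing[OF X l])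
    also have "alt_count N ?l (map (Pair False) ?as) = of_bool (w = id)"
    proof (cases "w = id")
      case True
      then show ?thesis
        using alt_count_row_lengths[OF p, of N] p
        by (simp add: content_vec_def comp_def is_partition_def)
    next
      case False
      then obtain k where k: "k \<le> N" "(\<Sum>i<k. int i) < (\<Sum>i<k. int (w i))"
        using permutation_ahead[OF w] by blast
      have "int (\<Sum>i<k. ?as ! i) = (\<Sum>i<k. ?l i + int (w i))"
        unfolding of_nat_sum using k(1) nn by (intro sum.cong) auto
      also have "\<dots> = int (\<Sum>i<k. p i) - (\<Sum>i<k. int i) + (\<Sum>i<k. int (w i))"
        using sum_content_vec[of p k] by (simp add: sum.distrib)
      finally have "\<not> (\<Sum>i<k. ?as ! i) \<le> (\<Sum>i<k. p i)" using k(2) by linarith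
      then have "alt_count N ?l (map (Pair False) ?as) = 0"
        using alt_count_nonzero_imp_dominated[OF p, of ?as k] k(1) by auto
      then show ?thesis using False by simp
    qed
    finally show ?thesis .
  qed
  have "(\<Sum>g | g permutes X. ?\<psi> g ^ 2) =
     (\<Sum>g | g permutes X. \<Sum>w | w permutes {..<N}. sign w * (?Y w g * ?\<psi> g))"
    unfolding power2_eq_square determinantal_char_def[of X N ?l] sum_distrib_right
    by (simp add: mult.assoc)
  also have "\<dots> = (\<Sum>w | w permutes {..<N}. sign w * (\<Sum>g | g permutes X. ?Y w g * ?\<psi> g))"
    unfolding sum_distrib_left by (rule sum.swap)
  also have "\<dots> = (\<Sum>w | w permutes {..<N}. sign w * (fact (card X) * of_bool (w = id)))"
    using pairing by simp
  also have "\<dots> = (\<Sum>w\<in>{id :: nat \<Rightarrow> nat}. fact (card X))"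
    by (rule sum.mono_neutral_cong_right) (auto simp: finite_permutations permutes_id)
  finally show ?thesis by simp
qed

section \<open>Class functions vanishing on elements of even order\<close>

text \<open>
  The terms of the product of the \<open>q_r = (\<Sum>i\<le>r. h_i * e_(r - i))\<close> for \<open>r\<close> in \<open>R\<close>.
\<close>

fun splittings :: "nat list \<Rightarrow> (bool \<times> nat) list set" where
  "splittings [] = {[]}"
| "splittings (r # R) = (\<Union>i\<le>r. (\<lambda>T. (False, i) # (True, r - i) # T) ` splittings R)"

lemma finite_splittings: "finite (splittings R)"
  by (induction R) auto

text \<open>
  In this form a splitting is the list of fibre sizes of a colouring in which the colours \<open>2 * j\<close> and
  \<open>Suc (2 * j)\<close> together are used \<open>R ! j\<close> times.
\<close>

lemma mem_splittings:
  "T \<in> splittings R \<longleftrightarrow> length T = 2 * length R \<and> (\<forall>k<length T. fst (T ! k) = odd k) \<and>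
     (\<forall>j<length R. snd (T ! (2 * j)) + snd (T ! Suc (2 * j)) = R ! j)"
proof (induction R arbitrary: T)
  case (Cons r R)
  show ?case
  proof
    assume "T \<in> splittings (r # R)"
    then obtain i T' where T: "i \<le> r" "T = (False, i) # (True, r - i) # T'" "T' \<in> splittings R" by auto
    note IH = T(3)[unfolded Cons.IH]
    show "length T = 2 * length (r # R) \<and> (\<forall>k<length T. fst (T ! k) = odd k) \<and>
     (\<forall>j<length (r # R). snd (T ! (2 * j)) + snd (T ! Suc (2 * j)) = (r # R) ! j)"
      using T(1) IH unfolding T(2)
      by (auto simp: nth_Cons split: nat.splits) 
  next
    assume A: "length T = 2 * length (r # R) \<and> (\<forall>k<length T. fst (T ! k) = odd k) \<and>
     (\<forall>j<length (r # R). snd (T ! (2 * j)) + snd (T ! Suc (2 * j)) = (r # R) ! j)"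
    then obtain a b T' where T: "T = a # b # T'"
      by (cases T; cases "tl T") auto
    have 1: "fst a = False" "fst b = True" "snd a + snd b = r"
      using A unfolding T by (auto dest: spec[of _ 0] spec[of _ 1])
    have "fst (T' ! k) = odd k" if "k < length T'" for k
      using A that unfolding T by (auto dest: spec[of _ "Suc (Suc k)"])
    moreover have "snd (T' ! (2 * j)) + snd (T' ! Suc (2 * j)) = R ! j" if "j < length R" for j
    proof -
      have "snd (T ! (2 * Suc j)) + snd (T ! Suc (2 * Suc j)) = (r # R) ! Suc j" using A that by auto
      then show ?thesis by (simp add: T)
    qed
    ultimately have "T' \<in> splittings R" using A by (simp add: Cons.IH T)
    moreover have "a = (False, snd a)" "b = (True, r - snd a)" "snd a \<le> r" using 1 by (auto simp: prod_eq_iff)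
    ultimately show "T \<in> splittings (r # R)" unfolding T
      by (auto intro!: bexI[of _ "snd a"] image_eqI[of _ _ T'] simp del: prod.collapse)
  qed
qed auto

lemma sign_cycle_of_list:
  "distinct cs \<Longrightarrow> sign (cycle_of_list cs) = (- 1) ^ (length cs - 1)"
proof (induction cs rule: cycle_of_list.induct)
  case (1 i j cs)
  have "sign (cycle_of_list (i # j # cs)) = sign (transpose i j) * sign (cycle_of_list (j # cs))"
    unfolding cycle_of_list.simps
    by (rule sign_compose[OF permutation_swap_id permutation_of_cycle])
  then show ?case using 1 by (simp add: sign_swap_id del: cycle_of_list.simps)
qed (auto simp: sign_id)

lemma sign_perm_on_orbit:
  assumes g: "permutation g" and ev: "even (least_power g x)"
  shows "sign (perm_on g (set (support g x))) = - 1"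
proof -
  have "perm_on g (set (support g x)) = cycle_of_list (support g x)"
    using cycle_restrict[OF g, of _ x] id_outside_supp[of _ "support g x"]
    by (auto simp: perm_on_def fun_eq_iff)
  moreover have "odd (length (support g x) - 1)"
    using least_power_of_permutation(2)[OF g, of x] ev by simp
  ultimately show ?thesis
    using sign_cycle_of_list[OF cycle_of_permutation[OF g, of x]] by simp
qed

definition partner_colour :: "nat \<Rightarrow> nat" where
  "partner_colour k = (if even k then Suc k else k - 1)"

text \<open>
  An invariant colouring is constant on the orbit of \<open>x\<close>. Recolouring this orbit with the partner colour
  preserves the joint fibre sizes and reverses the sign, since a cycle of even length is odd. This is
  the group-theoretic form of the fact that \<open>q_r\<close> involves only odd power sums.
\<close>

lemma sum_splittings_signed_young_char_even:
  assumes X: "finite X" and g: "g permutes X" and x: "x \<in> X" and ev: "even (least_power g x)"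
  shows "(\<Sum>T \<in> splittings R. signed_young_char X T g) = 0"
proof -
  let ?m = "length R"
  have perm: "permutation g" using g X permutation_permutes by blast
  have gX: "g y \<in> X \<longleftrightarrow> y \<in> X" for y by (rule permutes_in_image[OF g])
  define orb where "orb = set (support g x)"
  have orb: "orb = range (\<lambda>i. (g ^^ i) x)" unfolding orb_def by (rule support_set[OF perm])
  have orbX: "orb \<subseteq> X"
    unfolding orb using permutes_in_image[OF permutes_funpow[OF g]] x by auto
  have gorb: "g y \<in> orb \<longleftrightarrow> y \<in> orb" for y
  proof
    assume "y \<in> orb"
    then obtain i where "y = (g ^^ i) x" unfolding orb by auto
    then have "g y = (g ^^ Suc i) x" by simp
    then show "g y \<in> orb" unfolding orb by blast
  next
    assume "g y \<in> orb"
    then obtain i where i: "g y = (g ^^ i) x" unfolding orb by auto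
    obtain d where d: "(g ^^ d) = id" "d > 0" by (rule permutation_is_nilpotent[OF perm])
    have "g y = (g ^^ (d + i)) x" using i d(1) by (simp add: funpow_add)
    then have "g y = g ((g ^^ (d + i - 1)) x)" using d(2) by (cases "d + i") auto
    then have "y = (g ^^ (d + i - 1)) x" by (rule injD[OF permutes_inj[OF g]])
    then show "y \<in> orb" unfolding orb by auto
  qed
  have sgn_orb: "sign (perm_on g orb) = - 1" unfolding orb_def by (rule sign_perm_on_orbit[OF perm ev])
  define U where "U = {f \<in> X \<rightarrow>\<^sub>E {..<2 * ?m}. (\<forall>y\<in>X. f (g y) = f y) \<and>
     (\<forall>j<?m. fibre_card X f (2 * j) + fibre_card X f (Suc (2 * j)) = R ! j)}"
  define h where "h = (\<lambda>f :: 'a \<Rightarrow> nat. sign (perm_on g {y \<in> X. odd (f y)}))"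
  have finU: "finite U" unfolding U_def
    by (rule finite_subset[of _ "X \<rightarrow>\<^sub>E {..<2 * ?m}"]) (use X in \<open>auto intro: finite_PiE\<close>)
  define \<tau> where "\<tau> = (\<lambda>f :: 'a \<Rightarrow> nat. map (\<lambda>k. (odd k, fibre_card X f k)) [0..<2 * ?m])"
  have "(\<Sum>T \<in> splittings R. signed_young_char X T g) = (\<Sum>T \<in> splittings R. \<Sum>f | f \<in> U \<and> \<tau> f = T. h f)"
  proof (rule sum.cong[OF refl])
    fix T assume T: "T \<in> splittings R"
    then have len: "length T = 2 * ?m" and T1: "\<And>k. k < 2 * ?m \<Longrightarrow> fst (T ! k) = odd k"
      and T2: "\<And>j. j < ?m \<Longrightarrow> snd (T ! (2 * j)) + snd (T ! Suc (2 * j)) = R ! j"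
      by (auto simp: mem_splittings)
    have fib: "\<tau> f = T \<longleftrightarrow> (\<forall>k<2 * ?m. fibre_card X f k = snd (T ! k))" for f
    proof -
      have nth: "\<tau> f ! k = T ! k \<longleftrightarrow> fibre_card X f k = snd (T ! k)" if "k < 2 * ?m" for k
        using T1[OF that] that by (cases "T ! k") (simp add: \<tau>_def)
      have "length (\<tau> f) = 2 * ?m" by (simp add: \<tau>_def)
      then show ?thesis by (simp add: list_eq_iff_nth_eq len nth)
    qed
    have set_eq: "{f. f \<in> U \<and> \<tau> f = T} = fixed_colourings X (length T) (\<lambda>j. int (snd (T ! j))) g"
    proof -
      have "\<forall>j<?m. fibre_card X f (2 * j) + fibre_card X f (Suc (2 * j)) = R ! j"
        if "\<forall>k<2 * ?m. fibre_card X f k = snd (T ! k)" for f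
        using that T2 by simp
      then show ?thesis unfolding fib U_def fixed_colourings_def len of_nat_eq_iff by blast
    qed
    show "signed_young_char X T g = (\<Sum>f | f \<in> U \<and> \<tau> f = T. h f)"
      unfolding set_eq signed_young_char_def h_def
    proof (intro sum.cong refl arg_cong[of _ _ "\<lambda>A. sign (perm_on g A)"] Collect_cong conj_cong)
      fix f y assume f: "f \<in> fixed_colourings X (length T) (\<lambda>j. int (snd (T ! j))) g" "y \<in> X"
      then have "f y < 2 * ?m" using len by (auto simp: fixed_colourings_def)
      then show "fst (T ! f y) = odd (f y)" by (rule T1)
    qed
  qed
  also have "\<dots> = sum h U"
  proof (rule sum.group[OF finU finite_splittings])
    show "\<tau> ` U \<subseteq> splittings R" by (auto simp: \<tau>_def U_def mem_splittings)
  qed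
  also have "\<dots> = 0"
  proof -
    define flip where "flip = (\<lambda>f y. if y \<in> orb then partner_colour (f y) else f y)"
    have const: "f y = f x" if "f \<in> U" "y \<in> orb" for f y
    proof -
      have "f ((g ^^ i) x) = f x" for i
      proof (induction i)
        case (Suc i)
        have "(g ^^ i) x \<in> X" using orbX orb by auto
        then show ?case using Suc that(1) by (simp add: U_def)
      qed simp
      then show ?thesis using that(2) unfolding orb by auto
    qed
    have flip: "flip f \<in> U \<and> flip (flip f) = f \<and> h (flip f) = - h f" if f: "f \<in> U" for f
    proof -
      have fX: "f y < 2 * ?m" if "y \<in> X" for y using f that by (auto simp: U_def)
      have op: "partner_colour (partner_colour k) = k" "odd (partner_colour k) = even k"
        "k < 2 * ?m \<Longrightarrow> partner_colour k < 2 * ?m" "partner_colour k div 2 = k div 2" for k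
        by (auto simp: partner_colour_def elim!: evenE oddE)
      have ff: "flip (flip f) = f" by (auto simp: flip_def op)
      have PiE: "flip f \<in> X \<rightarrow>\<^sub>E {..<2 * ?m}"
        using f orbX fX op(3) by (auto simp: U_def flip_def PiE_def Pi_def extensional_def)
      have inv: "\<forall>y\<in>X. flip f (g y) = flip f y" using f gorb by (auto simp: U_def flip_def)
      have pair: "fibre_card X u (2 * j) + fibre_card X u (Suc (2 * j)) = card {y \<in> X. u y div 2 = j}"
        for u :: "'a \<Rightarrow> nat" and j
      proof -
        have "{y \<in> X. u y div 2 = j} = {y \<in> X. u y = 2 * j} \<union> {y \<in> X. u y = Suc (2 * j)}" by auto
        also have "card \<dots> = card {y \<in> X. u y = 2 * j} + card {y \<in> X. u y = Suc (2 * j)}"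
          using X by (intro card_Un_disjoint) auto
        finally show ?thesis by (simp add: fibre_card_def)
      qed
      have "flip f y div 2 = f y div 2" for y by (simp add: flip_def op)
      then have "flip f \<in> U" using f PiE inv unfolding U_def pair by simp
      moreover have "h (flip f) = - h f"
      proof -
        let ?A = "{y \<in> X. odd (f y) \<and> y \<notin> orb}"
        have A: "perm_on g ?A permutes X" "perm_on g orb permutes X"
          using g X f gX gorb orbX by (auto intro!: perm_on_permutes simp: U_def)
        have "perm_on g (?A \<union> orb) = perm_on g ?A \<circ> perm_on g orb"
          using gorb by (auto simp: perm_on_def fun_eq_iff)
        moreover have "permutation (perm_on g ?A)" "permutation (perm_on g orb)"
          using A X permutation_permutes by blast+
        ultimately have s: "sign (perm_on g (?A \<union> orb)) = - sign (perm_on g ?A)"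
          using sgn_orb by (simp add: sign_compose)
        show ?thesis
        proof (cases "odd (f x)")
          case True
          then have "{y \<in> X. odd (f y)} = ?A \<union> orb" "{y \<in> X. odd (flip f y)} = ?A"
            using const[OF f] orbX by (auto simp: flip_def op)
          then show ?thesis using s by (simp add: h_def)
        next
          case False
          then have "{y \<in> X. odd (f y)} = ?A" "{y \<in> X. odd (flip f y)} = ?A \<union> orb"
            using const[OF f] orbX by (auto simp: flip_def op)
          then show ?thesis using s by (simp add: h_def)
        qed
      qed
      ultimately show ?thesis using ff by blast
    qed
    have "sum h U = (\<Sum>f\<in>U. - h f)"
      by (rule sum.reindex_bij_witness[where i = flip and j = flip]) (use flip in auto)
    then show ?thesis by (simp add: sum_negf)
  qed
  finally show ?thesis .
qed

text \<open>
  The product of the orbit lengths is a multiple of the order.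
\<close>

lemma odd_ord_if_odd_orbits:
  assumes g: "g permutes {1..n}" and odd: "\<And>x. x \<in> {1..n} \<Longrightarrow> odd (least_power g x)"
  shows "odd (group.ord (sym_group n) g)"
proof -
  interpret group "sym_group n" by (rule sym_group_is_group)
  have gc: "g \<in> carrier (sym_group n)" using g by (simp add: sym_group_carrier)
  have perm: "permutation g" using g permutation_permutes by blast
  define m where "m = (\<Prod>x\<in>{1..n}. least_power g x)"
  have "(g ^^ m) x = x" for x
  proof (cases "x \<in> {1..n}")
    case True
    then have "least_power g x dvd m" unfolding m_def by (intro dvd_prodI) auto
    then show ?thesis using least_power_dvd[OF perm] by blast
  next
    case False
    then show ?thesis by (rule permutes_not_in[OF permutes_funpow[OF g]])
  qed
  then have "g ^^ m = id" by auto
  moreover have "g [^]\<^bsub>sym_group n\<^esub> k = g ^^ k" for k :: nat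
  proof (induction k)
    case 0
    then show ?case by (simp add: sym_group_one)
  next
    case (Suc k)
    have "g [^]\<^bsub>sym_group n\<^esub> Suc k = (g ^^ k) \<circ> g" using Suc by (simp add: sym_group_mult)
    then show ?case by (simp only: funpow_Suc_right)
  qed
  ultimately have "ord g dvd m" using pow_eq_id[OF gc, of m] by (simp add: sym_group_one)
  moreover have "odd m" unfolding m_def using odd by (simp add: prod.neutral even_prod_iff)
  ultimately show ?thesis by (meson dvd_trans)
qed

section \<open>Tableaux and colourings\<close>

definition row_length :: "nat list \<Rightarrow> nat \<Rightarrow> nat" where
  "row_length lam i = (if i < length lam then lam ! i else 0)"

lemma mem_young_diagram: "(i, j) \<in> young_diagram lam \<longleftrightarrow> j < row_length lam i"
  by (auto simp: young_diagram_def row_length_def)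

lemma card_young_diagram_rows: "card {c \<in> young_diagram lam. fst c < k} = (\<Sum>i<k. row_length lam i)"
proof -
  have "{c \<in> young_diagram lam. fst c < k} = (SIGMA i:{..<k}. {..<row_length lam i})"
    by (auto simp: mem_young_diagram)
  then show ?thesis by simp
qed

lemma card_by_columns:
  assumes "finite D"
  shows "card {c \<in> D. P c} = (\<Sum>j\<in>snd ` D. card {i. (i, j) \<in> D \<and> P (i, j)})"
proof -
  have "card {c \<in> D. P c} = (\<Sum>j\<in>snd ` D. card {c \<in> {c \<in> D. P c}. snd c = j})"
  proof -
    have "snd ` {c \<in> D. P c} \<subseteq> snd ` D" by auto
    then show ?thesis
      using sum.group[of "{c \<in> D. P c}" "snd ` D" snd "\<lambda>_. 1::nat"] assms by simp
  qed
  also have "\<dots> = (\<Sum>j\<in>snd ` D. card {i. (i, j) \<in> D \<and> P (i, j)})"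
  proof (rule sum.cong[OF refl])
    fix j
    have "{c \<in> {c \<in> D. P c}. snd c = j} = (\<lambda>i. (i, j)) ` {i. (i, j) \<in> D \<and> P (i, j)}" by auto
    then show "card {c \<in> {c \<in> D. P c}. snd c = j} = card {i. (i, j) \<in> D \<and> P (i, j)}"
      by (simp add: card_image inj_on_def)
  qed
  finally show ?thesis .
qed

lemma card_bij_pred:
  assumes "bij_betw t D X"
  shows "card {x \<in> X. P x} = card {c \<in> D. P (t c)}"
proof -
  have "bij_betw t {c \<in> D. P (t c)} {x \<in> X. P x}"
    using assms by (auto simp: bij_betw_def inj_on_def)
  then show ?thesis by (rule bij_betw_same_card[symmetric])
qed

text \<open>
  When this fails, a transposition fixes the colouring and lies in the column stabilizer, so the
  corresponding row symmetrizer and column antisymmetrizer annihilate each other.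
\<close>

definition separates_columns :: "nat list \<Rightarrow> (nat \<times> nat \<Rightarrow> nat) \<Rightarrow> (nat \<Rightarrow> nat) \<Rightarrow> bool" where
  "separates_columns lam t f \<longleftrightarrow>
     (\<forall>i i' j. (i, j) \<in> young_diagram lam \<longrightarrow> (i', j) \<in> young_diagram lam \<longrightarrow>
        f (t (i, j)) = f (t (i', j)) \<longrightarrow> i = i')"

lemma separates_columns_column_card:
  assumes lam: "sorted_wrt (\<ge>) lam" and sep: "separates_columns lam t f"
  shows "card {i. (i, j) \<in> young_diagram lam \<and> f (t (i, j)) < k} \<le>
         card {i. (i, j) \<in> young_diagram lam \<and> i < k}" (is "card ?A \<le> card ?B")
proof -
  define h where "h = card {i. (i, j) \<in> young_diagram lam}"
  have col: "(i, j) \<in> young_diagram lam \<longleftrightarrow> i < h" for i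
    using column_eq_lessThan[OF lam, of j] unfolding h_def by blast
  have "?B = {..<min h k}" by (auto simp: col)
  moreover have "card ?A \<le> h" using card_mono[of "{..<h}" ?A] by (auto simp: col)
  moreover have "card ?A \<le> k"
  proof -
    have "inj_on (\<lambda>i. f (t (i, j))) ?A"
      using sep unfolding separates_columns_def inj_on_def by blast
    then have "card ?A = card ((\<lambda>i. f (t (i, j))) ` ?A)" by (simp add: card_image)
    also have "\<dots> \<le> card {..<k}" by (rule card_mono) auto
    finally show ?thesis by simp
  qed
  ultimately show ?thesis by simp
qed

text \<open>
  The basic combinatorial lemma: a column of length \<open>h\<close> contains at most \<open>min h k\<close> points of the first
  \<open>k\<close> colours, which is its number of cells in the first \<open>k\<close> rows.
\<close>

lemma separates_columns_imp_dominated: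
  assumes lam: "sorted_wrt (\<ge>) lam" and t: "tableau lam t" and sep: "separates_columns lam t f"
  shows "card {x \<in> {1..sum_list lam}. f x < k} \<le> (\<Sum>i<k. row_length lam i)"
proof -
  let ?D = "young_diagram lam"
  have "card {x \<in> {1..sum_list lam}. f x < k} = card {c \<in> ?D. f (t c) < k}"
    by (rule card_bij_pred) (use t in \<open>simp add: tableau_def\<close>)
  also have "\<dots> = (\<Sum>j\<in>snd ` ?D. card {i. (i, j) \<in> ?D \<and> f (t (i, j)) < k})"
    by (rule card_by_columns[OF finite_young_diagram])
  also have "\<dots> \<le> (\<Sum>j\<in>snd ` ?D. card {i. (i, j) \<in> ?D \<and> i < k})"
    by (rule sum_mono) (rule separates_columns_column_card[OF lam sep])
  also have "\<dots> = card {c \<in> ?D. fst c < k}"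
    by (subst card_by_columns[OF finite_young_diagram]) simp
  finally show ?thesis by (simp add: card_young_diagram_rows)
qed

lemma card_less_eq_sum_fibre_card:
  assumes "finite X"
  shows "card {x \<in> X. f x < (k::nat)} = (\<Sum>i<k. fibre_card X f i)"
proof -
  have "card {x \<in> X. f x < k} = (\<Sum>i<k. card {x \<in> {x \<in> X. f x < k}. f x = i})"
  proof -
    have "f ` {x \<in> X. f x < k} \<subseteq> {..<k}" by auto
    then show ?thesis
      using sum.group[of "{x \<in> X. f x < k}" "{..<k}" f "\<lambda>_. 1::nat"] assms by simp
  qed
  also have "\<dots> = (\<Sum>i<k. fibre_card X f i)"
    unfolding fibre_card_def by (intro sum.cong refl arg_cong[of _ _ card]) auto
  finally show ?thesis .
qed

text \<open>
  With the content of \<open>lam\<close> the column bounds are all attained, so each column of length \<open>h\<close> carries the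
  colours \<open>0, ..., h - 1\<close> once each and can be sorted.
\<close>

lemma separates_columns_imp_column_perm:
  assumes lam: "sorted_wrt (\<ge>) lam" and t: "tableau lam t" and sep: "separates_columns lam t f"
    and content: "\<And>i. fibre_card {1..sum_list lam} f i = row_length lam i"
  obtains q where "q \<in> column_stabilizer lam t"
    "\<And>c. c \<in> young_diagram lam \<Longrightarrow> f (q (t c)) = fst c"
proof -
  let ?D = "young_diagram lam" and ?X = "{1..sum_list lam}"
  have bt: "bij_betw t ?D ?X" using t by (simp add: tableau_def)
  have fin: "finite ?D" by (rule finite_young_diagram)
  have eq: "card {i. (i, j) \<in> ?D \<and> f (t (i, j)) < k} = card {i. (i, j) \<in> ?D \<and> i < k}"
    if j: "j \<in> snd ` ?D" for j k
  proof (rule ccontr)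
    assume "card {i. (i, j) \<in> ?D \<and> f (t (i, j)) < k} \<noteq> card {i. (i, j) \<in> ?D \<and> i < k}"
    then have "card {i. (i, j) \<in> ?D \<and> f (t (i, j)) < k} < card {i. (i, j) \<in> ?D \<and> i < k}"
      using separates_columns_column_card[OF lam sep, of j k] by simp
    then have "(\<Sum>j\<in>snd ` ?D. card {i. (i, j) \<in> ?D \<and> f (t (i, j)) < k}) <
        (\<Sum>j\<in>snd ` ?D. card {i. (i, j) \<in> ?D \<and> i < k})"
      using separates_columns_column_card[OF lam sep] j fin by (intro sum_strict_mono_ex1) auto
    then have "card {c \<in> ?D. f (t c) < k} < card {c \<in> ?D. fst c < k}"
      by (simp add: card_by_columns[OF fin])
    moreover have "card {c \<in> ?D. f (t c) < k} = card {x \<in> ?X. f x < k}"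
      using card_bij_pred[OF bt, of "\<lambda>x. f x < k"] by simp
    moreover have "card {x \<in> ?X. f x < k} = card {c \<in> ?D. fst c < k}"
      unfolding card_less_eq_sum_fibre_card[OF finite_atLeastAtMost] card_young_diagram_rows
      by (rule sum.cong[OF refl content])
    ultimately show False by linarith
  qed
  \<comment> \<open>A column of length \<open>h\<close> already has \<open>h\<close> entries with a colour below \<open>h\<close>, hence no others.\<close>
  have val: "(f (t (i, j)), j) \<in> ?D" if ij: "(i, j) \<in> ?D" for i j
  proof -
    define h where "h = card {i. (i, j) \<in> ?D}"
    have col: "(i, j) \<in> ?D \<longleftrightarrow> i < h" for i
      using column_eq_lessThan[OF lam, of j] unfolding h_def by blast
    have "card {i. (i, j) \<in> ?D \<and> f (t (i, j)) < h} = card {i. (i, j) \<in> ?D \<and> i < h}"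
      by (rule eq) (use ij in force)
    also have "{i. (i, j) \<in> ?D \<and> i < h} = {..<h}" using col by auto
    finally have "{i. (i, j) \<in> ?D \<and> f (t (i, j)) < h} = {..<h}"
      using col by (intro card_subset_eq) auto
    then have "f (t (i, j)) < h" using ij col by blast
    then show ?thesis by (simp add: col)
  qed
  \<comment> \<open>The map \<open>u\<close> moves each cell within its column to the row given by the colour of its entry; its inverse sorts the columns.\<close>
  define u where "u = (\<lambda>c. (f (t c), snd c))"
  have "inj_on u ?D"
    using sep unfolding u_def inj_on_def separates_columns_def by (auto simp: prod_eq_iff)
  moreover have "u ` ?D \<subseteq> ?D" using val by (auto simp: u_def)
  ultimately have u: "bij_betw u ?D ?D" using endo_inj_surj[OF fin] by (simp add: bij_betw_def)
  define s where "s = inv_into ?D u"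
  have s: "bij_betw s ?D ?D" unfolding s_def by (rule bij_betw_inv_into[OF u])
  have sD: "s c \<in> ?D" and us: "u (s c) = c" if "c \<in> ?D" for c
    using s bij_betwE that bij_betw_inv_into_right[OF u that] by (auto simp: s_def)
  define t' where "t' = inv_into ?D t"
  have t': "bij_betw t' ?X ?D" unfolding t'_def by (rule bij_betw_inv_into[OF bt])
  have tt: "t' (t c) = c" if "c \<in> ?D" for c
    unfolding t'_def using bt that by (simp add: bij_betw_inv_into_left)
  define q where "q = (\<lambda>x. if x \<in> ?X then t (s (t' x)) else x)"
  have "bij_betw (t \<circ> (s \<circ> t')) ?X ?X"
    by (rule bij_betw_trans[OF bij_betw_trans[OF t' s] bt])
  then have "bij_betw q ?X ?X"
    by (rule bij_betw_cong[THEN iffD1, rotated]) (simp add: q_def)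
  then have qX: "q permutes ?X" by (rule bij_imp_permutes) (auto simp: q_def)
  have qt: "q (t c) = t (s c)" if "c \<in> ?D" for c
    using bt that tt[OF that] by (auto simp: q_def bij_betw_def)
  have "q ` column lam t j = column lam t j" for j
  proof (rule endo_inj_surj)
    show "finite (column lam t j)"
      by (rule finite_subset[of _ "t ` ?D"]) (auto simp: column_def fin)
    show "inj_on q (column lam t j)" using permutes_inj[OF qX] by (auto simp: inj_on_def)
    show "q ` column lam t j \<subseteq> column lam t j"
    proof
      fix y assume "y \<in> q ` column lam t j"
      then obtain i where i: "(i, j) \<in> ?D" "y = q (t (i, j))" by (auto simp: column_def)
      have "snd (s (i, j)) = j" using us[OF i(1)] by (simp add: u_def)
      then have "s (i, j) = (fst (s (i, j)), j)" by (simp add: prod_eq_iff)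
      then show "y \<in> column lam t j"
        using qt[OF i(1)] sD[OF i(1)] i(2) unfolding column_def by (metis (mono_tags, lifting) mem_Collect_eq)
    qed
  qed
  then have "q \<in> column_stabilizer lam t"
    using qX by (simp add: column_stabilizer_def sym_group_carrier)
  moreover have "f (q (t c)) = fst c" if "c \<in> ?D" for c
    using us[OF that] qt[OF that] by (simp add: u_def prod_eq_iff)
  ultimately show ?thesis by (rule that)
qed

lemma perm_action_compose:
  assumes "bij g" "bij h"
  shows "perm_action (g \<circ> h) v = perm_action g (perm_action h v)"
  by (simp only: perm_action_def o_inv_distrib[OF assms] image_comp)

section \<open>Column stabilizers and polytabloids\<close>

lemma column_stabilizer_permutes: "s \<in> column_stabilizer lam t \<Longrightarrow> s permutes {1..sum_list lam}"
  by (simp add: column_stabilizer_def sym_group_carrier)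

lemma finite_column_stabilizer: "finite (column_stabilizer lam t)"
  by (rule finite_subset[OF _ finite_permutations[of "{1..sum_list lam}"]])
    (auto dest: column_stabilizer_permutes)

lemma column_stabilizer_compose:
  "s \<in> column_stabilizer lam t \<Longrightarrow> q \<in> column_stabilizer lam t \<Longrightarrow> s \<circ> q \<in> column_stabilizer lam t"
  unfolding column_stabilizer_def sym_group_carrier mem_Collect_eq image_comp[symmetric]
  by (simp only: permutes_compose simp_thms)

lemma column_stabilizer_inv:
  assumes "s \<in> column_stabilizer lam t"
  shows "Hilbert_Choice.inv s \<in> column_stabilizer lam t"
proof -
  have s: "s permutes {1..sum_list lam}" by (rule column_stabilizer_permutes[OF assms])
  have "Hilbert_Choice.inv s ` column lam t j = column lam t j" for j
  proof -
    have "Hilbert_Choice.inv s ` column lam t j = Hilbert_Choice.inv s ` s ` column lam t j"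
      using assms by (simp add: column_stabilizer_def)
    also have "\<dots> = column lam t j" by (simp add: image_image permutes_inverses[OF s])
    finally show ?thesis .
  qed
  then show ?thesis using permutes_inv[OF s] by (simp add: column_stabilizer_def sym_group_carrier)
qed

lemma column_stabilizer_permutation: "s \<in> column_stabilizer lam t \<Longrightarrow> permutation s"
  using column_stabilizer_permutes permutation_permutes by blast

lemma sum_column_stabilizer_right:
  assumes q: "q \<in> column_stabilizer lam t"
  shows "(\<Sum>s \<in> column_stabilizer lam t. f (s \<circ> q)) = (\<Sum>s \<in> column_stabilizer lam t. f s)"
proof (rule sum.reindex_bij_witness[where j = "\<lambda>s. s \<circ> q" and i = "\<lambda>s. s \<circ> Hilbert_Choice.inv q"])
  note qp = column_stabilizer_permutes[OF q]
  show "s \<circ> q \<circ> Hilbert_Choice.inv q = s" for s by (simp add: comp_assoc permutes_inv_o[OF qp])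
  show "s \<circ> Hilbert_Choice.inv q \<circ> q = s" for s by (simp add: comp_assoc permutes_inv_o[OF qp])
qed (use q in \<open>auto intro: column_stabilizer_compose column_stabilizer_inv\<close>)

lemma sum_column_stabilizer_left:
  assumes q: "q \<in> column_stabilizer lam t"
  shows "(\<Sum>s \<in> column_stabilizer lam t. f (q \<circ> s)) = (\<Sum>s \<in> column_stabilizer lam t. f s)"
proof (rule sum.reindex_bij_witness[where j = "\<lambda>s. q \<circ> s" and i = "\<lambda>s. Hilbert_Choice.inv q \<circ> s"])
  note qp = column_stabilizer_permutes[OF q]
  show "Hilbert_Choice.inv q \<circ> (q \<circ> s) = s" for s
    by (simp add: comp_assoc[symmetric] permutes_inv_o[OF qp])
  show "q \<circ> (Hilbert_Choice.inv q \<circ> s) = s" for s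
    by (simp add: comp_assoc[symmetric] permutes_inv_o[OF qp])
qed (use q in \<open>auto intro: column_stabilizer_compose column_stabilizer_inv\<close>)

lemma sign_sign_cancel: "permutation q \<Longrightarrow> (of_int (sign q) :: 'k::field) * of_int (sign q) = 1"
  by (simp add: sign_def)

lemma perm_action_column_polytabloid:
  assumes q: "q \<in> column_stabilizer lam t"
  shows "perm_action q (polytabloid lam t) = fscale (of_int (sign q)) (polytabloid lam t :: _ \<Rightarrow> 'k::field)"
proof -
  interpret l: Vector_Spaces.linear fscale fscale "perm_action q" by (rule perm_action_linear)
  note qp = column_stabilizer_permutes[OF q]
  let ?C = "column_stabilizer lam t"
  let ?b = "\<lambda>s. basis_vector (tabloid lam (s \<circ> t)) :: _ \<Rightarrow> 'k"
  have "perm_action q (polytabloid lam t) = (\<Sum>s\<in>?C. fscale (of_int (sign s)) (?b (q \<circ> s)))"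
    by (simp add: polytabloid_def l.sum l.scale perm_action_basis_vector[OF permutes_bij[OF qp]]
        image_tabloid comp_assoc)
  also have "\<dots> = (\<Sum>s\<in>?C. fscale (of_int (sign q)) (fscale (of_int (sign (q \<circ> s))) (?b (q \<circ> s))))"
  proof (rule sum.cong[OF refl])
    fix s assume "s \<in> ?C"
    then have "sign (q \<circ> s) = sign q * sign s"
      using q by (intro sign_compose column_stabilizer_permutation)
    then show "fscale (of_int (sign s)) (?b (q \<circ> s)) =
        fscale (of_int (sign q)) (fscale (of_int (sign (q \<circ> s))) (?b (q \<circ> s)))"
      using sign_sign_cancel[OF column_stabilizer_permutation[OF q], where 'k = 'k]
      by (simp add: fscale_def mult.assoc[symmetric])
  qed
  also have "\<dots> = fscale (of_int (sign q)) (\<Sum>s\<in>?C. fscale (of_int (sign (q \<circ> s))) (?b (q \<circ> s)))"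
    by (simp add: fun_space.scale_sum_right)
  also have "\<dots> = fscale (of_int (sign q)) (polytabloid lam t)"
    unfolding polytabloid_def
    by (subst sum_column_stabilizer_left[OF q, of "\<lambda>s. fscale (of_int (sign s)) (?b s)"]) simp
  finally show ?thesis .
qed

lemma tableau_permute: "g permutes {1..sum_list lam} \<Longrightarrow> tableau lam t \<Longrightarrow> tableau lam (g \<circ> t)"
  using permutes_imp_bij by (auto simp: tableau_def intro: bij_betw_trans)

text \<open>
  A tabloid is the same thing as a colouring of the points by row numbers.
\<close>

lemma tabloid_eq_if_row_colouring:
  assumes "tableau lam t" "\<And>c. c \<in> young_diagram lam \<Longrightarrow> f (t c) = fst c"
  shows "tabloid lam t = (\<lambda>i. {x \<in> {1..sum_list lam}. f x = i})"
proof
  fix i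
  have X: "{1..sum_list lam} = t ` young_diagram lam" using assms(1) by (simp add: tableau_def bij_betw_def)
  show "tabloid lam t i = {x \<in> {1..sum_list lam}. f x = i}"
    unfolding X tabloid_def using assms(2) by auto
qed

lemma column_transposition:
  assumes t: "tableau lam t" and "(i, j) \<in> young_diagram lam" "(i', j) \<in> young_diagram lam"
  shows "transpose (t (i, j)) (t (i', j)) \<in> column_stabilizer lam t"
proof -
  have "t (i, j) \<in> {1..sum_list lam}" "t (i', j) \<in> {1..sum_list lam}"
    using t assms(2,3) bij_betwE unfolding tableau_def by blast+
  then have "transpose (t (i, j)) (t (i', j)) permutes {1..sum_list lam}" by (rule permutes_swap_id)
  moreover have "transpose (t (i, j)) (t (i', j)) ` column lam t k = column lam t k" for k
  proof (cases "k = j")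
    case True
    then have "t (i, j) \<in> column lam t k" "t (i', j) \<in> column lam t k"
      using assms(2,3) by (auto simp: column_def)
    then show ?thesis by (simp add: transpose_image_eq)
  next
    case False
    then have "t (i, j) \<notin> column lam t k" "t (i', j) \<notin> column lam t k"
      using assms t by (auto simp: column_def tableau_def bij_betw_def dest!: inj_onD)
    then show ?thesis by (simp add: transpose_image_eq)
  qed
  ultimately show ?thesis by (simp add: column_stabilizer_def sym_group_carrier)
qed

text \<open>
  A row and a column meet in at most one cell.
\<close>

lemma column_stabilizer_fixing_tabloid:
  assumes t: "tableau lam t" and s: "s \<in> column_stabilizer lam t" and eq: "tabloid lam (s \<circ> t) = tabloid lam t"
  shows "s = id"
proof
  fix x
  have sp: "s permutes {1..sum_list lam}" by (rule column_stabilizer_permutes[OF s])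
  show "s x = id x"
  proof (cases "x \<in> {1..sum_list lam}")
    case True
    then obtain i j where ij: "(i, j) \<in> young_diagram lam" "x = t (i, j)"
      using t unfolding tableau_def bij_betw_def by (metis imageE surj_pair)
    have "s x \<in> tabloid lam (s \<circ> t) i" using ij by (auto simp: tabloid_def)
    then obtain j' where j': "(i, j') \<in> young_diagram lam" "s x = t (i, j')"
      unfolding eq by (auto simp: tabloid_def)
    have "s x \<in> s ` column lam t j" using ij by (auto simp: column_def)
    then have "s x \<in> column lam t j" using s by (simp add: column_stabilizer_def)
    then obtain i' where i': "(i', j) \<in> young_diagram lam" "s x = t (i', j)" by (auto simp: column_def)
    have "(i, j') = (i', j)"
      using t j' i' unfolding tableau_def bij_betw_def by (metis inj_onD)
    then show ?thesis using ij j' by simp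
  next
    case False
    then show ?thesis using sp by (simp add: permutes_not_in)
  qed
qed

lemma polytabloid_cong:
  assumes "\<And>c. c \<in> young_diagram lam \<Longrightarrow> t c = t' c"
  shows "polytabloid lam t = polytabloid lam t'"
proof -
  have "column lam t = column lam t'" 
    unfolding column_def by (intro ext Collect_cong) (metis assms)
  moreover have "tabloid lam (s \<circ> t) = tabloid lam (s \<circ> t')" for s
    
    unfolding tabloid_def comp_def by (intro ext Collect_cong) (metis assms)
  ultimately show ?thesis by (simp add: polytabloid_def column_stabilizer_def)
qed

lemma ex_permuted_tableau:
  assumes "tableau lam t" "tableau lam t'"
  obtains g where "g permutes {1..sum_list lam}" "\<And>c. c \<in> young_diagram lam \<Longrightarrow> t' c = g (t c)"
proof -
  let ?D = "young_diagram lam" and ?X = "{1..sum_list lam}"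
  have t: "bij_betw t ?D ?X" "bij_betw t' ?D ?X" using assms by (auto simp: tableau_def)
  define g where "g = (\<lambda>x. if x \<in> ?X then t' (inv_into ?D t x) else x)"
  have "bij_betw (t' \<circ> inv_into ?D t) ?X ?X" by (rule bij_betw_trans[OF bij_betw_inv_into[OF t(1)] t(2)])
  then have "bij_betw g ?X ?X" by (rule bij_betw_cong[THEN iffD1, rotated]) (simp add: g_def)
  then have "g permutes ?X" by (rule bij_imp_permutes) (auto simp: g_def)
  moreover have "t' c = g (t c)" if "c \<in> ?D" for c
    using t(1) that bij_betwE[OF t(1)] by (auto simp: g_def bij_betw_inv_into_left)
  ultimately show ?thesis by (rule that)
qed

section \<open>Traces on finite-dimensional function spaces\<close>

lemma fun_linearI:
  assumes "\<And>u v. f (u + v) = f u + f v" "\<And>c v. f (fscale c v) = fscale c (f v)"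
  shows "Vector_Spaces.linear fscale fscale f"
  by unfold_locales (use assms in auto)

lemma functional_linearI:
  fixes \<phi> :: "('a \<Rightarrow> 'k::field) \<Rightarrow> 'k"
  assumes "\<And>u v. \<phi> (u + v) = \<phi> u + \<phi> v" "\<And>c v. \<phi> (fscale c v) = c * \<phi> v"
  shows "Vector_Spaces.linear fscale (*) \<phi>"
  by unfold_locales (use assms in \<open>auto simp: algebra_simps\<close>)

lemma sum_fun_eq: "(\<Sum>i\<in>I. f i) = (\<lambda>x. \<Sum>i\<in>I. f i x)"
  by (induction I rule: infinite_finite_induct) (auto simp: fun_eq_iff)

lemma sum_reverse3:
  "(\<Sum>a\<in>A. \<Sum>b\<in>B. \<Sum>c\<in>C. f a b c) = (\<Sum>c\<in>C. \<Sum>b\<in>B. \<Sum>a\<in>A. f a b c)"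
proof -
  have "(\<Sum>a\<in>A. \<Sum>b\<in>B. \<Sum>c\<in>C. f a b c) = (\<Sum>a\<in>A. \<Sum>c\<in>C. \<Sum>b\<in>B. f a b c)"
    by (intro sum.cong refl sum.swap)
  also have "\<dots> = (\<Sum>c\<in>C. \<Sum>a\<in>A. \<Sum>b\<in>B. f a b c)" by (rule sum.swap)
  also have "\<dots> = (\<Sum>c\<in>C. \<Sum>b\<in>B. \<Sum>a\<in>A. f a b c)" by (intro sum.cong refl sum.swap)
  finally show ?thesis .
qed

lemma span_finite_basis:
  fixes E :: "('a \<Rightarrow> 'k::field) set"
  assumes "finite E"
  obtains B where "fun_space.independent B" "finite B" "fun_space.span B = fun_space.span E"
proof -
  obtain B where B: "B \<subseteq> E" "fun_space.independent B" "E \<subseteq> fun_space.span B"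
    by (rule fun_space.maximal_independent_subset)
  moreover have "fun_space.span B = fun_space.span E"
    using B by (meson fun_space.span_mono fun_space.span_minimal fun_space.subspace_span subset_antisym)
  ultimately show ?thesis using assms finite_subset that by blast
qed

text \<open>
  The trace of a sum of rank-one operators \<open>v \<mapsto> \<phi> i v * w i\<close>, which allows traces on Specht modules to
  be computed without choosing a basis.
\<close>

lemma trace_on_finite_rank:
  fixes E :: "('a \<Rightarrow> 'k::field) set"
  assumes E: "finite E" "V = fun_space.span E"
    and f: "Vector_Spaces.linear fscale fscale f"
    and \<phi>: "\<And>i. i \<in> I \<Longrightarrow> Vector_Spaces.linear fscale (*) (\<phi> i)"
    and w: "\<And>i. i \<in> I \<Longrightarrow> w i \<in> V"
    and fv: "\<And>v. v \<in> V \<Longrightarrow> f v = (\<Sum>i\<in>I. fscale (\<phi> i v) (w i))"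
  shows "trace_on V f = (\<Sum>i\<in>I. \<phi> i (w i))"
proof -
  obtain B where B: "fun_space.independent B" "finite B" "fun_space.span B = V"
    using span_finite_basis[OF E(1)] E(2) by metis
  have BV: "b \<in> V" if "b \<in> B" for b using that B(3) fun_space.span_base by blast
  have fV: "f ` V \<subseteq> V"
  proof
    fix x assume "x \<in> f ` V"
    then obtain v where "v \<in> V" "x = (\<Sum>i\<in>I. fscale (\<phi> i v) (w i))" using fv by blast
    then show "x \<in> V" using w unfolding E(2) by (auto intro!: fun_space.span_sum fun_space.span_scale)
  qed
  have "trace_on V f = (\<Sum>b\<in>B. fun_space.representation B (f b) b)"
    by (rule trace_on_eq[OF B f fV])
  also have "\<dots> = (\<Sum>b\<in>B. \<Sum>i\<in>I. \<phi> i b * fun_space.representation B (w i) b)"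
  proof (rule sum.cong[OF refl])
    fix b assume b: "b \<in> B"
    have "fun_space.representation B (\<Sum>i\<in>I. fscale (\<phi> i b) (w i)) =
        (\<lambda>x. \<Sum>i\<in>I. fun_space.representation B (fscale (\<phi> i b) (w i)) x)"
      using B w by (intro fun_space.representation_sum) (auto intro!: fun_space.span_scale)
    also have "\<dots> = (\<lambda>x. \<Sum>i\<in>I. \<phi> i b * fun_space.representation B (w i) x)"
      using B w by (intro ext sum.cong refl) (simp add: fun_space.representation_scale)
    finally show "fun_space.representation B (f b) b = (\<Sum>i\<in>I. \<phi> i b * fun_space.representation B (w i) b)"
      using fv[OF BV[OF b]] by simp
  qed
  also have "\<dots> = (\<Sum>i\<in>I. \<Sum>b\<in>B. \<phi> i b * fun_space.representation B (w i) b)" by (rule sum.swap)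
  also have "\<dots> = (\<Sum>i\<in>I. \<phi> i (w i))"
  proof (rule sum.cong[OF refl])
    fix i assume i: "i \<in> I"
    interpret l: Vector_Spaces.linear fscale "(*)" "\<phi> i" by (rule \<phi>[OF i])
    have "\<phi> i (\<Sum>b\<in>B. fscale (fun_space.representation B (w i) b) b) =
        (\<Sum>b\<in>B. \<phi> i b * fun_space.representation B (w i) b)"
      by (simp add: l.sum l.scale mult.commute)
    moreover have "(\<Sum>b\<in>B. fscale (fun_space.representation B (w i) b) b) = w i"
      by (rule fun_space.sum_representation_eq) (use B w[OF i] in auto)
    ultimately show "(\<Sum>b\<in>B. \<phi> i b * fun_space.representation B (w i) b) = \<phi> i (w i)" by simp
  qed
  finally show ?thesis .
qed

lemma trace_on_sum:
  fixes E :: "('a \<Rightarrow> 'k::field) set"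
  assumes E: "finite E" "V = fun_space.span E"
    and f: "\<And>i. i \<in> I \<Longrightarrow> Vector_Spaces.linear fscale fscale (f i)" "\<And>i. i \<in> I \<Longrightarrow> f i ` V \<subseteq> V"
    and F: "Vector_Spaces.linear fscale fscale F" "\<And>v. v \<in> V \<Longrightarrow> F v = (\<Sum>i\<in>I. f i v)"
  shows "trace_on V F = (\<Sum>i\<in>I. trace_on V (f i))"
proof -
  obtain B where B: "fun_space.independent B" "finite B" "fun_space.span B = V"
    using span_finite_basis[OF E(1)] E(2) by metis
  have BV: "b \<in> V" if "b \<in> B" for b using that B(3) fun_space.span_base by blast
  have fiV: "f i v \<in> V" if "i \<in> I" "v \<in> V" for i v using f(2) that by blast
  have FV: "F ` V \<subseteq> V"
  proof
    fix x assume "x \<in> F ` V"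
    then obtain v where v: "v \<in> V" "x = (\<Sum>i\<in>I. f i v)" using F(2) by blast
    then show "x \<in> V" using fiV unfolding E(2) by (auto intro!: fun_space.span_sum)
  qed
  have "trace_on V F = (\<Sum>b\<in>B. fun_space.representation B (F b) b)"
    by (rule trace_on_eq[OF B F(1) FV])
  also have "\<dots> = (\<Sum>b\<in>B. \<Sum>i\<in>I. fun_space.representation B (f i b) b)"
  proof (rule sum.cong[OF refl])
    fix b assume b: "b \<in> B"
    have "fun_space.representation B (\<Sum>i\<in>I. f i b) = (\<lambda>x. \<Sum>i\<in>I. fun_space.representation B (f i b) x)"
      using B fiV BV[OF b] by (intro fun_space.representation_sum) auto
    then show "fun_space.representation B (F b) b = (\<Sum>i\<in>I. fun_space.representation B (f i b) b)"
      using F(2)[OF BV[OF b]] by simp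
  qed
  also have "\<dots> = (\<Sum>i\<in>I. trace_on V (f i))"
    by (subst sum.swap) (intro sum.cong refl trace_on_eq[OF B f, symmetric])
  finally show ?thesis .
qed

text \<open>
  The number \<open>d\<close> is the dimension of \<open>V\<close>.
\<close>

lemma trace_on_scalars:
  fixes E :: "('a \<Rightarrow> 'k::field) set"
  assumes E: "finite E" "V = fun_space.span E"
  shows "\<exists>d :: nat. \<forall>f c. Vector_Spaces.linear fscale fscale f \<longrightarrow>
     (\<forall>v\<in>V. f v = fscale c v) \<longrightarrow> trace_on V f = c * of_nat d"
proof -
  obtain B where B: "fun_space.independent B" "finite B" "fun_space.span B = V"
    using span_finite_basis[OF E(1)] E(2) by metis
  have BV: "b \<in> V" if "b \<in> B" for b using that B(3) fun_space.span_base by blast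
  have "trace_on V f = c * of_nat (card B)"
    if f: "Vector_Spaces.linear fscale fscale f" "\<forall>v\<in>V. f v = fscale c v" for f c
  proof -
    have "f ` V \<subseteq> V" using f(2) unfolding E(2) by (auto intro!: fun_space.span_scale)
    then have "trace_on V f = (\<Sum>b\<in>B. fun_space.representation B (f b) b)"
      by (rule trace_on_eq[OF B f(1)])
    also have "\<dots> = (\<Sum>b\<in>B. c)"
      using B BV f(2)
      by (intro sum.cong refl) (simp add: fun_space.representation_scale fun_space.representation_basis)
    finally show ?thesis by (simp add: mult.commute)
  qed
  then show ?thesis by blast
qed

section \<open>Specht modules are irreducible\<close>

definition tabloids :: "nat list \<Rightarrow> (nat \<Rightarrow> nat set) set" where
  "tabloids lam = {tabloid lam t |t. tableau lam t}"

text \<open>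
  The invariant bilinear form for which the tabloids are orthonormal.
\<close>

definition tabloid_form :: "nat list \<Rightarrow> ((nat \<Rightarrow> nat set) \<Rightarrow> 'k::field) \<Rightarrow> ((nat \<Rightarrow> nat set) \<Rightarrow> 'k) \<Rightarrow> 'k" where
  "tabloid_form lam u v = (\<Sum>T\<in>tabloids lam. u T * v T)"

lemma tabloid_cong:
  assumes "\<And>c. c \<in> young_diagram lam \<Longrightarrow> t c = t' c"
  shows "tabloid lam t = tabloid lam t'"
  unfolding tabloid_def by (intro ext Collect_cong) (metis assms)

lemma tabloid_form_add_left: "tabloid_form lam (u + v) w = tabloid_form lam u w + tabloid_form lam v w"
  by (simp add: tabloid_form_def sum.distrib algebra_simps)

lemma tabloid_form_scale_left: "tabloid_form lam (fscale c u) w = c * tabloid_form lam u w"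
  by (simp add: tabloid_form_def sum_distrib_left fscale_def mult.assoc)

lemma tabloid_form_commute: "tabloid_form lam u v = tabloid_form lam v u"
  by (simp add: tabloid_form_def mult.commute)

lemma tabloid_form_sum_left:
  "tabloid_form lam (\<Sum>i\<in>I. fscale (c i) (u i)) w = (\<Sum>i\<in>I. c i * tabloid_form lam (u i) w)"
proof -
  interpret l: Vector_Spaces.linear fscale "(*)" "\<lambda>u. tabloid_form lam u w"
    by (rule functional_linearI) (simp_all add: tabloid_form_add_left tabloid_form_scale_left)
  show ?thesis by (simp add: l.sum l.scale)
qed

text \<open>
  A base tableau \<open>t0\<close> makes the Specht module the span of one orbit of the finite group \<open>perms\<close>,
  instead of a span indexed by the infinitely many tableaux, which may differ outside of the diagram.
\<close>

locale specht_base =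
  fixes lam :: "nat list" and t0 :: "nat \<times> nat \<Rightarrow> nat"
  assumes lam: "sorted_wrt (\<ge>) lam" and t0: "tableau lam t0"
begin

abbreviation points :: "nat set" where "points \<equiv> {1..sum_list lam}"

definition perms :: "(nat \<Rightarrow> nat) set" where "perms = {g. g permutes {1..sum_list lam}}"

abbreviation e0 :: "(nat \<Rightarrow> nat set) \<Rightarrow> 'k::field" where "e0 \<equiv> polytabloid lam t0"

lemma finite_perms: "finite perms"
  unfolding perms_def by (rule finite_permutations) simp

lemma card_perms: "card perms = fact (sum_list lam)"
  unfolding perms_def by (rule card_permutations) auto

lemma perms_permutes: "g \<in> perms \<Longrightarrow> g permutes points" by (simp add: perms_def)

lemma perms_bij: "g \<in> perms \<Longrightarrow> bij g" using permutes_bij perms_permutes by blast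

lemma perms_compose: "g \<in> perms \<Longrightarrow> h \<in> perms \<Longrightarrow> g \<circ> h \<in> perms"
  by (simp add: perms_def permutes_compose)

lemma perms_inv: "g \<in> perms \<Longrightarrow> Hilbert_Choice.inv g \<in> perms"
  by (simp add: perms_def permutes_inv)

lemma act_compose: "g \<in> perms \<Longrightarrow> h \<in> perms \<Longrightarrow> perm_action (g \<circ> h) v = perm_action g (perm_action h v)"
  by (intro perm_action_compose perms_bij)

lemma perms_inv_o: "g \<in> perms \<Longrightarrow> g \<circ> Hilbert_Choice.inv g = id" "g \<in> perms \<Longrightarrow> Hilbert_Choice.inv g \<circ> g = id"
  using permutes_inv_o perms_permutes by blast+

lemma sum_perms_left:
  assumes "h \<in> perms"
  shows "(\<Sum>g\<in>perms. f (h \<circ> g)) = (\<Sum>g\<in>perms. f g)"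
proof (rule sum.reindex_bij_witness[where j = "\<lambda>g. h \<circ> g" and i = "\<lambda>g. Hilbert_Choice.inv h \<circ> g"])
  show "Hilbert_Choice.inv h \<circ> (h \<circ> g) = g" "h \<circ> (Hilbert_Choice.inv h \<circ> g) = g" for g
    by (simp_all add: comp_assoc[symmetric] perms_inv_o[OF assms])
qed (use assms in \<open>auto intro: perms_compose perms_inv\<close>)

lemma tabloids_eq: "tabloids lam = (\<lambda>g. tabloid lam (g \<circ> t0)) ` perms"
proof
  show "tabloids lam \<subseteq> (\<lambda>g. tabloid lam (g \<circ> t0)) ` perms"
  proof
    fix T assume "T \<in> tabloids lam"
    then obtain t where t: "tableau lam t" "T = tabloid lam t" by (auto simp: tabloids_def)
    obtain g where g: "g permutes points" "\<And>c. c \<in> young_diagram lam \<Longrightarrow> t c = g (t0 c)"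
      using ex_permuted_tableau[OF t0 t(1)] by blast
    have "T = tabloid lam (g \<circ> t0)" unfolding t(2) by (rule tabloid_cong) (simp add: g(2))
    then show "T \<in> (\<lambda>g. tabloid lam (g \<circ> t0)) ` perms" using g(1) by (auto simp: perms_def)
  qed
  show "(\<lambda>g. tabloid lam (g \<circ> t0)) ` perms \<subseteq> tabloids lam"
    using tableau_permute[OF _ t0] by (auto simp: tabloids_def perms_def)
qed

lemma finite_tabloids: "finite (tabloids lam)"
  by (simp add: tabloids_eq finite_perms)

lemma specht_eq_span:
  "(specht_module lam :: (_ \<Rightarrow> 'k::field) set) = fun_space.span ((\<lambda>g. perm_action g e0) ` perms)"
proof -
  have "{polytabloid lam t |t. tableau lam t} = (\<lambda>g. perm_action g (e0 :: _ \<Rightarrow> 'k)) ` perms"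
  proof
    show "{polytabloid lam t |t. tableau lam t} \<subseteq> (\<lambda>g. perm_action g (e0 :: _ \<Rightarrow> 'k)) ` perms"
    proof
      fix v :: "_ \<Rightarrow> 'k" assume "v \<in> {polytabloid lam t |t. tableau lam t}"
      then obtain t where t: "tableau lam t" "v = polytabloid lam t" by blast
      obtain g where g: "g permutes points" "\<And>c. c \<in> young_diagram lam \<Longrightarrow> t c = g (t0 c)"
        using ex_permuted_tableau[OF t0 t(1)] by blast
      have "v = polytabloid lam (g \<circ> t0)" unfolding t(2) by (rule polytabloid_cong) (simp add: g(2))
      then have "v = perm_action g e0" by (simp add: perm_action_polytabloid[OF g(1)])
      then show "v \<in> (\<lambda>g. perm_action g e0) ` perms" using g(1) by (auto simp: perms_def)
    qed
    show "(\<lambda>g. perm_action g (e0 :: _ \<Rightarrow> 'k)) ` perms \<subseteq> {polytabloid lam t |t. tableau lam t}"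
    proof
      fix v :: "_ \<Rightarrow> 'k" assume "v \<in> (\<lambda>g. perm_action g e0) ` perms"
      then obtain g where "g permutes points" "v = perm_action g e0" by (auto simp: perms_def)
      then show "v \<in> {polytabloid lam t |t. tableau lam t}"
        using tableau_permute[OF _ t0] perm_action_polytabloid by blast
    qed
  qed
  then show ?thesis by (simp add: specht_module_def)
qed

lemma finite_generators: "finite ((\<lambda>g. perm_action g e0) ` perms)"
  by (simp add: finite_perms)

lemma act_e0_mem: "g \<in> perms \<Longrightarrow> perm_action g e0 \<in> specht_module lam"
  unfolding specht_eq_span by (rule fun_space.span_base) auto

lemma act_mem: "g \<in> perms \<Longrightarrow> v \<in> specht_module lam \<Longrightarrow> perm_action g v \<in> specht_module lam"
  using perm_action_specht_module[of g lam] by (auto simp: perms_def sym_group_carrier)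

lemma e0_mem: "e0 \<in> specht_module lam"
  unfolding specht_module_def by (rule fun_space.span_base) (use t0 in auto)

lemma tabloid_form_act:
  assumes g: "g \<in> perms"
  shows "tabloid_form lam (perm_action g u) (perm_action g v) = tabloid_form lam u v"
proof -
  let ?i = "Hilbert_Choice.inv g"
  have gp: "g permutes points" by (rule perms_permutes[OF g])
  have mem: "(\<lambda>i. h ` T i) \<in> tabloids lam" if "h permutes points" "T \<in> tabloids lam" for h T
    using that tableau_permute by (auto simp: tabloids_def image_tabloid)
  show ?thesis unfolding tabloid_form_def perm_action_def
    by (rule sum.reindex_bij_witness[where j = "\<lambda>T i. ?i ` T i" and i = "\<lambda>T i. g ` T i"])
      (auto simp: image_image permutes_inverses[OF gp] intro: mem gp permutes_inv[OF gp])
qed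

text \<open>
  The column antisymmetrizer of \<open>t0\<close>.
\<close>

definition kappa :: "((nat \<Rightarrow> nat set) \<Rightarrow> 'k::field) \<Rightarrow> (nat \<Rightarrow> nat set) \<Rightarrow> 'k" where
  "kappa v = (\<Sum>s\<in>column_stabilizer lam t0. fscale (of_int (sign s)) (perm_action s v))"

lemma kappa_linear:
  "Vector_Spaces.linear fscale fscale (kappa :: (_ \<Rightarrow> 'k::field) \<Rightarrow> _)"
proof (rule fun_linearI)
  fix u v :: "(nat \<Rightarrow> nat set) \<Rightarrow> 'k" and c :: 'k
  show "kappa (u + v) = kappa u + kappa v"
    by (auto simp: kappa_def perm_action_def fscale_def fun_eq_iff algebra_simps sum.distrib sum_fun_eq)
  show "kappa (fscale c v) = fscale c (kappa v)"
    by (simp add: kappa_def perm_action_def fscale_def fun_eq_iff sum_fun_eq sum_distrib_left mult.left_commute)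
qed

lemma kappa_act:
  assumes q: "q \<in> column_stabilizer lam t0"
  shows "kappa (perm_action q v) = fscale (of_int (sign q)) (kappa v :: _ \<Rightarrow> 'k::field)"
proof -
  have qp: "q \<in> perms" using column_stabilizer_permutes[OF q] by (simp add: perms_def)
  let ?C = "column_stabilizer lam t0"
  have "kappa (perm_action q v) =
     (\<Sum>s\<in>?C. fscale (of_int (sign q)) (fscale (of_int (sign (s \<circ> q))) (perm_action (s \<circ> q) v)))"
    unfolding kappa_def
  proof (rule sum.cong[OF refl])
    fix s assume s: "s \<in> ?C"
    then have "s \<in> perms" using column_stabilizer_permutes by (simp add: perms_def)
    moreover have "sign (s \<circ> q) = sign q * sign s"
      using q s by (subst sign_compose) (auto dest: column_stabilizer_permutation)
    ultimately show "fscale (of_int (sign s)) (perm_action s (perm_action q v)) =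
        fscale (of_int (sign q)) (fscale (of_int (sign (s \<circ> q))) (perm_action (s \<circ> q) v))"
      using qp sign_sign_cancel[OF column_stabilizer_permutation[OF q], where 'k = 'k]
      by (simp add: act_compose fscale_def mult.assoc[symmetric])
  qed
  also have "\<dots> = fscale (of_int (sign q)) (\<Sum>s\<in>?C. fscale (of_int (sign (s \<circ> q))) (perm_action (s \<circ> q) v))"
    by (simp only: fun_space.scale_sum_right)
  also have "\<dots> = fscale (of_int (sign q)) (kappa v)"
    unfolding kappa_def
    by (rule arg_cong[OF sum_column_stabilizer_right[OF q, of "\<lambda>s. fscale (of_int (sign s)) (perm_action s v)"]])
  finally show ?thesis .
qed

lemma eq_neg_self_imp_0:
  fixes v :: "'a \<Rightarrow> 'k::field_char_0"
  assumes "v = fscale (- 1) v"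
  shows "v = 0"
proof
  fix x
  have "v x = - v x" using fun_cong[OF assms, of x] by (simp add: fscale_def)
  then show "v x = 0 x" by (simp add: eq_neg_iff_add_eq_0)
qed

text \<open>
  Regard the tabloid as a colouring by row numbers. If two points in a column of \<open>t0\<close> share a row,
  their transposition fixes the tabloid and negates its image; otherwise the tabloid is that of
  \<open>q \<circ> t0\<close> for some \<open>q\<close> in the column stabilizer.
\<close>

lemma kappa_tabloid:
  assumes t: "tableau lam t"
  shows "\<exists>c. kappa (basis_vector (tabloid lam t)) = fscale c (e0 :: _ \<Rightarrow> 'k::field_char_0)"
proof -
  let ?D = "young_diagram lam"
  let ?b = "\<lambda>t. basis_vector (tabloid lam t) :: _ \<Rightarrow> 'k"
  define f where "f = (\<lambda>x. if x \<in> points then fst (inv_into ?D t x) else length lam)"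
  have bt: "bij_betw t ?D points" using t by (simp add: tableau_def)
  have ft: "f (t c) = fst c" if "c \<in> ?D" for c
    using bt that bij_betwE[OF bt] by (auto simp: f_def bij_betw_inv_into_left)
  show ?thesis
  proof (cases "separates_columns lam t0 f")
    case False
    then obtain i i' j where ij: "(i, j) \<in> ?D" "(i', j) \<in> ?D" "f (t0 (i, j)) = f (t0 (i', j))" "i \<noteq> i'"
      by (auto simp: separates_columns_def)
    let ?q = "transpose (t0 (i, j)) (t0 (i', j))"
    have ne: "t0 (i, j) \<noteq> t0 (i', j)"
      using ij t0 by (auto simp: tableau_def bij_betw_def dest!: inj_onD)
    have q: "?q \<in> column_stabilizer lam t0" by (rule column_transposition[OF t0 ij(1,2)])
    have qp: "?q permutes points" by (rule column_stabilizer_permutes[OF q])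
    have "f (?q x) = f x" for x using ij(3) by (auto simp: transpose_def)
    then have "tabloid lam (?q \<circ> t) = tabloid lam t"
      using tabloid_eq_if_row_colouring[OF t, of f] ft
        tabloid_eq_if_row_colouring[OF tableau_permute[OF qp t], of f] by simp
    then have "perm_action ?q (?b t) = ?b t"
      by (simp add: perm_action_basis_vector[OF permutes_bij[OF qp]] image_tabloid)
    then have "kappa (?b t) = fscale (of_int (sign ?q)) (kappa (?b t))"
      using kappa_act[OF q, of "?b t"] by simp
    then have "kappa (?b t) = fscale (- 1) (kappa (?b t))" using ne by (simp add: sign_swap_id)
    then have "kappa (?b t) = 0" by (rule eq_neg_self_imp_0)
    then show ?thesis by (intro exI[of _ 0]) simp
  next
    case True
    have "fibre_card points f i = row_length lam i" for i
    proof -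
      have "fibre_card points f i = card {c \<in> ?D. f (t c) = i}"
        unfolding fibre_card_def by (rule card_bij_pred[OF bt])
      also have "{c \<in> ?D. f (t c) = i} = {i} \<times> {..<row_length lam i}"
        using ft by (auto simp: mem_young_diagram)
      finally show ?thesis by (simp add: card_cartesian_product)
    qed
    then obtain q where q: "q \<in> column_stabilizer lam t0" "\<And>c. c \<in> ?D \<Longrightarrow> f (q (t0 c)) = fst c"
      using separates_columns_imp_column_perm[OF lam t0 True] by blast
    have qp: "q permutes points" by (rule column_stabilizer_permutes[OF q(1)])
    have "tabloid lam (q \<circ> t0) = tabloid lam t"
      using tabloid_eq_if_row_colouring[OF t, of f] ft q(2)
        tabloid_eq_if_row_colouring[OF tableau_permute[OF qp t0], of f] by simp
    then have "?b t = perm_action q (?b t0)"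
      by (simp add: perm_action_basis_vector[OF permutes_bij[OF qp]] image_tabloid)
    moreover have "kappa (?b t0) = e0"
      unfolding kappa_def polytabloid_def
      by (intro sum.cong refl arg_cong[of _ _ "fscale _"])
        (simp add: perm_action_basis_vector[OF permutes_bij[OF column_stabilizer_permutes]] image_tabloid)
    ultimately show ?thesis using kappa_act[OF q(1), of "?b t0"] by auto
  qed
qed

lemma kappa_specht:
  assumes "v \<in> specht_module lam"
  shows "\<exists>c. kappa v = fscale c (e0 :: _ \<Rightarrow> 'k::field_char_0)"
proof -
  interpret l: Vector_Spaces.linear fscale fscale "kappa :: ((nat \<Rightarrow> nat set) \<Rightarrow> 'k) \<Rightarrow> _" by (rule kappa_linear)
  let ?b = "\<lambda>t. basis_vector (tabloid lam t) :: _ \<Rightarrow> 'k"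
  let ?U = "{v. \<exists>c. kappa v = fscale c (e0 :: _ \<Rightarrow> 'k)}"
  have U: "fun_space.subspace ?U"
    unfolding fun_space.subspace_def
  proof (intro conjI ballI allI)
    show "0 \<in> ?U" by (auto simp: l.zero intro!: exI[of _ 0])
    show "x + y \<in> ?U" if "x \<in> ?U" "y \<in> ?U" for x y
      using that by (auto simp: l.add fun_space.scale_left_distrib[symmetric])
    show "fscale c x \<in> ?U" if "x \<in> ?U" for c x
      using that by (auto simp: l.scale)
  qed
  have "polytabloid lam t \<in> ?U" if t: "tableau lam t" for t
    unfolding polytabloid_def[of lam t]
  proof (rule fun_space.subspace_sum[OF U], rule fun_space.subspace_scale[OF U])
    fix s assume "s \<in> column_stabilizer lam t"
    then have "tableau lam (s \<circ> t)" using t column_stabilizer_permutes by (blast intro: tableau_permute)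
    then show "?b (s \<circ> t) \<in> ?U" using kappa_tabloid by blast
  qed
  then have "specht_module lam \<subseteq> ?U"
    unfolding specht_module_def by (intro fun_space.span_minimal U) auto
  then show ?thesis using assms by blast
qed

text \<open>
  The antisymmetrizer \<open>kappa\<close> maps the Specht module to the line through \<open>e0\<close> and acts on \<open>e0\<close> as a
  nonzero scalar. So a commuting operator maps \<open>e0\<close> into this line, and \<open>e0\<close> generates the module.
\<close>

lemma schur:
  fixes f :: "((nat \<Rightarrow> nat set) \<Rightarrow> 'k::field_char_0) \<Rightarrow> _"
  assumes f: "Vector_Spaces.linear fscale fscale f"
    and comm: "\<And>g v. g \<in> perms \<Longrightarrow> f (perm_action g v) = perm_action g (f v)"
    and closed: "\<And>v. v \<in> specht_module lam \<Longrightarrow> f v \<in> specht_module lam"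
  obtains c where "\<And>v. v \<in> specht_module lam \<Longrightarrow> f v = fscale c v"
proof -
  interpret f: Vector_Spaces.linear fscale fscale f by (rule f)
  let ?C = "column_stabilizer lam t0"
  let ?n = "of_nat (card ?C) :: 'k"
  have "id \<in> ?C" by (simp add: column_stabilizer_def sym_group_carrier permutes_id)
  then have n0: "?n \<noteq> 0" using finite_column_stabilizer by auto
  have "kappa e0 = (\<Sum>s\<in>?C. (e0 :: _ \<Rightarrow> 'k))"
    unfolding kappa_def
  proof (rule sum.cong[OF refl])
    fix s assume s: "s \<in> ?C"
    then show "fscale (of_int (sign s)) (perm_action s e0) = (e0 :: _ \<Rightarrow> 'k)"
      using sign_sign_cancel[OF column_stabilizer_permutation[OF s], where 'k = 'k]
      by (simp add: perm_action_column_polytabloid)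
  qed
  then have ke: "kappa e0 = fscale ?n (e0 :: _ \<Rightarrow> 'k)"
    by (simp add: fun_eq_iff fscale_def sum_fun_eq)
  have "f (kappa v) = kappa (f v)" for v
    unfolding kappa_def f.sum f.scale
    by (intro sum.cong refl arg_cong[of _ _ "fscale _"] comm)
      (simp only: perms_def mem_Collect_eq column_stabilizer_permutes)
  moreover obtain c where c: "kappa (f e0) = fscale c e0" using kappa_specht[OF closed[OF e0_mem]] by blast
  ultimately have "fscale ?n (f e0) = fscale c e0" using ke by (metis f.scale)
  then have "fscale (1 / ?n) (fscale ?n (f e0)) = fscale (1 / ?n) (fscale c e0)" by simp
  then have fe: "f e0 = fscale (c / ?n) e0" using n0 by simp
  let ?U = "{v. f v = fscale (c / ?n) v}"
  have U: "fun_space.subspace ?U"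
    unfolding fun_space.subspace_def
    by (auto simp: f.zero f.add f.scale fun_space.scale_right_distrib mult.commute)
  have "perm_action g e0 \<in> ?U" if g: "g \<in> perms" for g
  proof -
    interpret g: Vector_Spaces.linear fscale fscale "perm_action g" by (rule perm_action_linear)
    show ?thesis by (simp add: comm[OF g] fe g.scale)
  qed
  then have "specht_module lam \<subseteq> ?U"
    unfolding specht_eq_span by (intro fun_space.span_minimal U) auto
  then show ?thesis using that by blast
qed

section \<open>Rationality and norm of Specht characters\<close>

lemma polytabloid_at_own_tabloid:
  assumes t: "tableau lam t"
  shows "(polytabloid lam t :: _ \<Rightarrow> 'k::field) (tabloid lam t) = 1"
proof -
  let ?C = "column_stabilizer lam t"
  have "polytabloid lam t (tabloid lam t) =
      (\<Sum>s\<in>?C. of_int (sign s) * (of_bool (tabloid lam t = tabloid lam (s \<circ> t)) :: 'k))"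
    by (simp add: polytabloid_def sum_fun_eq fscale_def basis_vector_def)
  also have "\<dots> = (\<Sum>s\<in>{id :: nat \<Rightarrow> nat}. 1)"
  proof (rule sum.mono_neutral_cong_right[OF finite_column_stabilizer])
    show "{id} \<subseteq> ?C" by (simp add: column_stabilizer_def sym_group_carrier permutes_id)
    show "\<forall>s\<in>?C - {id}. of_int (sign s) * (of_bool (tabloid lam t = tabloid lam (s \<circ> t)) :: 'k) = 0"
    proof
      fix s assume s: "s \<in> ?C - {id}"
      then have "tabloid lam t \<noteq> tabloid lam (s \<circ> t)" using column_stabilizer_fixing_tabloid[OF t, of s] by auto
      then show "of_int (sign s) * (of_bool (tabloid lam t = tabloid lam (s \<circ> t)) :: 'k) = 0" by simp
    qed
  qed (simp add: sign_id)
  finally show ?thesis by simp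
qed

text \<open>
  Integrality gives rational characters over every field of characteristic 0, and it makes the
  bilinear form of \<open>e0\<close> with itself a positive integer although the field need not be ordered.
\<close>

lemma polytabloid_int: "\<exists>z. (polytabloid lam t :: _ \<Rightarrow> 'k::field_char_0) = (\<lambda>T. of_int (z T))"
proof
  show "(polytabloid lam t :: _ \<Rightarrow> 'k) = (\<lambda>T. of_int
      (\<Sum>s\<in>column_stabilizer lam t. sign s * of_bool (T = tabloid lam (s \<circ> t))))"
    by (simp add: polytabloid_def sum_fun_eq fscale_def basis_vector_def fun_eq_iff)
qed

lemma tabloid_form_Rats:
  "tabloid_form lam (polytabloid lam t) (polytabloid lam t') \<in> (\<rat> :: 'k::field_char_0 set)"
proof -
  obtain z z' where "(polytabloid lam t :: _ \<Rightarrow> 'k) = (\<lambda>T. of_int (z T))"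
    "(polytabloid lam t' :: _ \<Rightarrow> 'k) = (\<lambda>T. of_int (z' T))"
    using polytabloid_int by meson
  then have "tabloid_form lam (polytabloid lam t) (polytabloid lam t') =
      (of_int (\<Sum>T\<in>tabloids lam. z T * z' T) :: 'k)"
    by (simp add: tabloid_form_def)
  then show ?thesis by (metis Rats_of_int)
qed

lemma tabloid_form_e0: "tabloid_form lam e0 e0 \<noteq> (0 :: 'k::field_char_0)"
proof -
  obtain z where z: "(e0 :: _ \<Rightarrow> 'k) = (\<lambda>T. of_int (z T))" using polytabloid_int by meson
  have "tabloid lam t0 \<in> tabloids lam" using t0 by (auto simp: tabloids_def)
  moreover have "of_int (z (tabloid lam t0)) = (1 :: 'k)"
    using polytabloid_at_own_tabloid[OF t0, where 'k = 'k] by (simp add: z)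
  then have "z (tabloid lam t0) \<noteq> 0" by auto
  ultimately have "0 < (\<Sum>T\<in>tabloids lam. z T * z T)"
    using finite_tabloids by (intro sum_pos2[of _ "tabloid lam t0"]) (auto simp: zero_less_mult_iff)
  then have "(of_int (\<Sum>T\<in>tabloids lam. z T * z T) :: 'k) \<noteq> 0" by (simp only: of_int_eq_0_iff)
  then show ?thesis by (simp add: tabloid_form_def z)
qed

lemma sum_in_Rats:
  fixes f :: "'b \<Rightarrow> 'k::field_char_0"
  shows "(\<And>x. x \<in> A \<Longrightarrow> f x \<in> \<rat>) \<Longrightarrow> sum f A \<in> \<rat>"
  by (induction A rule: infinite_finite_induct) auto

lemma act_e0: "g \<in> perms \<Longrightarrow> perm_action g e0 = polytabloid lam (g \<circ> t0)"
  by (rule perm_action_polytabloid) (simp add: perms_def)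

text \<open>
  The average over the group (up to the factor \<open>fact n\<close>) of the rank-one operator
  \<open>x \<mapsto> tabloid_form x u * w\<close>.
\<close>

definition average :: "((nat \<Rightarrow> nat set) \<Rightarrow> 'k::field) \<Rightarrow> ((nat \<Rightarrow> nat set) \<Rightarrow> 'k) \<Rightarrow>
    ((nat \<Rightarrow> nat set) \<Rightarrow> 'k) \<Rightarrow> (nat \<Rightarrow> nat set) \<Rightarrow> 'k" where
  "average u w x = (\<Sum>g\<in>perms. fscale (tabloid_form lam x (perm_action g u)) (perm_action g w))"

lemma average_linear: "Vector_Spaces.linear fscale fscale (average u w)"
proof (rule fun_linearI)
  show "average u w (x + y) = average u w x + average u w y" for x y
    by (simp add: average_def tabloid_form_add_left fun_space.scale_left_distrib sum.distrib)
  show "average u w (fscale c x) = fscale c (average u w x)" for c x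
    by (simp add: average_def tabloid_form_scale_left fun_space.scale_sum_right)
qed

lemma average_commute:
  assumes h: "h \<in> perms"
  shows "average u w (perm_action h x) = perm_action h (average u w x)"
proof -
  interpret l: Vector_Spaces.linear fscale fscale "perm_action h" by (rule perm_action_linear)
  have "average u w (perm_action h x) =
      (\<Sum>g\<in>perms. fscale (tabloid_form lam (perm_action h x) (perm_action (h \<circ> g) u)) (perm_action (h \<circ> g) w))"
    unfolding average_def by (rule sum_perms_left[OF h, symmetric])
  also have "\<dots> = (\<Sum>g\<in>perms. fscale (tabloid_form lam x (perm_action g u)) (perm_action h (perm_action g w)))"
    by (intro sum.cong refl) (simp add: act_compose[OF h] tabloid_form_act[OF h])
  finally show ?thesis by (simp add: average_def l.sum l.scale)
qed

lemma average_mem: "w \<in> specht_module lam \<Longrightarrow> average u w x \<in> specht_module lam"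
  unfolding average_def using act_mem[of _ w] unfolding specht_eq_span
  by (auto intro!: fun_space.span_sum fun_space.span_scale)

lemma average_trace:
  fixes u w :: "_ \<Rightarrow> 'k::field_char_0"
  assumes "w \<in> specht_module lam"
  shows "trace_on (specht_module lam) (average u w) = fact (sum_list lam) * tabloid_form lam w u"
proof -
  have "trace_on (specht_module lam) (average u w) =
      (\<Sum>g\<in>perms. tabloid_form lam (perm_action g w) (perm_action g u))"
  proof (rule trace_on_finite_rank[OF finite_generators specht_eq_span average_linear,
        where \<phi> = "\<lambda>g v. tabloid_form lam v (perm_action g u)" and w = "\<lambda>g. perm_action g w"])
    fix g :: "nat \<Rightarrow> nat"
    show "Vector_Spaces.linear fscale (*) (\<lambda>v. tabloid_form lam v (perm_action g u))"
      by (rule functional_linearI) (simp_all add: tabloid_form_add_left tabloid_form_scale_left)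
    show "perm_action g w \<in> specht_module lam" if "g \<in> perms" by (rule act_mem[OF that assms])
  qed (simp add: average_def)
  then show ?thesis by (simp add: tabloid_form_act card_perms)
qed

text \<open>
  By Schur's lemma the average is a scalar, which is found by comparing traces. This is Schur
  orthogonality for the matrix coefficients of the Specht module, with \<open>d\<close> its dimension.
\<close>

lemma ex_schur_constant:
  "\<exists>d :: nat. (of_nat d :: 'k::field_char_0) \<noteq> 0 \<and>
    (\<forall>u. \<forall>w\<in>specht_module lam. \<forall>x\<in>specht_module lam.
       average u w (x :: _ \<Rightarrow> 'k) = fscale (fact (sum_list lam) * tabloid_form lam w u / of_nat d) x)"
proof -
  obtain d :: nat where d: "\<forall>f c. Vector_Spaces.linear fscale fscale f \<longrightarrow>
     (\<forall>v\<in>specht_module lam. f v = fscale c v) \<longrightarrow>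
      trace_on (specht_module lam :: (_ \<Rightarrow> 'k) set) f = c * of_nat d"
    using trace_on_scalars[OF finite_generators specht_eq_span] by blast
  have scalar: "\<exists>c. c * of_nat d = fact (sum_list lam) * tabloid_form lam w u \<and>
      (\<forall>x\<in>specht_module lam. average u w x = fscale c x)"
    if w: "w \<in> specht_module lam" for u w :: "_ \<Rightarrow> 'k"
  proof -
    obtain c where "\<And>v. v \<in> specht_module lam \<Longrightarrow> average u w v = fscale c v"
      using schur[OF average_linear[of u w] average_commute average_mem[OF w]] by blast
    moreover from this have "trace_on (specht_module lam) (average u w) = c * of_nat d"
      using d average_linear by blast
    ultimately show ?thesis using average_trace[OF w, of u] by (intro exI[of _ c]) simp
  qed
  have d0: "(of_nat d :: 'k) \<noteq> 0"
  proof
    assume "(of_nat d :: 'k) = 0"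
    then show False using scalar[OF e0_mem, of e0] tabloid_form_e0[where 'k = 'k] by force
  qed
  moreover have "average u w x = fscale (fact (sum_list lam) * tabloid_form lam w u / of_nat d) x"
    if wx: "w \<in> specht_module lam" "x \<in> specht_module lam" for u w x :: "_ \<Rightarrow> 'k"
  proof -
    obtain c where c: "c * of_nat d = fact (sum_list lam) * tabloid_form lam w u"
      "\<And>x. x \<in> specht_module lam \<Longrightarrow> average u w x = fscale c x"
      using scalar[OF wx(1), of u] by blast
    have "c = fact (sum_list lam) * tabloid_form lam w u / of_nat d"
      using c(1) d0 by (simp add: field_simps)
    then show ?thesis using c(2)[OF wx(2)] by simp
  qed
  ultimately show ?thesis by blast
qed

text \<open>
  For \<open>u = w = e0\<close> the average is a nonzero scalar \<open>a\<close>, so the action of \<open>g\<close> on the module is \<open>1 / a\<close>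
  times a sum of rank-one operators. This writes the character as a sum of matrix coefficients of
  the orbit of \<open>e0\<close>, from which both claims follow, the second by Schur orthogonality.
\<close>

lemma specht_character_rational_norm:
  shows "g \<in> perms \<Longrightarrow> specht_character lam g \<in> (\<rat> :: 'k::field_char_0 set)"
    and "(\<Sum>g\<in>perms. (specht_character lam g :: 'k) ^ 2) = fact (sum_list lam)"
proof -
  obtain d :: nat where d0: "(of_nat d :: 'k) \<noteq> 0"
    and av: "\<And>u w x :: _ \<Rightarrow> 'k. w \<in> specht_module lam \<Longrightarrow> x \<in> specht_module lam \<Longrightarrow>
       average u w x = fscale (fact (sum_list lam) * tabloid_form lam w u / of_nat d) x"
    using ex_schur_constant[where 'k = 'k] by blast
  define N where "N = (fact (sum_list lam) :: 'k)"
  define s where "s = (tabloid_form lam e0 e0 :: 'k)"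
  define a where "a = N * s / of_nat d"
  define B where "B = (\<lambda>u v :: _ \<Rightarrow> 'k. tabloid_form lam u v)"
  define e where "e = (\<lambda>h. perm_action h e0 :: _ \<Rightarrow> 'k)"
  have s0: "s \<noteq> 0" unfolding s_def by (rule tabloid_form_e0)
  \<comment> \<open>The scalar \<open>a\<close> by which the average for \<open>u = w = e0\<close> acts.\<close>
  have a0: "a \<noteq> 0" using s0 d0 by (simp add: a_def N_def)
  have ortho: "(\<Sum>g\<in>perms. B x (perm_action g u) * B (perm_action g w) y) = N / of_nat d * B w u * B x y"
    if "w \<in> specht_module lam" "x \<in> specht_module lam" for u w x y
  proof -
    have "(\<Sum>g\<in>perms. B x (perm_action g u) * B (perm_action g w) y) = B (average u w x) y"
      unfolding average_def B_def by (simp add: tabloid_form_sum_left)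
    also have "\<dots> = N / of_nat d * B w u * B x y"
      by (simp add: av[OF that] B_def tabloid_form_scale_left N_def)
    finally show ?thesis .
  qed
  have char: "specht_character lam g = (1 / a) * (\<Sum>h\<in>perms. B (perm_action g (e h)) (e h))"
    if g: "g \<in> perms" for g
  proof -
    interpret l: Vector_Spaces.linear fscale fscale "perm_action g :: (_ \<Rightarrow> 'k) \<Rightarrow> _" by (rule perm_action_linear)
    have "specht_character lam g = (\<Sum>h\<in>perms. (1 / a) * B (perm_action g (e h)) (e h))"
      unfolding specht_character_def
    proof (rule trace_on_finite_rank[OF finite_generators specht_eq_span perm_action_linear,
          where \<phi> = "\<lambda>h v. (1 / a) * B v (e h)" and w = "\<lambda>h. perm_action g (e h)"])
      show "Vector_Spaces.linear fscale (*) (\<lambda>v. (1 / a) * B v (e h))" for h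
        by (rule functional_linearI)
          (simp_all add: B_def tabloid_form_add_left tabloid_form_scale_left algebra_simps)
      show "perm_action g (e h) \<in> specht_module lam" if "h \<in> perms" for h
        unfolding e_def by (intro act_mem g act_e0_mem that)
      fix v :: "_ \<Rightarrow> 'k" assume v: "v \<in> specht_module lam"
      have "v = fscale (1 / a) (average e0 e0 v)"
        using a0 by (simp add: av[OF e0_mem v] N_def[symmetric] s_def[symmetric] a_def[symmetric])
      then have "perm_action g v = fscale (1 / a) (perm_action g (average e0 e0 v))" by (metis l.scale)
      then show "perm_action g v = (\<Sum>h\<in>perms. fscale ((1 / a) * B v (e h)) (perm_action g (e h)))"
        by (simp add: average_def l.sum l.scale fun_space.scale_sum_right B_def e_def)
    qed
    then show ?thesis by (simp add: sum_distrib_left)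
  qed
  have rat: "B (perm_action g (e h)) (e h) \<in> \<rat>" if "g \<in> perms" "h \<in> perms" for g h
    using that tabloid_form_Rats[where 'k = 'k]
    by (simp add: B_def e_def act_e0 perm_action_polytabloid[OF perms_permutes])
  have "s \<in> \<rat>" unfolding s_def by (rule tabloid_form_Rats)
  moreover have "N \<in> \<rat>" unfolding N_def by (metis Rats_of_nat of_nat_fact)
  ultimately have "a \<in> \<rat>" by (simp add: a_def)
  moreover have "(\<Sum>h\<in>perms. B (perm_action g (e h)) (e h)) \<in> \<rat>" if "g \<in> perms"
    by (rule sum_in_Rats[OF rat[OF that]])
  ultimately show "specht_character lam g \<in> (\<rat> :: 'k set)" if "g \<in> perms"
    using that by (simp add: char)
  have e': "perm_action h e0 = e h" for h by (simp add: e_def)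
  have e: "e h \<in> specht_module lam" if "h \<in> perms" for h unfolding e_def by (rule act_e0_mem[OF that])
  have Bc: "B u v = B v u" for u v unfolding B_def by (rule tabloid_form_commute)
  have Be: "B (e h) (e h) = s" if "h \<in> perms" for h
    unfolding B_def e_def s_def by (rule tabloid_form_act[OF that])
  have "(specht_character lam g :: 'k) ^ 2 = (1 / a) ^ 2 * (\<Sum>h\<in>perms. \<Sum>k\<in>perms.
        B (e h) (perm_action g (e h)) * B (perm_action g (e k)) (e k))" if "g \<in> perms" for g
    unfolding char[OF that] power_mult_distrib power2_eq_square[of "sum _ _"] sum_product
    by (simp only: Bc[of "e _" "perm_action g _"])
  then have "(\<Sum>g\<in>perms. (specht_character lam g :: 'k) ^ 2) =
     (1 / a) ^ 2 * (\<Sum>g\<in>perms. \<Sum>h\<in>perms. \<Sum>k\<in>perms.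
        B (e h) (perm_action g (e h)) * B (perm_action g (e k)) (e k))"
    by (simp only: sum_distrib_left[symmetric] cong: sum.cong)
  also have "(\<Sum>g\<in>perms. \<Sum>h\<in>perms. \<Sum>k\<in>perms.
        B (e h) (perm_action g (e h)) * B (perm_action g (e k)) (e k)) =
      (\<Sum>k\<in>perms. \<Sum>h\<in>perms. \<Sum>g\<in>perms. B (e h) (perm_action g (e h)) * B (perm_action g (e k)) (e k))"
    by (rule sum_reverse3)
  also have "\<dots> = (\<Sum>k\<in>perms. \<Sum>h\<in>perms. N / of_nat d * (B (e k) (e h) * B (e h) (e k)))"
    by (intro sum.cong refl) (simp add: ortho e mult.assoc)
  also have "\<dots> = (\<Sum>k\<in>perms. N / of_nat d * (N / of_nat d * s * s))"
  proof (rule sum.cong[OF refl])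
    fix k assume k: "k \<in> perms"
    have "(\<Sum>h\<in>perms. B (e k) (e h) * B (e h) (e k)) = N / of_nat d * s * s"
      using ortho[OF e0_mem e[OF k], of e0 "e k"]
      unfolding Be[OF k] e' by (simp only: e' B_def s_def[symmetric])
    then show "(\<Sum>h\<in>perms. N / of_nat d * (B (e k) (e h) * B (e h) (e k))) =
        N / of_nat d * (N / of_nat d * s * s)"
      by (simp only: sum_distrib_left[symmetric])
  qed
  also have "\<dots> = N * a ^ 2"
    by (simp add: card_perms N_def[symmetric] a_def power2_eq_square)
  finally show "(\<Sum>g\<in>perms. (specht_character lam g :: 'k) ^ 2) = fact (sum_list lam)"
    using a0 by (simp add: N_def power_divide)
qed

section \<open>Specht characters summed over Young subgroups\<close>

text \<open>
  The symmetrizer of the Young subgroup that preserves the colouring \<open>f\<close>.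
\<close>

definition symmetrize :: "(nat \<Rightarrow> 'c) \<Rightarrow> ((nat \<Rightarrow> nat set) \<Rightarrow> 'k::field) \<Rightarrow> (nat \<Rightarrow> nat set) \<Rightarrow> 'k" where
  "symmetrize f v = (\<Sum>g\<in>colour_stab points f. perm_action g v)"

lemma colour_stab_perms: "g \<in> colour_stab points f \<Longrightarrow> g \<in> perms"
  by (simp add: colour_stab_def perms_def)

lemma symmetrize_linear: "Vector_Spaces.linear fscale fscale (symmetrize f)"
proof (rule fun_linearI)
  show "symmetrize f (u + v) = symmetrize f u + symmetrize f v" for u v
    by (simp add: symmetrize_def perm_action_def sum_fun_eq fun_eq_iff sum.distrib)
  show "symmetrize f (fscale c v) = fscale c (symmetrize f v)" for c v
    by (simp add: symmetrize_def perm_action_def fscale_def sum_fun_eq fun_eq_iff sum_distrib_left)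
qed

lemma symmetrize_act:
  assumes q: "q \<in> colour_stab points f"
  shows "symmetrize f (perm_action q v) = symmetrize f v"
    and "perm_action q (symmetrize f v) = symmetrize f v"
proof -
  interpret l: Vector_Spaces.linear fscale fscale "perm_action q" by (rule perm_action_linear)
  note qp = colour_stab_perms[OF q]
  have "symmetrize f (perm_action q v) = (\<Sum>g\<in>colour_stab points f. perm_action (g \<circ> q) v)"
    unfolding symmetrize_def by (intro sum.cong refl) (simp add: act_compose[OF colour_stab_perms qp])
  also have "\<dots> = symmetrize f v"
    unfolding symmetrize_def
    by (rule sum.reindex_bij_witness[where j = "\<lambda>g. g \<circ> q" and i = "\<lambda>g. g \<circ> Hilbert_Choice.inv q"])
      (use q perms_inv_o[OF qp] in \<open>auto simp: comp_assoc intro: colour_stab_compose colour_stab_inv\<close>)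
  finally show "symmetrize f (perm_action q v) = symmetrize f v" .
  have "perm_action q (symmetrize f v) = (\<Sum>g\<in>colour_stab points f. perm_action (q \<circ> g) v)"
    unfolding symmetrize_def l.sum by (intro sum.cong refl) (simp add: act_compose[OF qp colour_stab_perms])
  also have "\<dots> = symmetrize f v"
    unfolding symmetrize_def
    by (rule sum.reindex_bij_witness[where j = "\<lambda>g. q \<circ> g" and i = "\<lambda>g. Hilbert_Choice.inv q \<circ> g"])
      (use q perms_inv_o[OF qp] in \<open>auto simp: comp_assoc[symmetric] intro: colour_stab_compose colour_stab_inv\<close>)
  finally show "perm_action q (symmetrize f v) = symmetrize f v" .
qed

lemma symmetrize_trace:
  "trace_on (specht_module lam) (symmetrize f) =
     (\<Sum>g\<in>colour_stab points f. specht_character lam g :: 'k::field_char_0)"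
  unfolding specht_character_def
  by (rule trace_on_sum[OF finite_generators specht_eq_span perm_action_linear _ symmetrize_linear])
    (auto simp: symmetrize_def colour_stab_perms act_mem)

lemma symmetrize_unseparated:
  assumes t: "tableau lam t" and ns: "\<not> separates_columns lam t f"
  shows "symmetrize f (polytabloid lam t) = (0 :: _ \<Rightarrow> 'k::field_char_0)"
proof -
  interpret l: Vector_Spaces.linear fscale fscale "symmetrize f :: (_ \<Rightarrow> 'k) \<Rightarrow> _" by (rule symmetrize_linear)
  let ?D = "young_diagram lam"
  obtain i i' j where ij: "(i, j) \<in> ?D" "(i', j) \<in> ?D" "f (t (i, j)) = f (t (i', j))" "i \<noteq> i'"
    using ns by (auto simp: separates_columns_def)
  let ?q = "transpose (t (i, j)) (t (i', j))"
  have ne: "t (i, j) \<noteq> t (i', j)"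
    using ij t by (auto simp: tableau_def bij_betw_def dest!: inj_onD)
  have q: "?q \<in> column_stabilizer lam t" by (rule column_transposition[OF t ij(1,2)])
  have "f (?q x) = f x" for x using ij(3) by (auto simp: transpose_def)
  then have "?q \<in> colour_stab points f"
    using column_stabilizer_permutes[OF q] by (simp add: colour_stab_def)
  then have "symmetrize f (polytabloid lam t) = symmetrize f (perm_action ?q (polytabloid lam t) :: _ \<Rightarrow> 'k)"
    by (rule symmetrize_act(1)[symmetric])
  also have "\<dots> = fscale (- 1) (symmetrize f (polytabloid lam t))"
    using ne by (simp add: perm_action_column_polytabloid[OF q] sign_swap_id l.scale l.neg)
  finally show ?thesis by (rule eq_neg_self_imp_0)
qed

text \<open>
  The symmetrizer annihilates all polytabloids, so its trace vanishes.
\<close>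

lemma sum_specht_character_undominated:
  assumes "(\<Sum>i<k. row_length lam i) < card {x \<in> points. f x < k}"
  shows "(\<Sum>g\<in>colour_stab points f. specht_character lam g) = (0 :: 'k::field_char_0)"
proof -
  interpret l: Vector_Spaces.linear fscale fscale "symmetrize f :: (_ \<Rightarrow> 'k) \<Rightarrow> _" by (rule symmetrize_linear)
  have "fun_space.subspace {v. symmetrize f v = (0 :: _ \<Rightarrow> 'k)}"
    unfolding fun_space.subspace_def by (auto simp: l.zero l.add l.scale)
  moreover have "symmetrize f (polytabloid lam t) = (0 :: _ \<Rightarrow> 'k)" if t: "tableau lam t" for t
  proof -
    have "\<not> separates_columns lam t f" using separates_columns_imp_dominated[OF lam t, of f k] assms by auto
    then show ?thesis by (rule symmetrize_unseparated[OF t])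
  qed
  ultimately have "specht_module lam \<subseteq> {v. symmetrize f v = (0 :: _ \<Rightarrow> 'k)}"
    unfolding specht_module_def by (intro fun_space.span_minimal) auto
  then have "trace_on (specht_module lam) (symmetrize f :: (_ \<Rightarrow> 'k) \<Rightarrow> _) = (\<Sum>i\<in>{}. 0)"
    by (intro trace_on_finite_rank[OF finite_generators specht_eq_span symmetrize_linear,
          where \<phi> = "\<lambda>_ _. 0" and w = "\<lambda>_. 0"]) auto
  then show ?thesis by (simp add: symmetrize_trace)
qed

lemma ex_tableau_of_colouring:
  assumes content: "\<And>i. fibre_card points f i = row_length lam i"
  obtains t where "tableau lam t" "\<And>c. c \<in> young_diagram lam \<Longrightarrow> f (t c) = fst c"
proof -
  have "\<exists>h. bij_betw h {..<row_length lam i} {x \<in> points. f x = i}" for i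
    using content[of i] by (intro finite_same_card_bij) (auto simp: fibre_card_def)
  then obtain h where h: "\<And>i. bij_betw (h i) {..<row_length lam i} {x \<in> points. f x = i}" by metis
  define t where "t = (\<lambda>(i, j). h i j)"
  have hm: "h i j \<in> points \<and> f (h i j) = i" if "j < row_length lam i" for i j
    using bij_betwE[OF h[of i]] that by auto
  have "bij_betw t (young_diagram lam) points"
    unfolding bij_betw_def
  proof
    show "inj_on t (young_diagram lam)"
    proof (rule inj_onI)
      fix c d assume cd: "c \<in> young_diagram lam" "d \<in> young_diagram lam" "t c = t d"
      obtain i j i' j' where e: "c = (i, j)" "d = (i', j')" by force
      have "j < row_length lam i" "j' < row_length lam i'" using cd e by (auto simp: mem_young_diagram)
      moreover from this have "i = i'" using cd(3) hm[of j i] hm[of j' i'] by (simp add: t_def e)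
      ultimately show "c = d" using cd(3) h[of i] by (auto simp: t_def e bij_betw_def dest: inj_onD)
    qed
    show "t ` young_diagram lam = points"
    proof
      show "t ` young_diagram lam \<subseteq> points" using hm by (auto simp: t_def mem_young_diagram)
      show "points \<subseteq> t ` young_diagram lam"
      proof
        fix x assume "x \<in> points"
        then have "x \<in> h (f x) ` {..<row_length lam (f x)}" using h[of "f x"] by (auto simp: bij_betw_def)
        then obtain j where "j < row_length lam (f x)" "x = t (f x, j)" by (auto simp: t_def)
        then show "x \<in> t ` young_diagram lam" by (auto simp: mem_young_diagram)
      qed
    qed
  qed
  then have "tableau lam t" by (simp add: tableau_def)
  moreover have "f (t c) = fst c" if "c \<in> young_diagram lam" for c
    using that hm by (cases c) (auto simp: t_def mem_young_diagram)
  ultimately show ?thesis by (rule that)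
qed

text \<open>
  Each polytabloid is sent to a multiple of the image \<open>w\<close> of the polytabloid of a tableau \<open>t\<close> whose rows
  are the colour classes: after sorting its columns, its tableau differs from \<open>t\<close> by an element of the
  stabilizer. So the symmetrizer has rank one on the module, and it multiplies its image \<open>w\<close> by the
  order of the stabilizer.
\<close>

lemma sum_specht_character_own_content:
  assumes content: "\<And>i. fibre_card points f i = row_length lam i"
  shows "(\<Sum>g\<in>colour_stab points f. specht_character lam g) =
     (of_nat (card (colour_stab points f)) :: 'k::field_char_0)"
proof -
  interpret l: Vector_Spaces.linear fscale fscale "symmetrize f :: (_ \<Rightarrow> 'k) \<Rightarrow> _" by (rule symmetrize_linear)
  let ?D = "young_diagram lam" and ?S = "colour_stab points f"
  obtain t where t: "tableau lam t" and ft: "\<And>c. c \<in> ?D \<Longrightarrow> f (t c) = fst c"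
    using ex_tableau_of_colouring[OF content] by blast
  define w where "w = (symmetrize f (polytabloid lam t) :: _ \<Rightarrow> 'k)"
  define T where "T = tabloid lam t"
  define s where "s = (of_nat (card ?S) :: 'k)"
  have finS: "finite ?S" by (rule finite_colour_stab) simp
  have "id \<in> ?S" by (simp add: colour_stab_def permutes_id)
  then have s0: "s \<noteq> 0" unfolding s_def using finS by auto
  \<comment> \<open>The stabilizer fixes the tabloid \<open>T\<close>, which has coefficient 1 in its own polytabloid; so \<open>w\<close> is not 0.\<close>
  have wT: "w T = s"
  proof -
    have "perm_action g (polytabloid lam t) T = (1 :: 'k)" if g: "g \<in> ?S" for g
    proof -
      let ?i = "Hilbert_Choice.inv g"
      have i: "?i permutes points" "\<And>x. x \<in> points \<Longrightarrow> f (?i x) = f x"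
        using colour_stab_inv[OF g] by (auto simp: colour_stab_def)
      have "f ((?i \<circ> t) c) = fst c" if "c \<in> ?D" for c
      proof -
        have "t c \<in> points" using t that bij_betwE unfolding tableau_def by blast
        then show ?thesis using i(2) ft[OF that] by simp
      qed
      then have "tabloid lam (?i \<circ> t) = T"
        using tabloid_eq_if_row_colouring[OF t, of f] ft
          tabloid_eq_if_row_colouring[OF tableau_permute[OF i(1) t], of f] by (simp add: T_def)
      then show ?thesis
        using polytabloid_at_own_tabloid[OF t, where 'k = 'k]
        by (simp add: perm_action_def T_def image_tabloid)
    qed
    then show ?thesis by (simp add: w_def symmetrize_def sum_fun_eq s_def)
  qed
  have line: "\<exists>c. symmetrize f (polytabloid lam u) = fscale c w" if u: "tableau lam u" for u
  proof (cases "separates_columns lam u f")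
    case False
    then show ?thesis using symmetrize_unseparated[OF u False, where 'k = 'k] by (intro exI[of _ 0]) simp
  next
    case True
    obtain q where q: "q \<in> column_stabilizer lam u" "\<And>c. c \<in> ?D \<Longrightarrow> f (q (u c)) = fst c"
      using separates_columns_imp_column_perm[OF lam u True content] by blast
    have qp: "q permutes points" by (rule column_stabilizer_permutes[OF q(1)])
    have qu: "tableau lam (q \<circ> u)" by (rule tableau_permute[OF qp u])
    obtain p where p: "p permutes points" "\<And>c. c \<in> ?D \<Longrightarrow> (q \<circ> u) c = p (t c)"
      using ex_permuted_tableau[OF t qu] by blast
    have pS: "p \<in> ?S"
      unfolding colour_stab_def
    proof (intro CollectI conjI ballI p(1))
      fix x assume "x \<in> points"
      then obtain c where c: "c \<in> ?D" "x = t c"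
        using t unfolding tableau_def bij_betw_def by (metis imageE)
      then show "f (p x) = f x" using p(2)[OF c(1)] q(2)[OF c(1)] ft[OF c(1)] by simp
    qed
    have "fscale (of_int (sign q)) (symmetrize f (polytabloid lam u)) =
        symmetrize f (perm_action q (polytabloid lam u) :: _ \<Rightarrow> 'k)"
      by (simp add: perm_action_column_polytabloid[OF q(1)] l.scale)
    also have "perm_action q (polytabloid lam u) = (polytabloid lam (q \<circ> u) :: _ \<Rightarrow> 'k)"
      by (rule perm_action_polytabloid[OF qp])
    also have "\<dots> = polytabloid lam (p \<circ> t)"
      by (rule polytabloid_cong) (simp add: p(2)[unfolded comp_apply])
    also have "\<dots> = perm_action p (polytabloid lam t)"
      by (rule perm_action_polytabloid[OF p(1), symmetric])
    also have "symmetrize f \<dots> = w" unfolding w_def by (rule symmetrize_act(1)[OF pS])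
    finally have "fscale (of_int (sign q)) (fscale (of_int (sign q)) (symmetrize f (polytabloid lam u))) =
        fscale (of_int (sign q)) w" by simp
    then have "symmetrize f (polytabloid lam u) = fscale (of_int (sign q)) w"
      using sign_sign_cancel[OF column_stabilizer_permutation[OF q(1)], where 'k = 'k] by simp
    then show ?thesis by blast
  qed
  have "fun_space.subspace {v. \<exists>c. symmetrize f v = fscale c w}"
    unfolding fun_space.subspace_def
  proof (intro conjI ballI allI)
    show "0 \<in> {v. \<exists>c. symmetrize f v = fscale c w}" by (auto simp: l.zero intro!: exI[of _ 0])
    show "x + y \<in> {v. \<exists>c. symmetrize f v = fscale c w}"
      if "x \<in> {v. \<exists>c. symmetrize f v = fscale c w}" "y \<in> {v. \<exists>c. symmetrize f v = fscale c w}" for x y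
      using that by (auto simp: l.add fun_space.scale_left_distrib[symmetric])
    show "fscale c x \<in> {v. \<exists>c. symmetrize f v = fscale c w}"
      if "x \<in> {v. \<exists>c. symmetrize f v = fscale c w}" for c x
      using that by (auto simp: l.scale)
  qed
  then have "specht_module lam \<subseteq> {v. \<exists>c. symmetrize f v = fscale c w}"
    unfolding specht_module_def using line by (intro fun_space.span_minimal) auto
  then have rank1: "symmetrize f v = fscale (symmetrize f v T / s) w" if v: "v \<in> specht_module lam" for v
  proof -
    obtain c where c: "symmetrize f v = fscale c w" using \<open>specht_module lam \<subseteq> _\<close> v by blast
    have "symmetrize f v T = c * s" unfolding c by (simp add: fscale_def wT)
    then show ?thesis using s0 c by simp
  qed
  have tS: "polytabloid lam t \<in> (specht_module lam :: (_ \<Rightarrow> 'k) set)"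
    unfolding specht_module_def by (rule fun_space.span_base) (use t in auto)
  have wS: "w \<in> specht_module lam"
    using act_mem[OF colour_stab_perms tS] unfolding w_def symmetrize_def specht_eq_span
    by (auto intro!: fun_space.span_sum)
  have "(\<Sum>g\<in>?S. specht_character lam g :: 'k) = (\<Sum>i\<in>{()}. symmetrize f w T / s)"
    unfolding symmetrize_trace[symmetric]
  proof (rule trace_on_finite_rank[OF finite_generators specht_eq_span symmetrize_linear,
        where \<phi> = "\<lambda>_ v. symmetrize f v T / s" and w = "\<lambda>_. w"])
    have "symmetrize f (fscale c v) T = c * symmetrize f v T" for c and v :: "_ \<Rightarrow> 'k"
      unfolding l.scale by (simp add: fscale_def)
    then show "Vector_Spaces.linear fscale (*) (\<lambda>v. symmetrize f v T / s)"
      by (intro functional_linearI) (simp_all add: l.add add_divide_distrib)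
  qed (use wS rank1 in auto)
  also have "\<dots> = symmetrize f w T / s" by simp
  also have "symmetrize f w = (\<Sum>g\<in>?S. w)"
    unfolding symmetrize_def[of f w] by (intro sum.cong refl) (simp add: w_def symmetrize_act(2))
  also have "(\<Sum>g\<in>?S. w) T / s = s" using wT s0 by (simp add: sum_fun_eq s_def)
  finally show ?thesis by (simp add: s_def)
qed

end

context specht_base
begin

text \<open>
  Exchanging the sums over permutations and over the colourings that they fix.
\<close>

lemma sum_specht_character_young_char:
  "(\<Sum>g\<in>perms. (specht_character lam g :: 'k::field_char_0) * of_int (young_char points N \<alpha> g)) =
     (\<Sum>f | f \<in> points \<rightarrow>\<^sub>E {..<N} \<and> (\<forall>i<N. int (fibre_card points f i) = \<alpha> i).
        \<Sum>g\<in>colour_stab points f. specht_character lam g)"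
proof -
  let ?F = "{f \<in> points \<rightarrow>\<^sub>E {..<N}. \<forall>i<N. int (fibre_card points f i) = \<alpha> i}"
  let ?\<chi> = "\<lambda>g. specht_character lam g :: 'k"
  have fin: "finite ?F"
    by (rule finite_subset[of _ "points \<rightarrow>\<^sub>E {..<N}"]) (auto intro: finite_PiE)
  have "?\<chi> g * of_int (young_char points N \<alpha> g) = (\<Sum>f\<in>?F. if g \<in> colour_stab points f then ?\<chi> g else 0)"
    if "g \<in> perms" for g
  proof -
    have "fixed_colourings points N \<alpha> g = {f \<in> ?F. g \<in> colour_stab points f}"
      using perms_permutes[OF that] by (auto simp: fixed_colourings_def colour_stab_def)
    then show ?thesis
      using fin by (simp add: young_char_def sum.inter_filter[symmetric] mult.commute)
  qed
  then have "(\<Sum>g\<in>perms. ?\<chi> g * of_int (young_char points N \<alpha> g)) =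
      (\<Sum>f\<in>?F. \<Sum>g\<in>perms. if g \<in> colour_stab points f then ?\<chi> g else 0)"
    by (subst sum.swap) simp
  also have "\<dots> = (\<Sum>f\<in>?F. \<Sum>g\<in>colour_stab points f. ?\<chi> g)"
  proof (rule sum.cong[OF refl])
    fix f :: "nat \<Rightarrow> nat"
    have "{g \<in> perms. g \<in> colour_stab points f} = colour_stab points f" using colour_stab_perms by auto
    then show "(\<Sum>g\<in>perms. if g \<in> colour_stab points f then ?\<chi> g else 0) = (\<Sum>g\<in>colour_stab points f. ?\<chi> g)"
      using sum.inter_filter[OF finite_perms, of ?\<chi> "\<lambda>g. g \<in> colour_stab points f"] by simp
  qed
  finally show ?thesis by simp
qed

text \<open>
  The norm of the difference is \<open>1 - 2 + 1 = 0\<close>, up to the factor \<open>fact n\<close>; a sum of rational squares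
  vanishes only if all of them do.
\<close>

lemma specht_character_eq_determinantal:
  assumes N: "length lam \<le> N" and g: "g \<in> perms"
  shows "specht_character lam g =
     (of_int (determinantal_char points N (content_vec (row_length lam)) g) :: 'k::field_char_0)"
proof -
  let ?p = "row_length lam"
  let ?l = "content_vec ?p"
  let ?n = "sum_list lam"
  let ?\<chi> = "\<lambda>g. specht_character lam g :: 'k"
  let ?\<psi> = "determinantal_char points N ?l"
  have p0: "?p i = 0" if "N \<le> i" for i using N that by (simp add: row_length_def)
  have "?p (Suc i) \<le> ?p i" for i
    using lam by (auto simp: row_length_def sorted_wrt_iff_nth_less)
  then have part: "is_partition N ?p" using p0 by (simp add: is_partition_def decseq_Suc_iff)
  have "(\<Sum>i<N. ?p i) = (\<Sum>i<length lam. ?p i)"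
    using N by (intro sum.mono_neutral_right) (auto simp: row_length_def)
  then have sz: "(\<Sum>i<N. ?p i) = ?n"
    by (simp add: row_length_def sum_list_sum_nth atLeast0LessThan)
  have inner: "(\<Sum>g\<in>perms. ?\<chi> g * of_int (young_char points N (\<lambda>i. ?l i + int (w i)) g)) =
      fact ?n * of_bool (w = id)" if w: "w permutes {..<N}" for w
  proof (cases "w = id")
    case False
    then obtain k where k: "k \<le> N" "(\<Sum>i<k. int i) < (\<Sum>i<k. int (w i))"
      using permutation_ahead[OF w] by blast
    have "(\<Sum>g\<in>colour_stab points f. ?\<chi> g) = 0"
      if f: "\<forall>i<N. int (fibre_card points f i) = ?l i + int (w i)" for f
    proof (rule sum_specht_character_undominated[of k])
      have "int (card {x \<in> points. f x < k}) = (\<Sum>i<k. int (fibre_card points f i))"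
        by (simp only: card_less_eq_sum_fibre_card[OF finite_atLeastAtMost] of_nat_sum)
      also have "\<dots> = (\<Sum>i<k. ?l i + int (w i))" using f k(1) by (intro sum.cong) auto
      also have "\<dots> = int (\<Sum>i<k. ?p i) - (\<Sum>i<k. int i) + (\<Sum>i<k. int (w i))"
        using sum_content_vec[of ?p k] by (simp add: sum.distrib)
      finally show "(\<Sum>i<k. ?p i) < card {x \<in> points. f x < k}" using k(2) by linarith
    qed
    then show ?thesis unfolding sum_specht_character_young_char using False by simp
  next
    case True
    have cont: "?l i + int (w i) = int (?p i)" for i by (simp add: True content_vec_def)
    let ?F = "{f \<in> points \<rightarrow>\<^sub>E {..<N}. \<forall>k\<in>{..<N}. fibre_card points f k = ?p k}"
    obtain f0 where f0: "f0 \<in> points \<rightarrow>\<^sub>E {..<N}" "\<And>k. k \<in> {..<N} \<Longrightarrow> fibre_card points f0 k = ?p k"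
      by (rule ex_colouring_with_fibres[of points "{..<N}" ?p]) (use sz in auto)
    have "(\<Sum>g\<in>perms. ?\<chi> g * of_int (young_char points N (\<lambda>i. ?l i + int (w i)) g)) =
        (\<Sum>f\<in>?F. \<Sum>g\<in>colour_stab points f. ?\<chi> g)"
      unfolding sum_specht_character_young_char cont by (simp add: Ball_def)
    also have "\<dots> = (\<Sum>f\<in>?F. of_nat (card (colour_stab points f)))"
    proof (rule sum.cong[OF refl], rule sum_specht_character_own_content)
      fix f i assume f: "f \<in> ?F"
      show "fibre_card points f i = ?p i"
      proof (cases "i < N")
        case False
        then have "{x \<in> points. f x = i} = {}" using f by auto
        then show ?thesis using False p0 unfolding fibre_card_def by (simp only: card.empty)
      qed (use f in simp)
    qed
    also have "\<dots> = of_nat (\<Sum>f\<in>?F. card (colour_stab points f))" by simp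
    also have "?F = {f \<in> points \<rightarrow>\<^sub>E {..<N}. \<forall>k\<in>{..<N}. fibre_card points f k = fibre_card points f0 k}"
      using f0(2) by auto
    also have "(\<Sum>f | f \<in> points \<rightarrow>\<^sub>E {..<N} \<and> (\<forall>k\<in>{..<N}. fibre_card points f k = fibre_card points f0 k).
        card (colour_stab points f)) = fact (card points)"
      by (rule sum_card_colour_stab[OF _ f0(1)]) simp
    finally show ?thesis using True by simp
  qed
  have cross: "(\<Sum>g\<in>perms. ?\<chi> g * of_int (?\<psi> g)) = fact ?n"
  proof -
    have "(\<Sum>g\<in>perms. ?\<chi> g * of_int (?\<psi> g)) = (\<Sum>w | w permutes {..<N}. of_int (sign w) *
        (\<Sum>g\<in>perms. ?\<chi> g * of_int (young_char points N (\<lambda>i. ?l i + int (w i)) g)))"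
      unfolding determinantal_char_def of_int_sum of_int_mult sum_distrib_left
      by (subst sum.swap) (simp add: mult.left_commute)
    also have "\<dots> = (\<Sum>w | w permutes {..<N}. of_int (sign w) * (fact ?n * of_bool (w = id)))"
      using inner by simp
    also have "\<dots> = (\<Sum>w\<in>{id :: nat \<Rightarrow> nat}. fact ?n)"
      by (rule sum.mono_neutral_cong_right) (auto simp: finite_permutations permutes_id)
    finally show ?thesis by simp
  qed
  have "(\<Sum>g | g permutes points. ?\<psi> g ^ 2) = fact (card points)"
    by (rule determinantal_char_norm[OF _ part]) (use sz in auto)
  then have "of_int (\<Sum>g\<in>perms. ?\<psi> g ^ 2) = (of_int (fact ?n) :: 'k)" by (simp add: perms_def)
  then have norm: "(\<Sum>g\<in>perms. (of_int (?\<psi> g) :: 'k) ^ 2) = fact ?n" by simp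
  have "\<forall>h\<in>perms. \<exists>q. ?\<chi> h = of_rat q"
    using specht_character_rational_norm(1)[where 'k = 'k] by (auto elim: Rats_cases)
  then obtain q where q: "\<And>h. h \<in> perms \<Longrightarrow> ?\<chi> h = of_rat (q h)" by metis
  have "(of_rat (\<Sum>h\<in>perms. (q h - of_int (?\<psi> h)) ^ 2) :: 'k) =
      (\<Sum>h\<in>perms. (?\<chi> h - of_int (?\<psi> h)) ^ 2)"
    by (simp add: of_rat_sum of_rat_power of_rat_diff q)
  also have "\<dots> = (\<Sum>h\<in>perms. ?\<chi> h ^ 2 - 2 * (?\<chi> h * of_int (?\<psi> h)) + (of_int (?\<psi> h)) ^ 2)"
    by (intro sum.cong refl) (simp add: power2_diff)
  also have "\<dots> = 0"
    by (simp only: sum.distrib sum_subtractf sum_distrib_left[symmetric] cross norm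
        specht_character_rational_norm(2)) simp
  finally have "(\<Sum>h\<in>perms. (q h - of_int (?\<psi> h)) ^ 2) = 0" by simp
  then have "(q g - of_int (?\<psi> g)) ^ 2 = 0"
    using sum_nonneg_eq_0_iff[OF finite_perms, of "\<lambda>h. (q h - of_int (?\<psi> h)) ^ 2"] g by simp
  then have "q g = of_int (?\<psi> g)" by simp
  then show ?thesis using q[OF g] by simp
qed

end

theorem specht_character_determinantal:
  assumes lam: "partition_of lam n" and N: "length lam \<le> N" and g: "g permutes {1..n}"
  shows "specht_character lam g =
     (of_int (determinantal_char {1..n} N (content_vec (row_length lam)) g) :: 'k::field_char_0)"
proof -
  have n: "sum_list lam = n" using lam by (simp add: partition_of_def)
  have "card (young_diagram lam) = card {1..sum_list lam}" by (simp add: card_young_diagram)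
  then obtain t0 where "bij_betw t0 (young_diagram lam) {1..sum_list lam}"
    using finite_same_card_bij[OF finite_young_diagram finite_atLeastAtMost] by blast
  then interpret specht_base lam t0
    using lam by unfold_locales (auto simp: partition_of_def tableau_def)
  show ?thesis using specht_character_eq_determinantal[OF N, of g] g by (simp add: perms_def n)
qed

section \<open>Strips in diagrams\<close>

text \<open>
  Young diagrams as sets of cells: conjugation is then the converse of a relation.
\<close>

definition diagram :: "(nat \<times> nat) set \<Rightarrow> bool" where
  "diagram Y \<longleftrightarrow> finite Y \<and> (\<forall>i j. (Suc i, j) \<in> Y \<longrightarrow> (i, j) \<in> Y) \<and> (\<forall>i j. (i, Suc j) \<in> Y \<longrightarrow> (i, j) \<in> Y)"

definition rows_of :: "(nat \<times> nat) set \<Rightarrow> nat \<Rightarrow> nat" where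
  "rows_of Y i = card {j. (i, j) \<in> Y}"

definition cells :: "(nat \<Rightarrow> nat) \<Rightarrow> (nat \<times> nat) set" where
  "cells p = {(i, j). j < p i}"

lemma diagram_pred_row: "diagram Y \<Longrightarrow> (Suc i, j) \<in> Y \<Longrightarrow> (i, j) \<in> Y"
  unfolding diagram_def by blast

lemma diagram_pred_col: "diagram Y \<Longrightarrow> (i, Suc j) \<in> Y \<Longrightarrow> (i, j) \<in> Y"
  unfolding diagram_def by blast

lemma diagram_down:
  assumes Y: "diagram Y" and "(i, j) \<in> Y" "i' \<le> i" "j' \<le> j"
  shows "(i', j') \<in> Y"
proof -
  have 1: "(i, j) \<in> Y \<Longrightarrow> (i - d, j) \<in> Y" for d i j
  proof (induction d)
    case (Suc d)
    then show ?case using diagram_pred_row[OF Y, of "i - Suc d" j] by (cases "d < i") (auto simp: Suc_diff_Suc)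
  qed simp
  have 2: "(i, j) \<in> Y \<Longrightarrow> (i, j - d) \<in> Y" for d i j
  proof (induction d)
    case (Suc d)
    then show ?case using diagram_pred_col[OF Y, of i "j - Suc d"] by (cases "d < j") (auto simp: Suc_diff_Suc)
  qed simp
  show ?thesis using 2[OF 1[OF assms(2), of "i - i'"], of "j - j'"] assms(3,4) by simp
qed

lemma diagram_finite: "diagram Y \<Longrightarrow> finite Y"
  by (simp add: diagram_def)

lemma diagram_row_interval:
  assumes "diagram Y"
  shows "(i, j) \<in> Y \<longleftrightarrow> j < rows_of Y i"
proof -
  let ?R = "{j. (i, j) \<in> Y}"
  have fin: "finite ?R"
    by (rule finite_subset[of _ "snd ` Y"]) (use diagram_finite[OF assms] in force)+
  have "\<exists>m. ?R = {..<m}"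
  proof (cases "?R = {}")
    case True
    then show ?thesis by (intro exI[of _ 0]) simp
  next
    case False
    have "?R = {..<Suc (Max ?R)}"
    proof
      show "?R \<subseteq> {..<Suc (Max ?R)}" using fin by (auto simp: less_Suc_eq_le)
      show "{..<Suc (Max ?R)} \<subseteq> ?R"
      proof
        fix j assume "j \<in> {..<Suc (Max ?R)}"
        moreover have "(i, Max ?R) \<in> Y" using Max_in[OF fin False] by simp
        ultimately show "j \<in> ?R" using diagram_down[OF assms, of i "Max ?R" i j] by simp
      qed
    qed
    then show ?thesis by blast
  qed
  then obtain m where m: "?R = {..<m}" by blast
  then have "rows_of Y i = m" by (simp add: rows_of_def)
  then show ?thesis using m by blast
qed

lemma diagram_converse: "diagram (Y\<inverse>) \<longleftrightarrow> diagram Y"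
  unfolding diagram_def by simp blast

lemma cells_rows_of: "diagram Y \<Longrightarrow> cells (rows_of Y) = Y"
  using diagram_row_interval by (auto simp: cells_def)

lemma rows_of_cells: "rows_of (cells p) = p"
  by (auto simp: rows_of_def cells_def)

lemma diagram_cells:
  assumes "is_partition N p"
  shows "diagram (cells p)"
proof -
  have p0: "p i = 0" if "N \<le> i" for i using assms that by (simp add: is_partition_def)
  have "cells p \<subseteq> (SIGMA i:{..<N}. {..<p i})"
  proof
    fix c assume "c \<in> cells p"
    then show "c \<in> (SIGMA i:{..<N}. {..<p i})"
      using p0 by (cases c) (auto simp: cells_def, metis not_less less_zeroE)
  qed
  then have "finite (cells p)" by (rule finite_subset) simp
  moreover have "p (Suc i) \<le> p i" for i using assms by (simp add: is_partition_def antimonoD)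
  ultimately show ?thesis by (auto simp: diagram_def cells_def intro: less_le_trans)
qed

lemma rows_of_is_partition:
  assumes Y: "diagram Y" and N: "card Y \<le> N"
  shows "is_partition N (rows_of Y)"
  unfolding is_partition_def
proof (intro conjI allI impI)
  have "rows_of Y (Suc i) \<le> rows_of Y i" for i
  proof (rule ccontr)
    assume "\<not> ?thesis"
    then have "(Suc i, rows_of Y i) \<in> Y" using diagram_row_interval[OF Y] by simp
    then have "(i, rows_of Y i) \<in> Y" by (rule diagram_pred_row[OF Y])
    then show False using diagram_row_interval[OF Y] by simp
  qed
  then show "antimono (rows_of Y)" by (simp add: decseq_Suc_iff)
  fix i assume i: "N \<le> i"
  show "rows_of Y i = 0"
  proof (rule ccontr)
    assume "rows_of Y i \<noteq> 0"
    then have "(i, 0) \<in> Y" using diagram_row_interval[OF Y] by simp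
    then have "(k, 0) \<in> Y" if "k \<le> i" for k using diagram_down[OF Y, of i 0 k 0] that by simp
    then have "(\<lambda>k. (k, 0)) ` {..i} \<subseteq> Y" by blast
    then have "card ((\<lambda>k. (k, 0::nat)) ` {..i}) \<le> card Y" by (rule card_mono[OF diagram_finite[OF Y]])
    then show False using i N by (simp add: card_image inj_on_def)
  qed
qed

lemma card_cells:
  assumes "is_partition N p"
  shows "card (cells p) = (\<Sum>i<N. p i)"
proof -
  have p0: "p i = 0" if "N \<le> i" for i using assms that by (simp add: is_partition_def)
  have "cells p = (SIGMA i:{..<N}. {..<p i})"
    using p0 by (auto simp: cells_def) (metis not_less less_zeroE)
  then show ?thesis by simp
qed

text \<open>
  The strip \<open>Y - Z\<close> is horizontal iff no cell of it lies above a cell of \<open>Y\<close>.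
\<close>

definition horizontal_below :: "(nat \<times> nat) set \<Rightarrow> nat \<Rightarrow> (nat \<times> nat) set set" where
  "horizontal_below Y r =
     {Z. diagram Z \<and> Z \<subseteq> Y \<and> card (Y - Z) = r \<and> (\<forall>i j. (Suc i, j) \<in> Y \<longrightarrow> (i, j) \<in> Z)}"

definition vertical_below :: "(nat \<times> nat) set \<Rightarrow> nat \<Rightarrow> (nat \<times> nat) set set" where
  "vertical_below Y r =
     {Z. diagram Z \<and> Z \<subseteq> Y \<and> card (Y - Z) = r \<and> (\<forall>i j. (i, Suc j) \<in> Y \<longrightarrow> (i, j) \<in> Z)}"

abbreviation diagram_count :: "nat \<Rightarrow> (nat \<times> nat) set \<Rightarrow> (bool \<times> nat) list \<Rightarrow> int" where
  "diagram_count N Y T \<equiv> alt_count N (content_vec (rows_of Y)) T"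

lemma card_diff_cells:
  assumes Y: "diagram Y" "card Y \<le> N" and q: "is_partition N q" "\<And>i. q i \<le> rows_of Y i"
  shows "card (Y - cells q) = (\<Sum>i<N. rows_of Y i - q i)" "cells q \<subseteq> Y"
proof -
  show sub: "cells q \<subseteq> Y"
    using q(2) diagram_row_interval[OF Y(1)] by (auto simp: cells_def intro: less_le_trans)
  have "card (Y - cells q) = card (cells (rows_of Y)) - card (cells q)"
    using sub diagram_finite[OF Y(1)] by (simp add: card_Diff_subset finite_subset cells_rows_of[OF Y(1)])
  also have "\<dots> = (\<Sum>i<N. rows_of Y i - q i)"
    unfolding card_cells[OF q(1)] card_cells[OF rows_of_is_partition[OF Y]]
    by (rule sum_subtractf_nat[symmetric]) (use q in auto)
  finally show "card (Y - cells q) = (\<Sum>i<N. rows_of Y i - q i)" .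
qed

lemma subset_rows_le:
  assumes "diagram Y" "Z \<subseteq> Y"
  shows "rows_of Z i \<le> rows_of Y i"
  unfolding rows_of_def
  by (rule card_mono, rule finite_subset[of _ "snd ` Y"]) (use diagram_finite[OF assms(1)] assms(2) in force)+

lemma below_card: "diagram Y \<Longrightarrow> Z \<subseteq> Y \<Longrightarrow> card Y \<le> N \<Longrightarrow> card Z \<le> N"
  using card_mono[OF diagram_finite] order_trans by blast

lemma diagram_count_horizontal:
  assumes Y: "diagram Y" "card Y \<le> N"
  shows "diagram_count N Y ((False, r) # T) = (\<Sum>Z\<in>horizontal_below Y r. diagram_count N Z T)"
proof -
  note part = rows_of_is_partition[OF Y]
  have "diagram_count N Y ((False, r) # T) =
      (\<Sum>q\<in>hstrips N (rows_of Y) r. alt_count N (content_vec q) T)"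
    by (rule alt_count_hstrips[OF part])
  also have "\<dots> = (\<Sum>Z\<in>horizontal_below Y r. diagram_count N Z T)"
  proof (rule sum.reindex_bij_witness[where j = cells and i = rows_of])
    fix q assume q: "q \<in> hstrips N (rows_of Y) r"
    have qp: "is_partition N q" by (rule hstrips_is_partition[OF part q])
    have q': "\<And>i. rows_of Y (Suc i) \<le> q i" "\<And>i. q i \<le> rows_of Y i" "(\<Sum>i<N. rows_of Y i - q i) = r"
      using q by (auto simp: hstrips_def)
    show "rows_of (cells q) = q" by (rule rows_of_cells)
    show "alt_count N (content_vec (rows_of (cells q))) T = alt_count N (content_vec q) T"
      by (simp add: rows_of_cells)
    have "(i, j) \<in> cells q" if "(Suc i, j) \<in> Y" for i j
      using that q'(1)[of i] diagram_row_interval[OF Y(1)] by (auto simp: cells_def)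
    then show "cells q \<in> horizontal_below Y r"
      using card_diff_cells[OF Y qp q'(2)] q'(3) diagram_cells[OF qp] by (simp add: horizontal_below_def)
  next
    fix Z assume Z: "Z \<in> horizontal_below Y r"
    then have Z': "diagram Z" "Z \<subseteq> Y" "card (Y - Z) = r" "\<And>i j. (Suc i, j) \<in> Y \<Longrightarrow> (i, j) \<in> Z"
      by (auto simp: horizontal_below_def)
    show "cells (rows_of Z) = Z" by (rule cells_rows_of[OF Z'(1)])
    have le: "rows_of Z i \<le> rows_of Y i" for i by (rule subset_rows_le[OF Y(1) Z'(2)])
    have ge: "rows_of Y (Suc i) \<le> rows_of Z i" for i
    proof (rule ccontr)
      assume "\<not> ?thesis"
      then have "(i, rows_of Z i) \<in> Z" using Z'(4) diagram_row_interval[OF Y(1)] by simp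
      then show False using diagram_row_interval[OF Z'(1)] by simp
    qed
    have "is_partition N (rows_of Z)" by (rule rows_of_is_partition[OF Z'(1) below_card[OF Y(1) Z'(2) Y(2)]])
    then show "rows_of Z \<in> hstrips N (rows_of Y) r"
      using card_diff_cells(1)[OF Y _ le] Z'(3) le ge by (simp add: hstrips_def cells_rows_of[OF Z'(1)])
  qed
  finally show ?thesis .
qed

lemma diagram_count_vertical:
  assumes Y: "diagram Y" "card Y \<le> N"
  shows "diagram_count N Y ((True, r) # T) = (\<Sum>Z\<in>vertical_below Y r. diagram_count N Z T)"
proof -
  note part = rows_of_is_partition[OF Y]
  have "diagram_count N Y ((True, r) # T) =
      (\<Sum>q\<in>vstrips N (rows_of Y) r. alt_count N (content_vec q) T)"
    by (rule alt_count_vstrips[OF part])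
  also have "\<dots> = (\<Sum>Z\<in>vertical_below Y r. diagram_count N Z T)"
  proof (rule sum.reindex_bij_witness[where j = cells and i = rows_of])
    fix q assume q: "q \<in> vstrips N (rows_of Y) r"
    have qp: "is_partition N q" by (rule vstrips_is_partition[OF part q])
    have q': "\<And>i. rows_of Y i \<le> q i + 1" "\<And>i. q i \<le> rows_of Y i" "(\<Sum>i<N. rows_of Y i - q i) = r"
      using q by (auto simp: vstrips_def)
    show "rows_of (cells q) = q" by (rule rows_of_cells)
    show "alt_count N (content_vec (rows_of (cells q))) T = alt_count N (content_vec q) T"
      by (simp add: rows_of_cells)
    have "(i, j) \<in> cells q" if "(i, Suc j) \<in> Y" for i j
      using that q'(1)[of i] diagram_row_interval[OF Y(1)] by (auto simp: cells_def)
    then show "cells q \<in> vertical_below Y r"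
      using card_diff_cells[OF Y qp q'(2)] q'(3) diagram_cells[OF qp] by (simp add: vertical_below_def)
  next
    fix Z assume Z: "Z \<in> vertical_below Y r"
    then have Z': "diagram Z" "Z \<subseteq> Y" "card (Y - Z) = r" "\<And>i j. (i, Suc j) \<in> Y \<Longrightarrow> (i, j) \<in> Z"
      by (auto simp: vertical_below_def)
    show "cells (rows_of Z) = Z" by (rule cells_rows_of[OF Z'(1)])
    have le: "rows_of Z i \<le> rows_of Y i" for i by (rule subset_rows_le[OF Y(1) Z'(2)])
    have ge: "rows_of Y i \<le> Suc (rows_of Z i)" for i
    proof (rule ccontr)
      assume "\<not> ?thesis"
      then have "(i, rows_of Z i) \<in> Z" using Z'(4) diagram_row_interval[OF Y(1)] by simp
      then show False using diagram_row_interval[OF Z'(1)] by simp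
    qed
    have zp: "is_partition N (rows_of Z)"
      by (rule rows_of_is_partition[OF Z'(1) below_card[OF Y(1) Z'(2) Y(2)]])
    then show "rows_of Z \<in> vstrips N (rows_of Y) r"
      using card_diff_cells(1)[OF Y zp le] Z'(3) le ge
      by (simp add: vstrips_def cells_rows_of[OF Z'(1)] is_partition_def)
  qed
  finally show ?thesis .
qed

lemma converse_mem_vertical_below:
  "Z\<inverse> \<in> vertical_below Y r \<longleftrightarrow> Z \<in> horizontal_below (Y\<inverse>) r"
proof -
  have "Y\<inverse> - Z = (Y - Z\<inverse>)\<inverse>" by auto
  then have "card (Y\<inverse> - Z) = card (Y - Z\<inverse>)" by (simp only: card_inverse)
  moreover have "Z\<inverse> \<subseteq> Y \<longleftrightarrow> Z \<subseteq> Y\<inverse>" by auto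
  moreover have "(\<forall>i j. (i, Suc j) \<in> Y \<longrightarrow> (i, j) \<in> Z\<inverse>) \<longleftrightarrow> (\<forall>i j. (Suc i, j) \<in> Y\<inverse> \<longrightarrow> (i, j) \<in> Z)"
    unfolding converse_iff by blast
  ultimately show ?thesis
    by (simp only: vertical_below_def horizontal_below_def mem_Collect_eq diagram_converse)
qed

lemma sum_converse_horizontal:
  "(\<Sum>Z\<in>horizontal_below (Y\<inverse>) r. f (Z\<inverse>)) = (\<Sum>Z\<in>vertical_below Y r. f Z)"
  by (rule sum.reindex_bij_witness[where i = converse and j = converse])
    (simp_all add: converse_mem_vertical_below converse_mem_vertical_below[of "_\<inverse>", unfolded converse_converse])

lemma sum_converse_vertical:
  "(\<Sum>Z\<in>vertical_below (Y\<inverse>) r. f (Z\<inverse>)) = (\<Sum>Z\<in>horizontal_below Y r. f Z)"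
  using sum_converse_horizontal[where Y = "Y\<inverse>" and f = "\<lambda>Z. f (Z\<inverse>)"] by simp

text \<open>
  Conjugation exchanges horizontal and vertical strips.
\<close>

lemma diagram_count_converse:
  assumes "diagram Y" "card Y \<le> N"
  shows "diagram_count N (Y\<inverse>) T = diagram_count N Y (map (map_prod Not id) T)"
  using assms
proof (induction T arbitrary: Y)
  case Nil
  have e: "rows_of Z = (\<lambda>_. 0) \<longleftrightarrow> Z = {}" if "diagram Z" for Z
    using diagram_row_interval[OF that] cells_rows_of[OF that] by (auto simp: fun_eq_iff cells_def)
  have empty: "Y\<inverse> = {} \<longleftrightarrow> Y = {}" by auto
  have "is_partition N (rows_of Y)" "is_partition N (rows_of (Y\<inverse>))"
    using Nil by (auto intro!: rows_of_is_partition simp: diagram_converse)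
  then show ?case
    using e[of Y] e[of "Y\<inverse>"] Nil(1) empty
    by (simp add: alt_count_partition_Nil diagram_converse del: alt_count.simps)
next
  case (Cons a T)
  obtain s r where a: "a = (s, r)" by force
  have Y': "diagram (Y\<inverse>)" "card (Y\<inverse>) \<le> N" using Cons.prems by (simp_all add: diagram_converse)
  have IH: "diagram_count N Z T = diagram_count N (Z\<inverse>) (map (map_prod Not id) T)"
    if "diagram Z" "Z \<subseteq> Y\<inverse>" for Z
    using Cons.IH[of "Z\<inverse>"] below_card[OF Y'(1) that(2) Y'(2)] that by (simp add: diagram_converse id_def)
  show ?case
  proof (cases s)
    case True
    have "diagram_count N (Y\<inverse>) (a # T) = (\<Sum>Z\<in>vertical_below (Y\<inverse>) r. diagram_count N Z T)"
      unfolding a using True by (simp only: diagram_count_vertical[OF Y'])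
    also have "\<dots> = (\<Sum>Z\<in>vertical_below (Y\<inverse>) r. diagram_count N (Z\<inverse>) (map (map_prod Not id) T))"
      by (rule sum.cong[OF refl], rule IH) (auto simp: vertical_below_def)
    also have "\<dots> = (\<Sum>Z\<in>horizontal_below Y r. diagram_count N Z (map (map_prod Not id) T))"
      by (rule sum_converse_vertical)
    also have "\<dots> = diagram_count N Y (map (map_prod Not id) (a # T))"
      using True by (simp add: a diagram_count_horizontal[OF Cons.prems] del: alt_count.simps)
    finally show ?thesis .
  next
    case False
    have "diagram_count N (Y\<inverse>) (a # T) = (\<Sum>Z\<in>horizontal_below (Y\<inverse>) r. diagram_count N Z T)"
      unfolding a using False by (simp only: diagram_count_horizontal[OF Y'])
    also have "\<dots> = (\<Sum>Z\<in>horizontal_below (Y\<inverse>) r. diagram_count N (Z\<inverse>) (map (map_prod Not id) T))"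
      by (rule sum.cong[OF refl], rule IH) (auto simp: horizontal_below_def)
    also have "\<dots> = (\<Sum>Z\<in>vertical_below Y r. diagram_count N Z (map (map_prod Not id) T))"
      by (rule sum_converse_horizontal)
    also have "\<dots> = diagram_count N Y (map (map_prod Not id) (a # T))"
      using False by (simp add: a diagram_count_vertical[OF Cons.prems] del: alt_count.simps)
    finally show ?thesis .
  qed
qed

lemma sum_splittings_Cons:
  "(\<Sum>T\<in>splittings (r # R). h T) = (\<Sum>i\<le>r. \<Sum>T\<in>splittings R. h ((False, i) # (True, r - i) # T))"
proof -
  have "(\<Sum>T\<in>splittings (r # R). h T) =
      (\<Sum>i\<le>r. \<Sum>T\<in>(\<lambda>T. (False, i) # (True, r - i) # T) ` splittings R. h T)"
    unfolding splittings.simps by (rule sum.UNION_disjoint) (auto simp: finite_splittings)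
  also have "\<dots> = (\<Sum>i\<le>r. \<Sum>T\<in>splittings R. h ((False, i) # (True, r - i) # T))"
    by (rule sum.cong[OF refl], subst sum.reindex) (auto simp: inj_on_def)
  finally show ?thesis .
qed

text \<open>
  The factors \<open>h_i\<close> and \<open>e_(r - i)\<close> commute, so \<open>q_r\<close> is invariant under exchanging \<open>h\<close> and \<open>e\<close>.
\<close>

lemma sum_splittings_flip:
  "(\<Sum>T\<in>splittings R. alt_count N l (map (map_prod Not id) T)) = (\<Sum>T\<in>splittings R. alt_count N l T)"
proof (induction R arbitrary: l)
  case Nil
  show ?case by simp
next
  case (Cons r R)
  let ?G = "\<lambda>l. \<Sum>T\<in>splittings R. alt_count N l T"
  let ?H = "\<lambda>i. \<Sum>b\<in>row_fillings N False i. \<Sum>b'\<in>row_fillings N True (r - i).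
      ?G (\<lambda>k. l k - int (b k) - int (b' k))"
  have unroll: "(\<Sum>T\<in>splittings R. alt_count N l ((False, i) # (True, j) # f T)) =
      (\<Sum>b\<in>row_fillings N False i. \<Sum>b'\<in>row_fillings N True j.
        \<Sum>T\<in>splittings R. alt_count N (\<lambda>k. l k - int (b k) - int (b' k)) (f T))" for i j f
    unfolding alt_count.simps by (subst sum.swap) (intro sum.cong refl sum.swap)
  have "(\<Sum>T\<in>splittings (r # R). alt_count N l (map (map_prod Not id) T)) =
      (\<Sum>i\<le>r. \<Sum>T\<in>splittings R. alt_count N l ((False, r - i) # (True, i) # map (map_prod Not id) T))"
    unfolding sum_splittings_Cons
    by (intro sum.cong refl) (simp only: list.map map_prod_simp id_apply simp_thms alt_count_swap_tokens[of N l True])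
  also have "\<dots> = (\<Sum>i\<le>r. ?H (r - i))"
    by (intro sum.cong refl) (simp add: unroll Cons.IH del: alt_count.simps)
  also have "\<dots> = (\<Sum>i\<le>r. ?H i)"
    by (rule sum.reindex_bij_witness[where i = "\<lambda>i. r - i" and j = "\<lambda>i. r - i"]) auto
  also have "\<dots> = (\<Sum>T\<in>splittings (r # R). alt_count N l T)"
    unfolding sum_splittings_Cons
    by (intro sum.cong refl) (simp add: unroll[of _ _ "\<lambda>T. T"] del: alt_count.simps)
  finally show ?case .
qed

section \<open>Pairing a diagram with the functions q\<close>

text \<open>
  The scalar product of the Schur function of \<open>Y\<close> with the product of the \<open>q_r\<close> for \<open>r\<close> in \<open>R\<close>.
\<close>

definition odd_pairing :: "nat \<Rightarrow> (nat \<times> nat) set \<Rightarrow> nat list \<Rightarrow> int" where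
  "odd_pairing N Y R = (\<Sum>T\<in>splittings R. diagram_count N Y T)"

lemma odd_pairing_converse:
  assumes "diagram Y" "card Y \<le> N"
  shows "odd_pairing N (Y\<inverse>) R = odd_pairing N Y R"
  unfolding odd_pairing_def diagram_count_converse[OF assms] by (rule sum_splittings_flip)

text \<open>
  The diagrams \<open>\<kappa>\<close> through which a horizontal and then a vertical strip lead from \<open>Y\<close> down to \<open>\<nu>\<close>.
\<close>

definition between :: "(nat \<times> nat) set \<Rightarrow> (nat \<times> nat) set \<Rightarrow> (nat \<times> nat) set set" where
  "between Y \<nu> = {\<kappa>. diagram \<kappa> \<and> \<nu> \<subseteq> \<kappa> \<and> \<kappa> \<subseteq> Y \<and>
     (\<forall>i j. (Suc i, j) \<in> Y \<longrightarrow> (i, j) \<in> \<kappa>) \<and> (\<forall>i j. (i, Suc j) \<in> \<kappa> \<longrightarrow> (i, j) \<in> \<nu>)}"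

text \<open>
  The diagram \<open>Y\<close> without its rim, that is, without its first row and column and shifted back. In
  Frobenius' notation this drops the largest arm and the largest leg.
\<close>

definition shrink :: "(nat \<times> nat) set \<Rightarrow> (nat \<times> nat) set" where
  "shrink Y = {(i, j). (Suc i, Suc j) \<in> Y}"

text \<open>
  If \<open>\<nu>\<close> contains \<open>shrink Y\<close>, these are the lower left ends of the connected components of \<open>Y - \<nu>\<close>.
\<close>

definition free_cells :: "(nat \<times> nat) set \<Rightarrow> (nat \<times> nat) set \<Rightarrow> (nat \<times> nat) set" where
  "free_cells Y \<nu> = {(i, j) \<in> Y - \<nu>. (Suc i, j) \<notin> Y \<and> (j = 0 \<or> (i, j - 1) \<in> \<nu>)}"

text \<open>
  The diagrams \<open>\<nu>\<close> for which \<open>Y - \<nu>\<close> has \<open>r\<close> cells and contains no \<open>2 * 2\<close> square.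
\<close>

definition thick_below :: "(nat \<times> nat) set \<Rightarrow> nat \<Rightarrow> (nat \<times> nat) set set" where
  "thick_below Y r = {\<nu>. diagram \<nu> \<and> shrink Y \<subseteq> \<nu> \<and> \<nu> \<subseteq> Y \<and> card (Y - \<nu>) = r}"

text \<open>
  A cell of \<open>Y - \<nu>\<close> with a cell of \<open>Y\<close> below it has to lie in \<open>\<kappa>\<close>, and one with a cell of \<open>Y - \<nu>\<close> to its
  left must not. Both happen for some cell exactly if \<open>Y - \<nu>\<close> contains a \<open>2 * 2\<close> square; if this does
  not occur, the choice is free for the remaining cells, and all choices give diagrams.
\<close>

lemma card_between:
  assumes Y: "diagram Y" and \<nu>: "diagram \<nu>" "\<nu> \<subseteq> Y"
  shows "card (between Y \<nu>) = (if shrink Y \<subseteq> \<nu> then 2 ^ card (free_cells Y \<nu>) else 0)"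
proof (cases "shrink Y \<subseteq> \<nu>")
  case False
  then obtain i j where ij: "(Suc i, Suc j) \<in> Y" "(i, j) \<notin> \<nu>" by (auto simp: shrink_def)
  have "between Y \<nu> = {}"
  proof (rule equals0I)
    fix \<kappa> assume "\<kappa> \<in> between Y \<nu>"
    then have "(i, Suc j) \<in> \<kappa>" "(i, Suc j) \<in> \<kappa> \<longrightarrow> (i, j) \<in> \<nu>" using ij by (auto simp: between_def)
    then show False using ij(2) by blast
  qed
  then show ?thesis using False by simp
next
  case True
  define forced where "forced = {(i, j) \<in> Y - \<nu>. (Suc i, j) \<in> Y}"
  let ?F = "free_cells Y \<nu>"
  let ?f = "\<lambda>F. \<nu> \<union> forced \<union> F"
  have "bij_betw ?f (Pow ?F) (between Y \<nu>)"
  proof (rule bij_betw_byWitness[where f' = "\<lambda>\<kappa>. \<kappa> \<inter> ?F"])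
    show "\<forall>F\<in>Pow ?F. ?f F \<inter> ?F = F" by (auto simp: forced_def free_cells_def)
    show "\<forall>\<kappa>\<in>between Y \<nu>. ?f (\<kappa> \<inter> ?F) = \<kappa>"
    proof
      fix \<kappa> assume k: "\<kappa> \<in> between Y \<nu>"
      show "?f (\<kappa> \<inter> ?F) = \<kappa>"
      proof
        show "?f (\<kappa> \<inter> ?F) \<subseteq> \<kappa>" using k by (auto simp: between_def forced_def)
        show "\<kappa> \<subseteq> ?f (\<kappa> \<inter> ?F)"
        proof
          fix c assume c: "c \<in> \<kappa>"
          obtain i j where e: "c = (i, j)" by force
          have "j = 0 \<or> (i, j - 1) \<in> \<nu>" using k c e by (cases j) (auto simp: between_def)
          then show "c \<in> ?f (\<kappa> \<inter> ?F)" using k c e by (auto simp: between_def forced_def free_cells_def)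
        qed
      qed
    qed
    show "?f ` Pow ?F \<subseteq> between Y \<nu>"
    proof
      fix \<kappa> assume "\<kappa> \<in> ?f ` Pow ?F"
      then obtain F where F: "F \<subseteq> ?F" "\<kappa> = ?f F" by blast
      have sub: "\<kappa> \<subseteq> Y" using F \<nu>(2) by (auto simp: forced_def free_cells_def)
      have up: "(i, j) \<in> \<kappa>" if "(Suc i, j) \<in> Y" for i j
        using that diagram_pred_row[OF Y that] by (simp add: F(2) forced_def)
      have left: "(i, j) \<in> \<nu>" if ij: "(i, Suc j) \<in> \<kappa>" for i j
      proof -
        consider "(i, Suc j) \<in> \<nu>" | "(Suc i, Suc j) \<in> Y" | "(i, Suc j) \<in> ?F"
          using ij F by (auto simp: forced_def)
        then show ?thesis
        proof cases
          case 1
          then show ?thesis by (rule diagram_pred_col[OF \<nu>(1)])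
        next
          case 2
          then show ?thesis using True by (auto simp: shrink_def)
        next
          case 3
          then show ?thesis by (simp add: free_cells_def)
        qed
      qed
      have "diagram \<kappa>"
        unfolding diagram_def
      proof (intro conjI allI impI)
        show "finite \<kappa>" by (rule finite_subset[OF sub diagram_finite[OF Y]])
        show "(i, j) \<in> \<kappa>" if "(Suc i, j) \<in> \<kappa>" for i j using up sub that by blast
        show "(i, j) \<in> \<kappa>" if "(i, Suc j) \<in> \<kappa>" for i j using left[OF that] F(2) by blast
      qed
      moreover have "\<nu> \<subseteq> \<kappa>" using F(2) by blast
      ultimately show "\<kappa> \<in> between Y \<nu>" unfolding between_def using sub up left by blast
    qed
    show "(\<lambda>\<kappa>. \<kappa> \<inter> ?F) ` between Y \<nu> \<subseteq> Pow ?F" by auto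
  qed
  then have "card (between Y \<nu>) = card (Pow ?F)" by (rule bij_betw_same_card[symmetric])
  also have "finite ?F"
    by (rule finite_subset[OF _ diagram_finite[OF Y]]) (auto simp: free_cells_def)
  then have "card (Pow ?F) = 2 ^ card ?F" by (simp add: card_Pow)
  finally show ?thesis using True by simp
qed

lemma odd_pairing_Nil:
  assumes "diagram Y" "card Y \<le> N"
  shows "odd_pairing N Y [] = of_bool (Y = {})"
proof -
  have "rows_of Y = (\<lambda>_. 0) \<longleftrightarrow> Y = {}"
    using diagram_row_interval[OF assms(1)] cells_rows_of[OF assms(1)] by (auto simp: fun_eq_iff cells_def)
  then show ?thesis
    using alt_count_partition_Nil[OF rows_of_is_partition[OF assms]]
    by (simp add: odd_pairing_def del: alt_count.simps)
qed

lemma odd_pairing_Cons: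
  assumes Y: "diagram Y" "card Y \<le> N"
  shows "odd_pairing N Y (r # R) =
    (\<Sum>\<nu>\<in>thick_below Y r. 2 ^ card (free_cells Y \<nu>) * odd_pairing N \<nu> R)"
proof -
  let ?S = "\<lambda>\<nu>. odd_pairing N \<nu> R"
  have finY: "finite Y" by (rule diagram_finite[OF Y(1)])
  define Sub where "Sub = {\<nu>. diagram \<nu> \<and> \<nu> \<subseteq> Y \<and> card (Y - \<nu>) = r}"
  have fin1: "finite Sub" unfolding Sub_def by (rule finite_subset[of _ "Pow Y"]) (use finY in auto)
  have fin2: "finite (between Y \<nu>)" for \<nu>
    unfolding between_def by (rule finite_subset[of _ "Pow Y"]) (use finY in auto)
  have fin3: "finite (horizontal_below Y i)" for i
    unfolding horizontal_below_def by (rule finite_subset[of _ "Pow Y"]) (use finY in auto)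
  have fin4: "finite (vertical_below Z i)" if "Z \<subseteq> Y" for i Z
    unfolding vertical_below_def by (rule finite_subset[of _ "Pow Y"]) (use finY that in auto)
  have "odd_pairing N Y (r # R) =
     (\<Sum>i\<le>r. \<Sum>\<kappa>\<in>horizontal_below Y i. \<Sum>\<nu>\<in>vertical_below \<kappa> (r - i). ?S \<nu>)"
    unfolding odd_pairing_def sum_splittings_Cons diagram_count_horizontal[OF Y]
  proof (rule sum.cong[OF refl])
    fix i
    have "(\<Sum>T\<in>splittings R. \<Sum>Z\<in>horizontal_below Y i. diagram_count N Z ((True, r - i) # T)) =
       (\<Sum>T\<in>splittings R. \<Sum>Z\<in>horizontal_below Y i. \<Sum>\<nu>\<in>vertical_below Z (r - i). diagram_count N \<nu> T)"
    proof (intro sum.cong refl diagram_count_vertical)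
      fix Z assume "Z \<in> horizontal_below Y i"
      then show "diagram Z" "card Z \<le> N" using below_card[OF Y(1) _ Y(2), of Z] by (auto simp: horizontal_below_def)
    qed
    also have "\<dots> = (\<Sum>Z\<in>horizontal_below Y i. \<Sum>\<nu>\<in>vertical_below Z (r - i). \<Sum>T\<in>splittings R. diagram_count N \<nu> T)"
      by (subst sum.swap) (intro sum.cong refl sum.swap)
    finally show "(\<Sum>T\<in>splittings R. \<Sum>Z\<in>horizontal_below Y i. diagram_count N Z ((True, r - i) # T)) =
      (\<Sum>Z\<in>horizontal_below Y i. \<Sum>\<nu>\<in>vertical_below Z (r - i). \<Sum>T\<in>splittings R. diagram_count N \<nu> T)" .
  qed
  also have "\<dots> = (\<Sum>(i, \<kappa>, \<nu>)\<in>(SIGMA i:{..r}. SIGMA \<kappa>:horizontal_below Y i. vertical_below \<kappa> (r - i)). ?S \<nu>)"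
    using fin3 fin4 by (subst sum.Sigma[symmetric])
      (auto simp: horizontal_below_def intro!: finite_SigmaI sum.cong sum.Sigma)
  also have "\<dots> = (\<Sum>(\<nu>, \<kappa>)\<in>(SIGMA \<nu>:Sub. between Y \<nu>). ?S \<nu>)"
  proof (rule sum.reindex_bij_witness[where j = "\<lambda>(i, \<kappa>, \<nu>). (\<nu>, \<kappa>)" and i = "\<lambda>(\<nu>, \<kappa>). (card (Y - \<kappa>), \<kappa>, \<nu>)"])
    fix x assume "x \<in> (SIGMA i:{..r}. SIGMA \<kappa>:horizontal_below Y i. vertical_below \<kappa> (r - i))"
    then obtain i \<kappa> \<nu> where x: "x = (i, \<kappa>, \<nu>)" "i \<le> r" "\<kappa> \<in> horizontal_below Y i" "\<nu> \<in> vertical_below \<kappa> (r - i)"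
      by auto
    have "Y - \<nu> = (Y - \<kappa>) \<union> (\<kappa> - \<nu>)" using x(3,4) by (auto simp: horizontal_below_def vertical_below_def)
    then have "card (Y - \<nu>) = card (Y - \<kappa>) + card (\<kappa> - \<nu>)"
      using finY x(3) by (simp, intro card_Un_disjoint) (auto simp: horizontal_below_def intro: finite_subset)
    then have "card (Y - \<nu>) = r" using x by (simp add: horizontal_below_def vertical_below_def)
    then show "(case x of (i, \<kappa>, \<nu>) \<Rightarrow> (\<nu>, \<kappa>)) \<in> (SIGMA \<nu>:Sub. between Y \<nu>)"
      using x(3,4) unfolding x(1) by (auto simp: Sub_def between_def horizontal_below_def vertical_below_def)
    show "(case case x of (i, \<kappa>, \<nu>) \<Rightarrow> (\<nu>, \<kappa>) of (\<nu>, \<kappa>) \<Rightarrow> (card (Y - \<kappa>), \<kappa>, \<nu>)) = x"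
      using x by (auto simp: horizontal_below_def)
    show "(case case x of (i, \<kappa>, \<nu>) \<Rightarrow> (\<nu>, \<kappa>) of (\<nu>, \<kappa>) \<Rightarrow> ?S \<nu>) = (case x of (i, \<kappa>, \<nu>) \<Rightarrow> ?S \<nu>)"
      by (simp add: x(1))
  next
    fix y assume "y \<in> (SIGMA \<nu>:Sub. between Y \<nu>)"
    then obtain \<nu> \<kappa> where y: "y = (\<nu>, \<kappa>)" "\<nu> \<in> Sub" "\<kappa> \<in> between Y \<nu>" by auto
    have "Y - \<nu> = (Y - \<kappa>) \<union> (\<kappa> - \<nu>)" using y(2,3) by (auto simp: Sub_def between_def)
    then have "card (Y - \<nu>) = card (Y - \<kappa>) + card (\<kappa> - \<nu>)"
      using finY y(3) by (simp, intro card_Un_disjoint) (auto simp: between_def intro: finite_subset)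
    then have "card (Y - \<kappa>) \<le> r" "card (\<kappa> - \<nu>) = r - card (Y - \<kappa>)" using y(2) by (auto simp: Sub_def)
    then show "(case y of (\<nu>, \<kappa>) \<Rightarrow> (card (Y - \<kappa>), \<kappa>, \<nu>)) \<in>
        (SIGMA i:{..r}. SIGMA \<kappa>:horizontal_below Y i. vertical_below \<kappa> (r - i))"
      using y(2,3) unfolding y(1) by (auto simp: Sub_def between_def horizontal_below_def vertical_below_def)
    show "(case case y of (\<nu>, \<kappa>) \<Rightarrow> (card (Y - \<kappa>), \<kappa>, \<nu>) of (i, \<kappa>, \<nu>) \<Rightarrow> (\<nu>, \<kappa>)) = y"
      by (simp add: y(1))
  qed
  also have "\<dots> = (\<Sum>\<nu>\<in>Sub. \<Sum>\<kappa>\<in>between Y \<nu>. ?S \<nu>)"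
    by (rule sum.Sigma[symmetric]) (use fin1 fin2 in auto)
  also have "\<dots> = (\<Sum>\<nu>\<in>Sub. if shrink Y \<subseteq> \<nu> then 2 ^ card (free_cells Y \<nu>) * ?S \<nu> else 0)"
    by (intro sum.cong refl) (auto simp: card_between[OF Y(1)] Sub_def)
  also have "\<dots> = (\<Sum>\<nu> | \<nu> \<in> Sub \<and> shrink Y \<subseteq> \<nu>. 2 ^ card (free_cells Y \<nu>) * ?S \<nu>)"
    using fin1 by (rule sum.inter_filter[symmetric])
  also have "{\<nu>. \<nu> \<in> Sub \<and> shrink Y \<subseteq> \<nu>} = thick_below Y r" by (auto simp: Sub_def thick_below_def)
  finally show ?thesis .
qed

section \<open>Frames around a diagram\<close>

text \<open>
  Removing the rim of this set of cells leaves \<open>\<omega>\<close>; the parameters \<open>a\<close> and \<open>b\<close> are the lengths of its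
  first row and of its first column.
\<close>

definition framed :: "(nat \<times> nat) set \<Rightarrow> nat \<Rightarrow> nat \<Rightarrow> (nat \<times> nat) set" where
  "framed \<omega> a b = {0} \<times> {..<a} \<union> {..<b} \<times> {0} \<union> map_prod Suc Suc ` \<omega>"

lemma mem_framed:
  assumes "0 < a" "0 < b"
  shows "(0, j) \<in> framed \<omega> a b \<longleftrightarrow> j < a" "(i, 0) \<in> framed \<omega> a b \<longleftrightarrow> i < b"
    "(Suc i, Suc j) \<in> framed \<omega> a b \<longleftrightarrow> (i, j) \<in> \<omega>"
  using assms by (auto simp: framed_def)

lemma shrink_framed: "0 < a \<Longrightarrow> 0 < b \<Longrightarrow> shrink (framed \<omega> a b) = \<omega>"
  by (auto simp: shrink_def mem_framed)

lemma framed_converse: "(framed \<omega> a b)\<inverse> = framed (\<omega>\<inverse>) b a"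
  by (auto simp: framed_def)

lemma shrink_converse: "shrink (Y\<inverse>) = (shrink Y)\<inverse>"
  by (auto simp: shrink_def)

lemma card_framed:
  assumes "finite \<omega>" "0 < a" "0 < b"
  shows "card (framed \<omega> a b) + 1 = a + b + card \<omega>"
proof -
  have 1: "{0} \<times> {..<a} \<union> {..<b} \<times> {0} = {0} \<times> {..<a} \<union> {Suc 0..<b} \<times> {0::nat}"
    using assms(2) by (auto simp: Suc_le_eq)
  have "card (framed \<omega> a b) = card ({0::nat} \<times> {..<a} \<union> {Suc 0..<b} \<times> {0}) + card (map_prod Suc Suc ` \<omega>)"
    unfolding framed_def 1 using assms(1) by (intro card_Un_disjoint) auto
  also have "card ({0::nat} \<times> {..<a} \<union> {Suc 0..<b} \<times> {0}) = card ({0::nat} \<times> {..<a}) + card ({Suc 0..<b} \<times> {0::nat})"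
    by (intro card_Un_disjoint) auto
  also have "card (map_prod Suc Suc ` \<omega>) = card \<omega>"
    by (rule card_image) (auto simp: inj_on_def)
  finally show ?thesis using assms(3) by (simp add: card_cartesian_product)
qed

lemma shrink_subset: "diagram Y \<Longrightarrow> shrink Y \<subseteq> Y"
  by (auto simp: shrink_def dest: diagram_pred_row diagram_pred_col)

lemma diagram_shrink:
  assumes Y: "diagram Y"
  shows "diagram (shrink Y)"
  unfolding diagram_def
proof (intro conjI allI impI)
  show "finite (shrink Y)" by (rule finite_subset[OF shrink_subset[OF Y] diagram_finite[OF Y]])
  show "(i, j) \<in> shrink Y" if "(Suc i, j) \<in> shrink Y" for i j
    using diagram_pred_row[OF Y, of "Suc i" "Suc j"] that by (simp add: shrink_def)
  show "(i, j) \<in> shrink Y" if "(i, Suc j) \<in> shrink Y" for i j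
    using diagram_pred_col[OF Y, of "Suc i" "Suc j"] that by (simp add: shrink_def)
qed

lemma diagram_corner: "diagram Y \<Longrightarrow> Y \<noteq> {} \<Longrightarrow> (0, 0) \<in> Y"
  by (metis diagram_down ex_in_conv le0 surj_pair)

lemma diagram_eq_framed:
  assumes Y: "diagram Y" "Y \<noteq> {}"
  shows "Y = framed (shrink Y) (rows_of Y 0) (rows_of (Y\<inverse>) 0)"
    and "0 < rows_of Y 0" "0 < rows_of (Y\<inverse>) 0"
proof -
  have row: "(0, j) \<in> Y \<longleftrightarrow> j < rows_of Y 0" for j by (rule diagram_row_interval[OF Y(1)])
  have col: "(i, 0) \<in> Y \<longleftrightarrow> i < rows_of (Y\<inverse>) 0" for i
    using diagram_row_interval[of "Y\<inverse>" 0 i] Y(1) by (simp add: diagram_converse)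
  show pos: "0 < rows_of Y 0" "0 < rows_of (Y\<inverse>) 0"
    using diagram_corner[OF Y] row[of 0] col[of 0] by auto
  have "(i, j) \<in> Y \<longleftrightarrow> (i, j) \<in> framed (shrink Y) (rows_of Y 0) (rows_of (Y\<inverse>) 0)" for i j
  proof (cases i)
    case 0
    then show ?thesis by (simp add: row mem_framed[OF pos])
  next
    case (Suc i')
    then show ?thesis by (cases j) (simp_all add: col mem_framed[OF pos] shrink_def)
  qed
  then show "Y = framed (shrink Y) (rows_of Y 0) (rows_of (Y\<inverse>) 0)" by auto
qed

lemma framed_bounds:
  assumes Y: "diagram (framed \<omega> a b)" and pos: "0 < a" "0 < b"
  shows "diagram \<omega>" "rows_of \<omega> 0 < a" "rows_of (\<omega>\<inverse>) 0 < b"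
proof -
  note m = mem_framed[OF pos]
  show \<omega>: "diagram \<omega>" using diagram_shrink[OF Y] by (simp add: shrink_framed pos)
  show "rows_of \<omega> 0 < a"
  proof (cases "rows_of \<omega> 0")
    case (Suc r)
    then have "(0, r) \<in> \<omega>" by (simp add: diagram_row_interval[OF \<omega>])
    then have "(0, Suc r) \<in> framed \<omega> a b" by (intro diagram_pred_row[OF Y, of 0 "Suc r"]) (simp add: m)
    then show ?thesis using Suc by (simp add: m)
  qed (use pos in simp)
  show "rows_of (\<omega>\<inverse>) 0 < b"
  proof (cases "rows_of (\<omega>\<inverse>) 0")
    case (Suc r)
    then have "(0, r) \<in> \<omega>\<inverse>" using \<omega> by (simp add: diagram_row_interval[of "\<omega>\<inverse>" 0 r] diagram_converse del: converse_iff)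
    then have "(Suc r, 0) \<in> framed \<omega> a b" by (intro diagram_pred_col[OF Y, of "Suc r" 0]) (simp add: m)
    then show ?thesis using Suc by (simp add: m)
  qed (use pos in simp)
qed

text \<open>
  The rim is connected, and its lower left end is the last cell of the first column.
\<close>

lemma free_cells_shrink:
  assumes Y: "diagram Y" "Y \<noteq> {}"
  shows "card (free_cells Y (shrink Y)) = 1"
proof -
  let ?b = "rows_of (Y\<inverse>) 0"
  have col: "(i, 0) \<in> Y \<longleftrightarrow> i < ?b" for i
    using diagram_row_interval[of "Y\<inverse>" 0 i] Y(1) by (simp add: diagram_converse)
  have b: "0 < ?b" by (rule diagram_eq_framed(3)[OF Y])
  have out: "(?b - 1, 0) \<notin> shrink Y"
  proof
    assume "(?b - 1, 0) \<in> shrink Y"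
    then have "(?b, Suc 0) \<in> Y" using b by (simp add: shrink_def)
    then have "(?b, 0) \<in> Y" by (rule diagram_pred_col[OF Y(1)])
    then show False by (simp add: col)
  qed
  have "free_cells Y (shrink Y) = {(?b - 1, 0)}"
  proof
    show "free_cells Y (shrink Y) \<subseteq> {(?b - 1, 0)}"
    proof
      fix c assume c: "c \<in> free_cells Y (shrink Y)"
      obtain i j where e: "c = (i, j)" by force
      have "j = 0" using c e by (cases j) (auto simp: free_cells_def shrink_def)
      then show "c \<in> {(?b - 1, 0)}" using c e col[of i] col[of "Suc i"] by (auto simp: free_cells_def)
    qed
    show "{(?b - 1, 0)} \<subseteq> free_cells Y (shrink Y)"
      using out b by (simp add: free_cells_def col)
  qed
  then show ?thesis by simp
qed

lemma thick_below_top: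
  assumes Y: "diagram Y"
  shows "thick_below Y (card (Y - shrink Y)) = {shrink Y}"
proof
  have fin: "finite Y" by (rule diagram_finite[OF Y])
  show "{shrink Y} \<subseteq> thick_below Y (card (Y - shrink Y))"
    using diagram_shrink[OF Y] shrink_subset[OF Y] by (simp add: thick_below_def)
  show "thick_below Y (card (Y - shrink Y)) \<subseteq> {shrink Y}"
  proof
    fix \<nu> assume \<nu>: "\<nu> \<in> thick_below Y (card (Y - shrink Y))"
    then have "Y - \<nu> \<subseteq> Y - shrink Y" "card (Y - \<nu>) = card (Y - shrink Y)" by (auto simp: thick_below_def)
    then have "Y - \<nu> = Y - shrink Y" using fin by (intro card_subset_eq) auto
    then show "\<nu> \<in> {shrink Y}" using \<nu> shrink_subset[OF Y] by (auto simp: thick_below_def)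
  qed
qed

lemma thick_below_above_top:
  assumes Y: "diagram Y" and r: "card (Y - shrink Y) < r"
  shows "thick_below Y r = {}"
proof (rule equals0I)
  fix \<nu> assume "\<nu> \<in> thick_below Y r"
  then have "Y - \<nu> \<subseteq> Y - shrink Y" "card (Y - \<nu>) = r" by (auto simp: thick_below_def)
  then show False using card_mono[of "Y - shrink Y" "Y - \<nu>"] diagram_finite[OF Y] r by simp
qed

lemma odd_pairing_top:
  assumes Y: "diagram Y" "Y \<noteq> {}" "card Y \<le> N"
  shows "odd_pairing N Y (card (Y - shrink Y) # R) = 2 * odd_pairing N (shrink Y) R"
  by (simp add: odd_pairing_Cons[OF Y(1,3)] thick_below_top[OF Y(1)] free_cells_shrink[OF Y(1,2)])

lemma card_shrink_less:
  assumes Y: "diagram Y" "Y \<noteq> {}"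
  shows "card (shrink Y) < card Y"
proof -
  note pos = diagram_eq_framed(2,3)[OF Y]
  have "finite (shrink Y)" using diagram_finite diagram_shrink Y(1) by blast
  from card_framed[OF this pos] show ?thesis
    using pos unfolding diagram_eq_framed(1)[OF Y, symmetric] by simp
qed

text \<open>
  Removing the whole rim again and again gives a product of \<open>q_r\<close>s whose pairing with \<open>Y\<close> is a power of 2.
\<close>

lemma odd_pairing_nonzero:
  assumes "diagram Y" "card Y \<le> N"
  shows "\<exists>R. odd_pairing N Y R \<noteq> 0"
  using assms
proof (induction "card Y" arbitrary: Y rule: less_induct)
  case less
  show ?case
  proof (cases "Y = {}")
    case True
    then show ?thesis using odd_pairing_Nil[OF less.prems] by (intro exI[of _ "[]"]) simp
  next
    case False
    note lt = card_shrink_less[OF less.prems(1) False]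
    obtain R where "odd_pairing N (shrink Y) R \<noteq> 0"
      using less.hyps[OF lt diagram_shrink[OF less.prems(1)]] lt less.prems(2) by auto
    then show ?thesis
      using odd_pairing_top[OF less.prems(1) False less.prems(2), of R]
      by (intro exI[of _ "card (Y - shrink Y) # R"]) simp
  qed
qed

text \<open>
  The size of the rim is the largest \<open>r\<close> for which some pairing starting with \<open>r\<close> does not vanish, and
  for this \<open>r\<close> the pairings are twice those of the diagram without its rim.
\<close>

lemma odd_pairing_eq_shrink:
  assumes Y: "diagram Y" "Y \<noteq> {}" "card Y \<le> N" and Z: "diagram Z" "Z \<noteq> {}" "card Z \<le> N"
    and eq: "\<And>R. odd_pairing N Y R = odd_pairing N Z R"
  shows "odd_pairing N (shrink Y) R = odd_pairing N (shrink Z) R"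
    and "card (Y - shrink Y) = card (Z - shrink Z)"
proof -
  have le: "card (Y - shrink Y) \<le> card (Z - shrink Z)"
    if Y: "diagram Y" "Y \<noteq> {}" "card Y \<le> N" and Z: "diagram Z" "card Z \<le> N"
      and eq: "\<And>R. odd_pairing N Y R = odd_pairing N Z R" for Y Z
  proof (rule ccontr)
    assume "\<not> ?thesis"
    then have "odd_pairing N Z (card (Y - shrink Y) # R) = 0" for R
      by (simp add: odd_pairing_Cons[OF Z] thick_below_above_top[OF Z(1)])
    then have "odd_pairing N (shrink Y) R = 0" for R
      using odd_pairing_top[OF Y] eq by simp
    moreover have "card (shrink Y) \<le> N" using card_shrink_less[OF Y(1,2)] Y(3) by simp
    ultimately show False using odd_pairing_nonzero[OF diagram_shrink[OF Y(1)]] by blast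
  qed
  show top: "card (Y - shrink Y) = card (Z - shrink Z)"
    using le[OF Y Z(1,3) eq] le[OF Z Y(1,3) eq[symmetric]] by simp
  show "odd_pairing N (shrink Y) R = odd_pairing N (shrink Z) R"
    using odd_pairing_top[OF Y, of R] odd_pairing_top[OF Z, of R] eq top by simp
qed

section \<open>Recovering a diagram up to conjugation\<close>

text \<open>
  Here \<open>\<omega>\<close> is common to both diagrams, and \<open>k = a - rows_of \<omega> 0\<close> is the smallest overhang. Leave \<open>k\<close> cells
  of the rim behind. Both diagrams then allow the same remaining diagrams \<open>\<nu>\<close>, and by comparison with
  the frame \<open>framed \<omega> a' b\<close> around both, their weights differ only at \<open>nr\<close> (first row of \<open>\<omega>\<close> lengthened to
  \<open>a\<close>), where the first diagram has one component less, and at \<open>nc\<close> (first column of \<open>\<omega>\<close> lengthened to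
  \<open>b'\<close>), where the second one has. The second exception exists only if its overhang is also \<open>k\<close>.
\<close>

lemma same_core_conjugate:
  assumes dl: "diagram (framed \<omega> a b)" and dm: "diagram (framed \<omega> a' b')"
    and pos: "0 < a" "0 < b" "0 < a'" "0 < b'"
    and lt: "a < a'" and sum: "a + b = a' + b'"
    and short: "a - rows_of \<omega> 0 \<le> b' - rows_of (\<omega>\<inverse>) 0"
    and N: "card (framed \<omega> a b) \<le> N"
    and eq: "\<And>R. odd_pairing N (framed \<omega> a b) R = odd_pairing N (framed \<omega> a' b') R"
    and IH: "\<And>Y Z. diagram Y \<Longrightarrow> diagram Z \<Longrightarrow> card Y < card (framed \<omega> a b) \<Longrightarrow> card Z = card Y \<Longrightarrow>
       (\<And>R. odd_pairing N Y R = odd_pairing N Z R) \<Longrightarrow> Y = Z \<or> Y = Z\<inverse>"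
  shows "framed \<omega> a' b' = (framed \<omega> a b)\<inverse>"
proof -
  let ?L = "framed \<omega> a b" and ?K = "framed \<omega> a' b'"
  define A where "A = rows_of \<omega> 0"
  define B where "B = rows_of (\<omega>\<inverse>) 0"
  define k where "k = a - A"
  note ml = mem_framed[OF pos(1,2)] and mm = mem_framed[OF pos(3,4)]
  have \<omega>: "diagram \<omega>" and Aa: "A < a" using framed_bounds[OF dl pos(1,2)] by (simp_all add: A_def)
  have Bb': "B < b'" using framed_bounds(3)[OF dm pos(3,4)] by (simp add: B_def)
  have bb': "b' < b" using lt sum by simp
  have kB: "k \<le> b' - B" using short by (simp add: k_def A_def B_def)
  have row: "(0, j) \<in> \<omega> \<longleftrightarrow> j < A" for j unfolding A_def by (rule diagram_row_interval[OF \<omega>])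
  have col: "(i, 0) \<in> \<omega> \<longleftrightarrow> i < B" for i
    unfolding B_def using diagram_row_interval[of "\<omega>\<inverse>" 0 i] \<omega> by (simp add: diagram_converse)
  have fin: "finite \<omega>" by (rule diagram_finite[OF \<omega>])
  have finl: "finite ?L" and finm: "finite ?K" using diagram_finite dl dm by blast+
  have cl: "card ?L + 1 = a + b + card \<omega>" by (rule card_framed[OF fin pos(1,2)])
  have cm: "card ?K + 1 = a + b + card \<omega>" using card_framed[OF fin pos(3,4)] sum by simp
  have Nm: "card ?K \<le> N" using N cl cm by simp
  have wl: "\<omega> \<subseteq> ?L" and wm: "\<omega> \<subseteq> ?K"
    using shrink_subset[OF dl] shrink_subset[OF dm] pos by (simp_all add: shrink_framed)
  have big: "card \<omega> + k < card ?L" using cl bb' Aa Bb' by (simp add: k_def)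
  define r where "r = card ?L - (card \<omega> + k)"
  \<comment> \<open>With only \<open>k\<close> cells beyond \<open>\<omega>\<close>, \<open>\<nu>\<close> cannot stick out of the shorter row or of the shorter column.\<close>
  have arm: "j < a" if \<nu>: "diagram \<nu>" "\<omega> \<subseteq> \<nu>" "card \<nu> = card \<omega> + k" and "(0, j) \<in> \<nu>" for \<nu> j
  proof (rule ccontr)
    assume "\<not> j < a"
    then have "{0} \<times> {A..a} \<subseteq> \<nu> - \<omega>"
      using diagram_down[OF \<nu>(1) that(4)] by (auto simp: row)
    then have "card ({0::nat} \<times> {A..a}) \<le> card (\<nu> - \<omega>)"
      using diagram_finite[OF \<nu>(1)] by (intro card_mono) auto
    then show False using \<nu> fin Aa by (simp add: card_Diff_subset card_cartesian_product k_def)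
  qed
  have leg: "i < b' \<and> (Suc i = b' \<longrightarrow> b' - B \<le> k)"
    if \<nu>: "diagram \<nu>" "\<omega> \<subseteq> \<nu>" "card \<nu> = card \<omega> + k" and "(i, 0) \<in> \<nu>" for \<nu> i
  proof -
    have "card ({B..i} \<times> {0::nat}) \<le> card (\<nu> - \<omega>)"
      using diagram_down[OF \<nu>(1) that(4)] diagram_finite[OF \<nu>(1)] by (intro card_mono) (auto simp: col)
    then have "Suc i - B \<le> k" using \<nu> fin by (simp add: card_Diff_subset card_cartesian_product)
    then show ?thesis using kB Bb' by auto
  qed
  have thick: "\<nu> \<in> thick_below ?L r \<longleftrightarrow> diagram \<nu> \<and> \<omega> \<subseteq> \<nu> \<and> \<nu> \<subseteq> ?L \<and> card \<nu> = card \<omega> + k" for \<nu>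
  proof -
    have "card (?L - \<nu>) = r \<longleftrightarrow> card \<nu> = card \<omega> + k" if "\<nu> \<subseteq> ?L"
      using that card_mono[OF finl that] big finite_subset[OF that finl]
      by (auto simp: card_Diff_subset r_def)
    then show ?thesis by (auto simp: thick_below_def shrink_framed pos)
  qed
  have thick': "\<nu> \<in> thick_below ?K r \<longleftrightarrow> diagram \<nu> \<and> \<omega> \<subseteq> \<nu> \<and> \<nu> \<subseteq> ?K \<and> card \<nu> = card \<omega> + k" for \<nu>
  proof -
    have "card (?K - \<nu>) = r \<longleftrightarrow> card \<nu> = card \<omega> + k" if "\<nu> \<subseteq> ?K"
      using that card_mono[OF finm that] big finite_subset[OF that finm] cl cm
      by (auto simp: card_Diff_subset r_def)
    then show ?thesis by (auto simp: thick_below_def shrink_framed pos)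
  qed
  have mem_common: "\<nu> \<subseteq> ?L \<longleftrightarrow> \<nu> \<subseteq> ?K" if \<nu>: "diagram \<nu>" "\<omega> \<subseteq> \<nu>" "card \<nu> = card \<omega> + k" for \<nu>
  proof -
    have "(i, j) \<in> ?L \<longleftrightarrow> (i, j) \<in> ?K" if c: "(i, j) \<in> \<nu>" for i j
    proof (cases i)
      case 0
      then have "j < a" using arm[OF \<nu>] c by simp
      then show ?thesis using 0 lt by (simp add: ml mm)
    next
      case (Suc i')
      show ?thesis
      proof (cases j)
        case 0
        then have "i < b'" using leg[OF \<nu>] c by simp
        then show ?thesis using 0 bb' by (simp add: ml mm)
      qed (simp add: Suc ml mm)
    qed
    then show ?thesis by (auto simp: subset_iff)
  qed
  have M: "thick_below ?L r = thick_below ?K r"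
  proof (rule Set.set_eqI)
    show "\<nu> \<in> thick_below ?L r \<longleftrightarrow> \<nu> \<in> thick_below ?K r" for \<nu>
      unfolding thick thick' using mem_common[of \<nu>] by blast
  qed
  let ?M = "thick_below ?L r"
  have finM: "finite ?M" unfolding thick_below_def
    by (rule finite_subset[of _ "Pow ?L"]) (use finl in auto)
  let ?U = "framed \<omega> a' b"
  note mu = mem_framed[OF pos(3,2)]
  have finf: "finite (free_cells Y \<nu>)" if "finite Y" for Y \<nu>
    by (rule finite_subset[OF _ that]) (auto simp: free_cells_def)
  \<comment> \<open>Lengthening the first row adds a component to the rest of the rim if \<open>\<nu>\<close> fills the old row, and otherwise lengthens a component. The same holds for columns.\<close>
  have free_arm: "card (free_cells ?U \<nu>) = card (free_cells ?L \<nu>) + of_bool ((0, a - 1) \<in> \<nu>)"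
    if "\<nu> \<in> ?M" for \<nu>
  proof -
    have \<nu>: "diagram \<nu>" "\<omega> \<subseteq> \<nu>" "card \<nu> = card \<omega> + k" using that[unfolded thick] by simp_all
    have ar: "(0, j) \<in> \<nu> \<Longrightarrow> j < a" for j using arm[OF \<nu>] .
    have "free_cells ?U \<nu> = free_cells ?L \<nu> \<union> (if (0, a - 1) \<in> \<nu> then {(0, a)} else {})" (is "_ = ?R")
    proof -
      have "(i, j) \<in> free_cells ?U \<nu> \<longleftrightarrow> (i, j) \<in> ?R" for i j
      proof (cases i)
        case 0
        show ?thesis
        proof (cases j)
          case 0
          then show ?thesis using \<open>i = 0\<close> pos by (auto simp: free_cells_def ml mu)
        next
          case (Suc j')
          have "(0, j') \<in> \<nu> \<Longrightarrow> \<not> Suc j' < a \<Longrightarrow> Suc j' = a" using ar[of j'] by simp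
          moreover have "Suc j' = a \<Longrightarrow> (0, j') \<notin> \<omega>" using Aa by (simp add: row)
          moreover have "(0, Suc j') \<notin> \<nu>" if "Suc j' = a" using ar[of "Suc j'"] that by auto
          moreover have "(Suc 0, a) \<notin> ?U" if "Suc j' = a"
            using mu(3)[of 0 j'] row[of j'] that Aa by auto
          moreover have "a - 1 = j'" if "Suc j' = a" using that by simp
          ultimately show ?thesis
            using \<open>i = 0\<close> Suc lt by (cases "Suc j' = a") (auto simp: free_cells_def ml mu)
        qed
      next
        case (Suc i')
        then show ?thesis by (cases j) (auto simp: free_cells_def ml mu)
      qed
      then show ?thesis by (auto simp: set_eq_iff)
    qed
    moreover have "(0, a) \<notin> free_cells ?L \<nu>" by (simp add: free_cells_def ml)
    ultimately show ?thesis using finf[OF finl, of \<nu>] by simp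
  qed
  have free_leg: "card (free_cells ?U \<nu>) = card (free_cells ?K \<nu>) + of_bool ((b' - 1, 0) \<in> \<nu>)"
    if "\<nu> \<in> ?M" for \<nu>
  proof -
    have \<nu>: "diagram \<nu>" "\<omega> \<subseteq> \<nu>" "card \<nu> = card \<omega> + k" using that[unfolded thick] by simp_all
    have le: "(i, 0) \<in> \<nu> \<Longrightarrow> i < b'" for i using leg[OF \<nu>] by blast
    define C where "C = free_cells ?K \<nu> - {(b' - 1, 0)}"
    have "free_cells ?U \<nu> = insert (b - 1, 0) C"
    proof -
      have "(i, j) \<in> free_cells ?U \<nu> \<longleftrightarrow> (i, j) \<in> insert (b - 1, 0) C" for i j
      proof (cases j)
        case 0
        have "(b - 1, 0) \<notin> \<nu>" using le[of "b - 1"] bb' by auto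
        moreover have "(i, 0) \<notin> C" by (auto simp: C_def free_cells_def mm)
        ultimately show ?thesis using 0 pos by (auto simp: free_cells_def mu)
      next
        case (Suc j')
        then show ?thesis by (cases i) (auto simp: C_def free_cells_def mm mu)
      qed
      then show ?thesis by (auto simp: set_eq_iff)
    qed
    moreover have "(b - 1, 0) \<notin> C" using bb' by (auto simp: C_def free_cells_def mm)
    moreover have "finite C" using finf[OF finm] by (simp add: C_def)
    ultimately have "card (free_cells ?U \<nu>) = Suc (card C)" by simp
    moreover have "(b' - 1, 0) \<in> free_cells ?K \<nu> \<longleftrightarrow> (b' - 1, 0) \<notin> \<nu>"
      using pos by (simp add: free_cells_def mm)
    ultimately show ?thesis
      using finf[OF finm, of \<nu>] card_Suc_Diff1[of "free_cells ?K \<nu>" "(b' - 1, 0)"] by (auto simp: C_def)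
  qed
  define nr where "nr = \<omega> \<union> {0} \<times> {..<a}"
  define nc where "nc = \<omega> \<union> {..<b'} \<times> {0}"
  have nr_M: "nr \<in> ?M"
    unfolding thick
  proof (intro conjI)
    have e: "nr = \<omega> \<union> {0} \<times> {A..<a}" by (auto simp: nr_def row)
    have "card nr = card \<omega> + card ({0::nat} \<times> {A..<a})"
      unfolding e using fin by (intro card_Un_disjoint) (auto simp: row)
    then show "card nr = card \<omega> + k" by (simp add: card_cartesian_product k_def)
    show "diagram nr"
      unfolding diagram_def nr_def
      using fin by (auto dest: diagram_pred_row[OF \<omega>] diagram_pred_col[OF \<omega>])
    show "\<omega> \<subseteq> nr" "nr \<subseteq> ?L" using wl by (auto simp: nr_def ml)
  qed
  have nr_iff: "(0, a - 1) \<in> \<nu> \<longleftrightarrow> \<nu> = nr" if "\<nu> \<in> ?M" for \<nu>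
  proof
    have \<nu>: "diagram \<nu>" "\<omega> \<subseteq> \<nu>" "card \<nu> = card \<omega> + k" using that[unfolded thick] by simp_all
    assume "(0, a - 1) \<in> \<nu>"
    then have "nr \<subseteq> \<nu>" using \<nu>(2) diagram_down[OF \<nu>(1), of 0 "a - 1"] by (auto simp: nr_def)
    moreover have "card nr = card \<nu>" using nr_M \<nu>(3) thick by simp
    ultimately show "\<nu> = nr" using card_subset_eq[OF diagram_finite[OF \<nu>(1)]] by blast
  qed (use pos in \<open>simp add: nr_def\<close>)
  let ?S = "\<lambda>\<nu>. odd_pairing N \<nu>"
  let ?wl = "\<lambda>\<nu>. 2 ^ card (free_cells ?L \<nu>) :: int" and ?wm = "\<lambda>\<nu>. 2 ^ card (free_cells ?K \<nu>) :: int"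
  have weights: "?wl \<nu> * 2 ^ of_bool (\<nu> = nr) = ?wm \<nu> * 2 ^ of_bool ((b' - 1, 0) \<in> \<nu>)" if "\<nu> \<in> ?M" for \<nu>
    using free_arm[OF that] free_leg[OF that] nr_iff[OF that] by (simp flip: power_add)
  have diff: "(\<Sum>\<nu>\<in>?M. (?wl \<nu> - ?wm \<nu>) * ?S \<nu> R) = 0" for R
    using eq[of "r # R"] unfolding odd_pairing_Cons[OF dl N] odd_pairing_Cons[OF dm Nm] M[symmetric]
    by (simp add: left_diff_distrib sum_subtractf)
  have nr_small: "card nr < card ?L" using nr_M big thick by simp
  have nr_d: "diagram nr" using nr_M[unfolded thick] by simp
  \<comment> \<open>If the column of the second diagram overhangs by more than \<open>k\<close>, then \<open>nr\<close> is the only exception and its pairings vanish.\<close>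
  have kb: "b' - B = k"
  proof (rule ccontr)
    assume "b' - B \<noteq> k"
    then have no: "(b' - 1, 0) \<notin> \<nu>" if "\<nu> \<in> ?M" for \<nu>
      using leg[of \<nu> "b' - 1"] that thick[of \<nu>] kB pos by auto
    have w: "?wl \<nu> - ?wm \<nu> = (if \<nu> = nr then - ?wl nr else 0)" if "\<nu> \<in> ?M" for \<nu>
      using weights[OF that] no[OF that] by (cases "\<nu> = nr") simp_all
    have "?S nr R = 0" for R
    proof -
      have "(\<Sum>\<nu>\<in>?M. if \<nu> = nr then - ?wl nr * ?S nr R else 0) = (\<Sum>\<nu>\<in>?M. (?wl \<nu> - ?wm \<nu>) * ?S \<nu> R)"
        by (rule sum.cong[OF refl]) (simp add: w)
      then show ?thesis unfolding diff using nr_M finM by simp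
    qed
    moreover have "card nr \<le> N" using nr_small N by simp
    ultimately show False using odd_pairing_nonzero[OF nr_d] by blast
  qed
  have nc_M: "nc \<in> ?M"
    unfolding M thick'
  proof (intro conjI)
    have e: "nc = \<omega> \<union> {B..<b'} \<times> {0}" by (auto simp: nc_def col)
    have "card nc = card \<omega> + card ({B..<b'} \<times> {0::nat})"
      unfolding e using fin by (intro card_Un_disjoint) (auto simp: col)
    then show "card nc = card \<omega> + k" by (simp add: card_cartesian_product kb)
    show "diagram nc"
      unfolding diagram_def nc_def
      using fin by (auto dest: diagram_pred_row[OF \<omega>] diagram_pred_col[OF \<omega>])
    show "\<omega> \<subseteq> nc" "nc \<subseteq> ?K" using wm by (auto simp: nc_def mm)
  qed
  have nc_iff: "(b' - 1, 0) \<in> \<nu> \<longleftrightarrow> \<nu> = nc" if "\<nu> \<in> ?M" for \<nu>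
  proof
    have \<nu>: "diagram \<nu>" "\<omega> \<subseteq> \<nu>" "card \<nu> = card \<omega> + k" using that[unfolded thick] by simp_all
    assume "(b' - 1, 0) \<in> \<nu>"
    then have "nc \<subseteq> \<nu>" using \<nu>(2) diagram_down[OF \<nu>(1), of "b' - 1" 0] by (auto simp: nc_def)
    moreover have "card nc = card \<nu>" using nc_M \<nu>(3) thick by simp
    ultimately show "\<nu> = nc" using card_subset_eq[OF diagram_finite[OF \<nu>(1)]] by blast
  qed (use pos in \<open>simp add: nc_def\<close>)
  have "\<omega> = \<omega>\<inverse> \<and> A = B"
  proof (cases "nr = nc")
    case True
    have "(0, a - 1) \<in> nr" using pos by (simp add: nr_def)
    then have "(0, a - 1) \<in> \<omega> \<or> a - 1 = 0" unfolding True by (auto simp: nc_def)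
    then have "A = 0" using Aa by (auto simp: row)
    then have "(0, 0) \<notin> \<omega>" by (simp add: row)
    then have "\<omega> = {}" using diagram_corner[OF \<omega>] by blast
    moreover from this have "B = 0" using col[of 0] by auto
    ultimately show ?thesis using \<open>A = 0\<close> by simp
  next
    case False
    have free_nr: "free_cells ?L nr = {(b - 1, 0)}"
    proof
      show "free_cells ?L nr \<subseteq> {(b - 1, 0)}"
      proof
        fix c assume c: "c \<in> free_cells ?L nr"
        obtain i j where e: "c = (i, j)" by force
        have i: "i \<noteq> 0"
        proof
          assume "i = 0"
          then have "(0, j) \<in> ?L" "(0, j) \<notin> nr" using c e by (simp_all add: free_cells_def)
          then show False by (simp add: ml nr_def)
        qed
        have "j = 0"
        proof (rule ccontr)
          assume "j \<noteq> 0"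
          then obtain j' where j: "j = Suc j'" by (cases j) auto
          then have "(i, j') \<in> \<omega>" "(Suc i, Suc j') \<notin> ?L" using c e i by (auto simp: free_cells_def nr_def)
          then show False by (simp add: ml)
        qed
        then show "c \<in> {(b - 1, 0)}" using c e by (auto simp: free_cells_def ml)
      qed
      have "b - 1 \<noteq> 0" using bb' Bb' by simp
      moreover have "(b - 1, 0) \<notin> \<omega>" using bb' Bb' by (simp add: col)
      ultimately show "{(b - 1, 0)} \<subseteq> free_cells ?L nr" using pos by (auto simp: free_cells_def ml nr_def)
    qed
    have free_nc: "free_cells ?K nc = {(B, 1)}"
    proof
      show "free_cells ?K nc \<subseteq> {(B, 1)}"
      proof
        fix c assume c: "c \<in> free_cells ?K nc"
        obtain i j where e: "c = (i, j)" by force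
        have "j \<noteq> 0"
        proof
          assume "j = 0"
          then have "(i, 0) \<in> ?K" "(i, 0) \<notin> nc" using c e by (simp_all add: free_cells_def)
          then show False by (simp add: mm nc_def)
        qed
        then obtain j' where j: "j = Suc j'" by (cases j) auto
        have "(i, j') \<notin> \<omega>" using c e j by (auto simp: free_cells_def mm)
        moreover have "(i, j') \<in> nc" using c e j by (auto simp: free_cells_def)
        ultimately have j0: "j' = 0" and iB: "B \<le> i" by (auto simp: nc_def col)
        have "i \<le> B"
        proof (cases i)
          case (Suc i')
          then have "(i', 0) \<in> \<omega>" using c e j j0 by (auto simp: free_cells_def mm)
          then show ?thesis using Suc col by simp
        qed simp
        then show "c \<in> {(B, 1)}" using e j j0 iB by simp
      qed
      have "(B, 1) \<in> ?K"
      proof (cases B)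
        case 0
        then show ?thesis using lt pos by (simp add: mm)
      next
        case (Suc B')
        then show ?thesis using col[of B'] mm(3)[of B' 0] by simp
      qed
      moreover have "(B, 0) \<notin> \<omega>" by (simp add: col)
      moreover have "(B, 1) \<notin> \<omega>" using diagram_pred_col[OF \<omega>, of B 0] col[of B] by auto
      ultimately show "{(B, 1)} \<subseteq> free_cells ?K nc"
        using Bb' mm(3)[of B 0] by (auto simp: free_cells_def nc_def)
    qed
    have w: "?wl \<nu> - ?wm \<nu> = (if \<nu> = nr then - 2 else 0) + (if \<nu> = nc then 2 else 0)" if "\<nu> \<in> ?M" for \<nu>
    proof -
      have "?wl nr = 2" "?wm nc = 2" by (simp_all add: free_nr free_nc)
      then show ?thesis
        using weights[OF that] nc_iff[OF that] False by (cases "\<nu> = nr"; cases "\<nu> = nc") simp_all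
    qed
    have "?S nr R = ?S nc R" for R
    proof -
      have "(\<Sum>\<nu>\<in>?M. (if \<nu> = nr then - 2 * ?S nr R else 0) + (if \<nu> = nc then 2 * ?S nc R else 0)) =
          (\<Sum>\<nu>\<in>?M. (?wl \<nu> - ?wm \<nu>) * ?S \<nu> R)"
        by (rule sum.cong[OF refl]) (simp add: w distrib_right)
      then show ?thesis unfolding diff using nr_M nc_M finM by (simp add: sum.distrib)
    qed
    moreover have "diagram nc" "card nc = card nr" using nc_M nr_M thick by simp_all
    ultimately have "nr = nc\<inverse>" using IH[OF nr_d _ nr_small] False by blast
    then have rc: "nr = \<omega>\<inverse> \<union> {0} \<times> {..<b'}" by (auto simp: nc_def)
    have "(0, j) \<in> nr \<longleftrightarrow> j < a" for j using Aa by (auto simp: nr_def row)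
    moreover have "(0, j) \<in> nr \<longleftrightarrow> j < b'" for j using Bb' by (auto simp: rc col)
    ultimately have "a = b'" by (metis linorder_neqE_nat order_less_irrefl)
    then have AB: "A = B" using kb Aa Bb' by (simp add: k_def)
    have "(i, j) \<in> \<omega> \<longleftrightarrow> (i, j) \<in> \<omega>\<inverse>" for i j
    proof (cases i)
      case 0
      then show ?thesis using AB by (simp add: row col)
    next
      case (Suc i')
      have "(Suc i', j) \<in> \<omega> \<longleftrightarrow> (Suc i', j) \<in> nr" by (simp add: nr_def)
      also have "\<dots> \<longleftrightarrow> (Suc i', j) \<in> \<omega>\<inverse>" unfolding rc by simp
      finally show ?thesis using Suc by simp
    qed
    then show ?thesis using AB by auto
  qed
  then have "\<omega>\<inverse> = \<omega>" "A = B" by auto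
  moreover from this have "a = b'" using kb Aa Bb' by (simp add: k_def)
  moreover from this have "a' = b" using sum by simp
  ultimately show ?thesis by (simp add: framed_converse)
qed

text \<open>
  Since the total sizes agree, the diagram with the shorter row has the longer column. The smallest
  overhang is then the row of this diagram or the column of the other one; in the second case the
  previous lemma applies to the conjugates in the opposite order.
\<close>

lemma odd_pairing_determines_same_core:
  assumes Y: "diagram Y" "Y \<noteq> {}" "card Y \<le> N" and Z: "diagram Z" "Z \<noteq> {}" "card Z = card Y"
    and core: "shrink Y = shrink Z"
    and eq: "\<And>R. odd_pairing N Y R = odd_pairing N Z R"
    and IH: "\<And>U V. diagram U \<Longrightarrow> diagram V \<Longrightarrow> card U < card Y \<Longrightarrow> card V = card U \<Longrightarrow>
       (\<And>R. odd_pairing N U R = odd_pairing N V R) \<Longrightarrow> U = V \<or> U = V\<inverse>"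
  shows "Y = Z \<or> Y = Z\<inverse>"
proof -
  have main: "Z = Y\<inverse>"
    if Y: "diagram Y" "Y \<noteq> {}" "card Y \<le> N" and Z: "diagram Z" "Z \<noteq> {}" "card Z = card Y"
      and core: "shrink Y = shrink Z" and lt: "rows_of Y 0 < rows_of Z 0"
      and eq: "\<And>R. odd_pairing N Y R = odd_pairing N Z R"
      and IH: "\<And>U V. diagram U \<Longrightarrow> diagram V \<Longrightarrow> card U < card Y \<Longrightarrow> card V = card U \<Longrightarrow>
       (\<And>R. odd_pairing N U R = odd_pairing N V R) \<Longrightarrow> U = V \<or> U = V\<inverse>" for Y Z
  proof -
    define \<omega> a b a' b' where defs: "\<omega> = shrink Y" "a = rows_of Y 0" "b = rows_of (Y\<inverse>) 0"
      "a' = rows_of Z 0" "b' = rows_of (Z\<inverse>) 0"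
    have Yf: "Y = framed \<omega> a b" and Zf: "Z = framed \<omega> a' b'" and pos: "0 < a" "0 < b" "0 < a'" "0 < b'"
      using diagram_eq_framed[OF Y(1,2)] diagram_eq_framed[OF Z(1,2)] core by (simp_all add: defs)
    have fin: "finite \<omega>" using diagram_finite diagram_shrink Y(1) by (simp add: defs(1))
    have sum: "a + b = a' + b'"
      using card_framed[OF fin pos(1,2)] card_framed[OF fin pos(3,4)] Z(3) by (simp add: Yf[symmetric] Zf[symmetric])
    have lt': "a < a'" using lt by (simp add: defs)
    show ?thesis
    proof (cases "a - rows_of \<omega> 0 \<le> b' - rows_of (\<omega>\<inverse>) 0")
      case True
      show ?thesis
        by (rule same_core_conjugate[OF _ _ pos lt' sum True, folded Yf Zf, OF Y(1) Z(1) Y(3) eq IH])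
    next
      case False
      have conv: "odd_pairing N (Z\<inverse>) R = odd_pairing N (Y\<inverse>) R" for R
        using odd_pairing_converse[OF Y(1,3)] odd_pairing_converse[OF Z(1)] Y(3) Z(3) eq by simp
      have Yc: "Y\<inverse> = framed (\<omega>\<inverse>) b a" and Zc: "Z\<inverse> = framed (\<omega>\<inverse>) b' a'"
        by (simp_all add: Yf Zf framed_converse)
      have d: "diagram (Z\<inverse>)" "diagram (Y\<inverse>)" "card (Z\<inverse>) \<le> N"
        using Y Z by (simp_all add: diagram_converse)
      have short: "b' - rows_of (\<omega>\<inverse>) 0 \<le> a - rows_of ((\<omega>\<inverse>)\<inverse>) 0" using False by simp
      have IH': "U = V \<or> U = V\<inverse>"
        if "diagram U" "diagram V" "card U < card (Z\<inverse>)" "card V = card U"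
          "\<And>R. odd_pairing N U R = odd_pairing N V R" for U V
        using IH[of U V] that Z(3) by simp
      have "b' < b" "b' + a' = b + a" using lt' sum by simp_all
      from same_core_conjugate[OF _ _ pos(4,3,2,1) this short, folded Yc Zc, OF d conv IH']
      have "Y\<inverse> = (Z\<inverse>)\<inverse>" .
      then show ?thesis by simp
    qed
  qed
  consider "rows_of Y 0 < rows_of Z 0" | "rows_of Z 0 < rows_of Y 0" | "rows_of Y 0 = rows_of Z 0"
    by linarith
  then show ?thesis
  proof cases
    case 1
    then have "Z = Y\<inverse>" by (intro main Y Z core eq IH)
    then show ?thesis by simp
  next
    case 2
    have "Y = Z\<inverse>" by (rule main[OF Z(1,2) _ Y(1,2) _ _ 2]) (use Y Z core eq IH in simp_all)
    then show ?thesis by simp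
  next
    case 3
    note Yf = diagram_eq_framed[OF Y(1,2)] and Zf = diagram_eq_framed[OF Z(1,2)]
    have fin: "finite (shrink Y)" using diagram_finite diagram_shrink Y(1) by blast
    have "card Y + 1 = rows_of Y 0 + rows_of (Y\<inverse>) 0 + card (shrink Y)"
      using card_framed[OF fin Yf(2,3)] by (simp only: Yf(1)[symmetric])
    moreover have "card Z + 1 = rows_of Z 0 + rows_of (Z\<inverse>) 0 + card (shrink Z)"
      using card_framed[OF fin[unfolded core] Zf(2,3)] by (simp only: Zf(1)[symmetric])
    ultimately have "rows_of (Y\<inverse>) 0 = rows_of (Z\<inverse>) 0" using 3 core Z(3) by simp
    then have "Y = Z" using Yf(1) Zf(1) 3 core by simp
    then show ?thesis by simp
  qed
qed

lemma odd_pairing_determines: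
  assumes "diagram Y" "diagram Z" "card Y \<le> N" "card Z = card Y"
    and "\<And>R. odd_pairing N Y R = odd_pairing N Z R"
  shows "Y = Z \<or> Y = Z\<inverse>"
  using assms
proof (induction "card Y" arbitrary: Y Z rule: less_induct)
  case less
  note Y = less.prems(1,3) and Z = less.prems(2) and eq = less.prems(5)
  have ZN: "card Z \<le> N" using less.prems by simp
  show ?case
  proof (cases "Y = {}")
    case True
    then have "Z = {}" using less.prems(4) diagram_finite[OF Z] by simp
    then show ?thesis using True by simp
  next
    case False
    then have Zne: "Z \<noteq> {}" using less.prems(4) diagram_finite[OF Y(1)] by auto
    have fin: "finite (shrink Y)" "finite (shrink Z)" using diagram_finite diagram_shrink Y(1) Z by blast+
    have "card Y - card (shrink Y) = card Z - card (shrink Z)"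
      using odd_pairing_eq_shrink(2)[OF Y(1) False Y(2) Z Zne ZN eq] fin
      by (simp add: card_Diff_subset shrink_subset Y(1) Z)
    moreover have lt: "card (shrink Y) < card Y" "card (shrink Z) < card Z"
      using card_shrink_less Y(1) False Z Zne by auto
    ultimately have "card (shrink Z) = card (shrink Y)" using less.prems(4) by simp
    then have "shrink Y = shrink Z \<or> shrink Y = (shrink Z)\<inverse>"
      using odd_pairing_eq_shrink(1)[OF Y(1) False Y(2) Z Zne ZN eq] lt(1) Y
      by (intro less.hyps) (auto simp: diagram_shrink Z)
    then show ?thesis
    proof
      assume core: "shrink Y = shrink Z"
      show ?thesis
        by (rule odd_pairing_determines_same_core[OF Y(1) False Y(2) Z Zne less.prems(4) core eq])
          (use less.hyps Y(2) in auto)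
    next
      assume core: "shrink Y = (shrink Z)\<inverse>"
      have "Y = Z\<inverse> \<or> Y = (Z\<inverse>)\<inverse>"
      proof (rule odd_pairing_determines_same_core[OF Y(1) False Y(2)])
        show "diagram (Z\<inverse>)" using Z by (simp add: diagram_converse)
        show "Z\<inverse> \<noteq> {}" using Zne by auto
        show "card (Z\<inverse>) = card Y" using less.prems(4) by simp
        show "shrink Y = shrink (Z\<inverse>)" using core by (simp add: shrink_converse)
        show "odd_pairing N Y R = odd_pairing N (Z\<inverse>) R" for R
          by (simp add: odd_pairing_converse[OF Z ZN] eq)
      qed (use less.hyps Y(2) in auto)
      then show ?thesis by auto
    qed
  qed
qed

section \<open>Specht characters on elements of odd order\<close>

lemma diagram_young_diagram:
  assumes "sorted_wrt (\<ge>) lam"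
  shows "diagram (young_diagram lam)"
  unfolding diagram_def
proof (intro conjI allI impI finite_young_diagram)
  show "(i, j) \<in> young_diagram lam" if "(Suc i, j) \<in> young_diagram lam" for i j
    using young_diagram_down_closed[OF assms that, of i j] by simp
  show "(i, j) \<in> young_diagram lam" if "(i, Suc j) \<in> young_diagram lam" for i j
    using young_diagram_down_closed[OF assms that, of i j] by simp
qed

lemma rows_of_young_diagram: "rows_of (young_diagram lam) = row_length lam"
  by (auto simp: rows_of_def mem_young_diagram)

lemma partition_eq_if_young_diagram_eq:
  assumes lam: "partition_of lam n" and mu: "partition_of mu n" and eq: "young_diagram lam = young_diagram mu"
  shows "lam = mu"
proof -
  have rows: "row_length lam i = row_length mu i" for i
    using rows_of_young_diagram[of lam] rows_of_young_diagram[of mu] eq by (metis (no_types))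
  have pos: "row_length xs i = 0 \<longleftrightarrow> length xs \<le> i" if "partition_of xs n" for xs i
    using that by (auto simp: partition_of_def row_length_def)
  have len: "length lam = length mu"
    using pos[OF lam, of "length mu"] pos[OF mu, of "length mu"] pos[OF lam, of "length lam"]
      pos[OF mu, of "length lam"] rows by auto
  moreover have "lam ! i = mu ! i" if "i < length lam" for i
    using rows[of i] that len by (simp add: row_length_def)
  ultimately show ?thesis by (rule nth_equalityI)
qed

lemma length_partition_le:
  assumes "partition_of lam n"
  shows "length lam \<le> n"
proof -
  have "\<forall>k\<in>set lam. 0 < k" "sum_list lam = n" using assms by (auto simp: partition_of_def)
  then show ?thesis
  proof (induction lam arbitrary: n)
    case (Cons x lam)
    then have "length lam \<le> sum_list lam" "0 < x" by auto
    then show ?case using Cons.prems by auto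
  qed simp
qed

text \<open>
  The integers of the combinatorial argument are, up to the order of the group, scalar products of the
  determinantal character with a class function that vanishes on elements of even order.
\<close>

lemma odd_pairing_eq_sum_characters:
  assumes lam: "partition_of lam n"
  shows "fact n * odd_pairing n (young_diagram lam) R =
    (\<Sum>g | g permutes {1..n}. (\<Sum>T\<in>splittings R. signed_young_char {1..n} T g) *
        determinantal_char {1..n} n (content_vec (row_length lam)) g)"
proof -
  have "(\<Sum>i<n. row_length lam i) = (\<Sum>i<length lam. row_length lam i)"
    using length_partition_le[OF lam] by (intro sum.mono_neutral_right) (auto simp: row_length_def)
  also have "\<dots> = n"
    using lam by (simp add: row_length_def partition_of_def sum_list_sum_nth atLeast0LessThan)
  finally have sz: "(\<Sum>i<n. content_vec (row_length lam) i) + (\<Sum>i<n. int i) = int (card {1..n})"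
    by (simp add: sum_content_vec)
  show ?thesis
    unfolding odd_pairing_def rows_of_young_diagram sum_distrib_right sum_distrib_left
    using determinantal_char_pairing[OF _ sz] by (subst sum.swap) simp
qed

theorem corollary2p7:
  fixes n :: nat and lam mu :: "nat list"
  assumes "n \<ge> 1"
    and "partition_of lam n"
    and "partition_of mu n"
    and "\<And>g. g \<in> carrier (sym_group n) \<Longrightarrow> odd (group.ord (sym_group n) g) \<Longrightarrow>
           (specht_character lam g :: 'k::field_char_0) = specht_character mu g"
  shows "lam = mu \<or> lam = conjugate mu"
proof -
  note lam = assms(2) and mu = assms(3)
  let ?X = "{1..n}"
  let ?\<psi> = "\<lambda>lam. determinantal_char ?X n (content_vec (row_length lam))"
  have odd: "?\<psi> lam g = ?\<psi> mu g" if g: "g permutes ?X" "odd (group.ord (sym_group n) g)" for g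
  proof -
    have "(of_int (?\<psi> lam g) :: 'k) = specht_character lam g"
      by (rule specht_character_determinantal[OF lam length_partition_le[OF lam] g(1), symmetric])
    also have "\<dots> = specht_character mu g" using assms(4)[of g] g by (simp add: sym_group_carrier)
    also have "\<dots> = of_int (?\<psi> mu g)"
      by (rule specht_character_determinantal[OF mu length_partition_le[OF mu] g(1)])
    finally show ?thesis by (simp only: of_int_eq_iff)
  qed
  have "odd_pairing n (young_diagram lam) R = odd_pairing n (young_diagram mu) R" for R
  proof -
    let ?\<Theta> = "\<lambda>g. \<Sum>T\<in>splittings R. signed_young_char ?X T g"
    have "?\<Theta> g * ?\<psi> lam g = ?\<Theta> g * ?\<psi> mu g" if g: "g permutes ?X" for g
    proof (cases "odd (group.ord (sym_group n) g)")
      case True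
      then show ?thesis using odd[OF g] by simp
    next
      case False
      then obtain x where "x \<in> ?X" "even (least_power g x)" using odd_ord_if_odd_orbits[OF g] by blast
      then have "?\<Theta> g = 0" by (intro sum_splittings_signed_young_char_even[OF _ g]) auto
      then show ?thesis by simp
    qed
    then have "fact n * odd_pairing n (young_diagram lam) R = fact n * odd_pairing n (young_diagram mu) R"
      unfolding odd_pairing_eq_sum_characters[OF lam] odd_pairing_eq_sum_characters[OF mu]
      by (intro sum.cong) auto
    then show ?thesis by simp
  qed
  moreover have "diagram (young_diagram lam)" "diagram (young_diagram mu)"
    using lam mu by (auto simp: partition_of_def intro!: diagram_young_diagram)
  moreover have "card (young_diagram lam) = n" "card (young_diagram mu) = n"
    using lam mu by (auto simp: partition_of_def card_young_diagram)
  ultimately have "young_diagram lam = young_diagram mu \<or> young_diagram lam = (young_diagram mu)\<inverse>"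
    by (intro odd_pairing_determines[of _ _ n]) auto
  moreover have "young_diagram (conjugate mu) = (young_diagram mu)\<inverse>"
    using young_diagram_conjugate[of mu] mu by (auto simp: partition_of_def)
  ultimately show ?thesis
    using partition_eq_if_young_diagram_eq[OF lam mu]
      partition_eq_if_young_diagram_eq[OF lam partition_of_conjugate[OF mu]] by auto
qed

end
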